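(* For all $n \in \mathbb{N}$, $$\overline{NT2}(1,5,5n+2) - \overline{NT2}(4,5,5n+2) + 2\,\overline{NT2}(2,5,5n+2) - 2\,\overline{NT2}(3,5,5n+2) \equiv 0 \pmod 5.$$
   Context: $\mathbb{N}=\{0,1,2,\dots\}$. A partition of $n$ is a non-increasing sequence of positive integers (its parts) whose sum is $n$. An overpartition of $n$ is a partition of $n$ in which the first occurrence of each number may (or may not) be overlined (e.g. there are 14 overpartitions of $4$). For an overpartition $\pi$, let $\ell(\pi)$ be the (size of the) largest part, $n(\pi)$ the number of parts, $\pi_o$ the subpartition consisting of the odd non-overlined parts of $\pi$ (so $n(\pi_o)$ is the number of odd non-overlined parts), and $\chi(\pi)=1$ if the largest part of $\pi$ is odd and non-overlined and $\chi(\pi)=0$ otherwise; here an overlined part $\overline{k}$ is regarded as larger than a non-overlined part $k$ of the same size, so the largest part is the first part in the sequence. The $M_2$-rank of $\pi$ is $$\text{$M_2$-rank}(\pi) = \left\lceil \frac{\ell(\pi)}{2}\right\rceil - n(\pi) + n(\pi_o) - \chi(\pi).$$ $\overline{NT2}(b,k,n)$ denotes the total number of parts in the overpartitions of $n$ with $M_2$-rank congruent to $b$ modulo $k$, i.e. the sum of $n(\pi)$ over all overpartitions $\pi$ of $n$ whose $M_2$-rank is $\equiv b \pmod k$. *)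

theory Defs
  imports Complex_Main "HOL-Number_Theory.Cong"
begin

definition is_partition :: "nat \<Rightarrow> nat list \<Rightarrow> bool" where
  "is_partition n xs \<longleftrightarrow> sorted_wrt (\<ge>) xs \<and> (\<forall>x\<in>set xs. 0 < x) \<and> sum_list xs = n"

text \<open>A part \<open>(k, v)\<close> of an overpartition has size \<open>k\<close> and is overlined iff \<open>v\<close> holds.\<close>

type_synonym part = "nat \<times> bool"

abbreviation part_size :: "part \<Rightarrow> nat" where
  "part_size \<equiv> fst"

abbreviation overlined :: "part \<Rightarrow> bool" where
  "overlined \<equiv> snd"

definition overpartitions :: "nat \<Rightarrow> part list set" where
  "overpartitions n = {\<pi>. is_partition n (map part_size \<pi>) \<and>
     (\<forall>i<length \<pi>. overlined (\<pi> ! i) \<longrightarrow> (\<forall>j<i. part_size (\<pi> ! j) \<noteq> part_size (\<pi> ! i)))}"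

definition odd_nonoverlined :: "part \<Rightarrow> bool" where
  "odd_nonoverlined p \<longleftrightarrow> odd (part_size p) \<and> \<not> overlined p"

text \<open>An overlined \<open>k\<close> counts as larger than a non-overlined \<open>k\<close>, and only the first occurrence
  of a size can be overlined, so the largest part is the head of the list. The empty
  overpartition has no largest part; there both functions below are 0 by convention.\<close>

definition largest_part_size :: "part list \<Rightarrow> nat" where
  "largest_part_size \<pi> = (if \<pi> = [] then 0 else part_size (hd \<pi>))"

definition chi :: "part list \<Rightarrow> nat" where
  "chi \<pi> = (if \<pi> \<noteq> [] \<and> odd_nonoverlined (hd \<pi>) then 1 else 0)"

definition M2_rank :: "part list \<Rightarrow> int" where
  "M2_rank \<pi> = \<lceil>real (largest_part_size \<pi>) / 2\<rceil> - int (length \<pi>)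
     + int (length (filter odd_nonoverlined \<pi>)) - int (chi \<pi>)"

definition NT2 :: "int \<Rightarrow> int \<Rightarrow> nat \<Rightarrow> nat" where
  "NT2 b k n = (\<Sum>\<pi> | \<pi> \<in> overpartitions n \<and> [M2_rank \<pi> = b] (mod k). length \<pi>)"

lemma length_le_sum_list:
  fixes xs :: "nat list"
  assumes "\<forall>x\<in>set xs. 0 < x"
  shows "length xs \<le> sum_list xs"
  using assms by (induction xs) auto

text \<open>Finiteness ensures that the sum defining \<open>NT2\<close> is a genuine finite sum.\<close>

lemma finite_overpartitions: "finite (overpartitions n)"
proof (rule finite_subset)
  show "overpartitions n \<subseteq> {\<pi>. set \<pi> \<subseteq> {..n} \<times> UNIV \<and> length \<pi> \<le> n}"
  proof
    fix \<pi> assume "\<pi> \<in> overpartitions n"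
    then have pos: "\<forall>x\<in>set (map part_size \<pi>). 0 < x"
      and sum: "sum_list (map part_size \<pi>) = n"
      unfolding overpartitions_def is_partition_def by simp_all
    have "length \<pi> \<le> n"
      using length_le_sum_list[OF pos] sum by simp
    moreover have "part_size p \<le> n" if "p \<in> set \<pi>" for p
      using member_le_sum_list[of "part_size p" "map part_size \<pi>"] that sum by simp
    ultimately show "\<pi> \<in> {\<pi>. set \<pi> \<subseteq> {..n} \<times> UNIV \<and> length \<pi> \<le> n}"
      by (auto simp: mem_Times_iff)
  qed
  show "finite {\<pi>. set \<pi> \<subseteq> {..n} \<times> (UNIV :: bool set) \<and> length \<pi> \<le> n}"
    by (rule finite_lists_length_le) simp
qed

end

theory Submission
  imports Defs "HOL-Computational_Algebra.Formal_Power_Series" "Berlekamp_Zassenhaus.Finite_Field"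
begin

text \<open>
  The weights $1, 2, -2, -1$ are congruent to the residues $1, 2, 3, 4$ modulo 5, so the combination is
  congruent to the sum of $n(\pi) r(\pi)$ over the overpartitions of $5n+2$, where $r$ is the $M_2$-rank;
  this sum is studied over a field of characteristic 5. Let $o(\pi)$ count the odd non-overlined parts and
  write $r = L - e$ with $n = e + o$. The statistics $L + o = n + r$ and $n$ are equidistributed, since their
  bivariate generating functions solve the same $q$-difference equation; hence $2 \sum n r = - \sum r^2$.
  A $q$-difference equation for the overpartitions with $L \le m$, refined by $e$, determines the rank
  generating function and gives $P \varphi = 1$ and $\sum n r\, q^{|\pi|} = P M$, where $P$ counts
  overpartitions, $\varphi = \sum (-1)^n q^{n^2}$ and
  $M = \sum_{n \ne 0} (-1)^n q^{n^2+2n} / (1 - q^{2n})^2$.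
  The moments (in $N$) of a lattice sum over $q^{(N-n)^2+n^2}$ relate $M$ to
  $\Lambda_j = \sum_{n \ne 0} (-1)^n n^j q^{n^2} (1 + q^{2n}) / (1 - q^{2n})$. In characteristic 5 we have
  $\Lambda_5 = \Lambda_1$, which closes the system to a differential equation for $P \Lambda_1$. There and in
  $P = (q^2)_\infty / (q)_\infty^2$, rewritten by Jacobi's identity for $(q)_\infty^3$, only few residue
  classes of exponents modulo 5 occur, and the coefficients of $P M$ in the class of 2 cancel.
\<close>

unbundle fps_syntax

section \<open>Locally finite sums of power series\<close>

text \<open>The length $n = e + o$ is not determined by $L$ and $e$, so a generating function in
  these two statistics cannot see $n r$; equidistribution trades the mixed moment for the second
  moment of the rank alone. Neither $M$ nor \<Lambda>_1 is a product or a theta function, so the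
  residue classes of their exponents cannot be read off directly. Characteristic 5 supplies three
  tools. Fifth powers are series in $q^5$, so multiplying by them clears denominators without mixing
  residue classes. The operator $D = q d/dq$ acts as a scalar on a series whose exponents lie in one
  residue class. And $n^5 = n$ stops the hierarchy of moments, where each derivative would otherwise
  bring in a new unknown. The lattice sum has an unknown constant of its own; it is a Lambert
  series, in characteristic 5 the logarithmic derivative of $(q^2)_{inf}^3$, and this is why
  Jacobi's identity enters.\<close>

class char5_field = field +
  assumes five_eq_0: "5 = 0"

lemma two_neq_0: "(2::'a::char5_field) \<noteq> 0"
proof
  assume h: "(2::'a) = 0"
  have "(5::'a) = 2 * 2 + 1" by simp
  then show False using h five_eq_0[where 'a='a] by simp
qed

section \<open>The operator $D = q d/dq$ on formal power series\<close>

definition euler :: "'a::semiring_1 fps \<Rightarrow> 'a fps"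
  where "euler f = Abs_fps (\<lambda>n. of_nat n * f $ n)"

lemma euler_nth [simp]: "euler f $ n = of_nat n * f $ n"
  by (simp add: euler_def)

lemma euler_conv_deriv: "euler f = fps_X * fps_deriv (f::'a::comm_ring_1 fps)"
  by (rule fps_ext) (auto simp: fps_mult_fps_X_commute split: nat.splits)

lemma euler_add [simp]: "euler (f + g) = euler f + euler (g::'a::comm_ring_1 fps)"
  and euler_diff [simp]: "euler (f - g) = euler f - euler g"
  and euler_uminus [simp]: "euler (- g) = - euler g"
  and euler_0 [simp]: "euler 0 = (0 :: 'a fps)"
  by (rule fps_ext; simp add: algebra_simps)+

lemma euler_1 [simp]: "euler 1 = (0 :: 'a::comm_ring_1 fps)"
  by (rule fps_ext) simp

lemma euler_mult: "euler (f * g) = euler f * g + f * euler (g::'a::comm_ring_1 fps)"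
  by (simp add: euler_conv_deriv algebra_simps)

lemma euler_power: "euler (f ^ n) = of_nat n * f ^ (n - 1) * euler (f::'a::comm_ring_1 fps)"
  by (simp add: euler_conv_deriv fps_deriv_power' mult_ac)

lemma euler_of_nat [simp]: "euler (of_nat k) = (0 :: 'a::comm_ring_1 fps)"
  by (induction k) simp_all

lemma euler_X_power: "euler (fps_X ^ n) = of_nat n * (fps_X ^ n :: 'a::comm_ring_1 fps)"
proof (induction n)
  case (Suc n)
  have "euler fps_X = (fps_X :: 'a fps)" by (simp add: euler_conv_deriv)
  then show ?case using Suc by (simp add: euler_mult algebra_simps)
qed simp

text \<open>Local finiteness replaces convergence: each coefficient receives finitely many
  contributions, so \<open>fsum\<close> is an algebraic sum over an arbitrary index set, with no
  order of summation involved.\<close>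

definition locfin :: "('i \<Rightarrow> 'a::zero fps) \<Rightarrow> 'i set \<Rightarrow> bool"
  where "locfin f I \<longleftrightarrow> (\<forall>n. finite {i\<in>I. f i $ n \<noteq> 0})"

definition fsum :: "('i \<Rightarrow> 'a::comm_monoid_add fps) \<Rightarrow> 'i set \<Rightarrow> 'a fps"
  where "fsum f I = Abs_fps (\<lambda>n. \<Sum>i | i \<in> I \<and> f i $ n \<noteq> 0. f i $ n)"

text \<open>Any finite set that contains all contributing indices will do, so that several sums can
  be evaluated over one common set.\<close>

lemma fsum_nth:
  assumes "finite A" "A \<subseteq> I" "\<And>i. i \<in> I - A \<Longrightarrow> f i $ n = 0"
  shows "fsum f I $ n = (\<Sum>i\<in>A. f i $ n)"
  unfolding fsum_def using assms by (auto intro!: sum.mono_neutral_left)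

lemma locfin_nth:
  assumes "locfin f I" "locfin g I"
  obtains A where "finite A" "A \<subseteq> I" "\<And>i k. i \<in> I - A \<Longrightarrow> k \<le> n \<Longrightarrow> f i $ k = 0"
    "\<And>i k. i \<in> I - A \<Longrightarrow> k \<le> n \<Longrightarrow> g i $ k = 0"
proof -
  let ?A = "(\<Union>k\<le>n. {i\<in>I. f i $ k \<noteq> 0}) \<union> (\<Union>k\<le>n. {i\<in>I. g i $ k \<noteq> 0})"
  show ?thesis
    by (rule that[of ?A]) (use assms in \<open>auto simp: locfin_def\<close>)
qed

lemma locfin_obtain:
  assumes "locfin f I"
  obtains A where "finite A" "A \<subseteq> I" "\<And>i k. i \<in> I - A \<Longrightarrow> k \<le> n \<Longrightarrow> f i $ k = 0"
    "\<And>k. k \<le> n \<Longrightarrow> fsum f I $ k = (\<Sum>i\<in>A. f i $ k)"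
proof -
  obtain A where A: "finite A" "A \<subseteq> I" "\<And>i k. i \<in> I - A \<Longrightarrow> k \<le> n \<Longrightarrow> f i $ k = 0"
    using locfin_nth[OF assms assms] by metis
  show ?thesis
    by (rule that[of A]) (use A in \<open>auto intro: fsum_nth\<close>)
qed

lemma locfin_add: "locfin f I \<Longrightarrow> locfin g I \<Longrightarrow> locfin (\<lambda>i. f i + g i :: 'a::comm_monoid_add fps) I"
  unfolding locfin_def
proof
  fix n assume "\<forall>n. finite {i \<in> I. f i $ n \<noteq> 0}" "\<forall>n. finite {i \<in> I. g i $ n \<noteq> 0}"
  then have "finite ({i \<in> I. f i $ n \<noteq> 0} \<union> {i \<in> I. g i $ n \<noteq> 0})" by simp
  then show "finite {i \<in> I. (f i + g i) $ n \<noteq> 0}" by (rule finite_subset[rotated]) auto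
qed

lemma locfin_mult: 
  assumes "locfin f I" shows "locfin (\<lambda>i. c i * f i :: 'a::comm_ring_1 fps) I"
  unfolding locfin_def
proof
  fix n
  have fin: "finite (\<Union>k\<le>n. {i\<in>I. f i $ k \<noteq> 0})"
    using assms by (simp add: locfin_def)
  show "finite {i \<in> I. (c i * f i) $ n \<noteq> 0}"
  proof (rule finite_subset[OF _ fin], safe)
    fix i assume i: "i \<in> I" "(c i * f i) $ n \<noteq> 0"
    then obtain j where "j \<in> {0..n}" "c i $ j * f i $ (n - j) \<noteq> 0"
      by (auto simp: fps_mult_nth elim: sum.not_neutral_contains_not_neutral)
    then show "i \<in> (\<Union>k\<le>n. {i\<in>I. f i $ k \<noteq> 0})"
      using i by (auto intro!: bexI[of _ "n - j"])
  qed
qed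

lemma locfin_mono:
  assumes "locfin f I" "J \<subseteq> I" "\<And>i n. i \<in> J \<Longrightarrow> f i $ n = 0 \<Longrightarrow> g i $ n = 0"
  shows "locfin g J"
  unfolding locfin_def
proof
  fix n
  have "finite {i \<in> I. f i $ n \<noteq> 0}" using assms(1) by (simp add: locfin_def)
  then show "finite {i \<in> J. g i $ n \<noteq> 0}"
    by (rule finite_subset[rotated]) (use assms in auto)
qed

lemma locfin_subset: "locfin f I \<Longrightarrow> J \<subseteq> I \<Longrightarrow> locfin f J"
  by (rule locfin_mono) auto

lemma fsum_cong: "(\<And>i. i \<in> I \<Longrightarrow> f i = g i) \<Longrightarrow> fsum f I = fsum g I"
  unfolding fsum_def by (intro arg_cong[of _ _ Abs_fps] ext sum.cong) auto

lemma fsum_add: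
  assumes "locfin f I" "locfin g I"
  shows "fsum (\<lambda>i. f i + g i) I = fsum f I + fsum g I"
proof (rule fps_ext)
  fix n
  obtain A where A: "finite A" "A \<subseteq> I" "\<And>i k. i \<in> I - A \<Longrightarrow> k \<le> n \<Longrightarrow> f i $ k = 0"
    "\<And>i k. i \<in> I - A \<Longrightarrow> k \<le> n \<Longrightarrow> g i $ k = 0" using locfin_nth[OF assms] by metis
  have "fsum (\<lambda>i. f i + g i) I $ n = (\<Sum>i\<in>A. (f i + g i) $ n)"
    by (rule fsum_nth) (use A in auto)
  moreover have "fsum f I $ n = (\<Sum>i\<in>A. f i $ n)" "fsum g I $ n = (\<Sum>i\<in>A. g i $ n)"
    by (rule fsum_nth; use A in auto)+
  ultimately show "fsum (\<lambda>i. f i + g i) I $ n = (fsum f I + fsum g I) $ n"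
    by (simp add: sum.distrib)
qed

lemma fsum_mult:
  fixes c :: "'a::comm_ring_1 fps"
  assumes "locfin f I"
  shows "fsum (\<lambda>i. c * f i) I = c * fsum f I"
proof (rule fps_ext)
  fix n
  obtain A where A: "finite A" "A \<subseteq> I" "\<And>i k. i \<in> I - A \<Longrightarrow> k \<le> n \<Longrightarrow> f i $ k = 0"
    "\<And>k. k \<le> n \<Longrightarrow> fsum f I $ k = (\<Sum>i\<in>A. f i $ k)"
    using locfin_obtain[OF assms] by metis
  have "fsum (\<lambda>i. c * f i) I $ n = (\<Sum>i\<in>A. (c * f i) $ n)"
    by (rule fsum_nth) (use A in \<open>auto simp: fps_mult_nth\<close>)
  also have "\<dots> = (\<Sum>j=0..n. c $ j * (\<Sum>i\<in>A. f i $ (n - j)))"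
    by (simp add: fps_mult_nth sum_distrib_left sum.swap[of _ A])
  also have "\<dots> = (c * fsum f I) $ n"
    unfolding fps_mult_nth by (intro sum.cong refl) (use A(4) in auto)
  finally show "fsum (\<lambda>i. c * f i) I $ n = (c * fsum f I) $ n" .
qed

lemma fsum_uminus:
  fixes f :: "'i \<Rightarrow> 'a::comm_ring_1 fps"
  shows "locfin f I \<Longrightarrow> fsum (\<lambda>i. - f i) I = - fsum f I"
  using fsum_mult[of f I "-1"] by simp

lemma fsum_diff:
  assumes "locfin f I" "locfin g I"
  shows "fsum (\<lambda>i. f i - g i) I = fsum f I - fsum (g :: 'i \<Rightarrow> 'a::comm_ring_1 fps) I"
  using fsum_add[OF assms(1) locfin_mult[OF assms(2), of "\<lambda>_. -1"]] fsum_mult[OF assms(2), of "-1"] by simp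

lemma fsum_euler:
  fixes f :: "'i \<Rightarrow> 'a::comm_ring_1 fps"
  assumes "locfin f I"
  shows "euler (fsum f I) = fsum (\<lambda>i. euler (f i)) I"
proof (rule fps_ext)
  fix n
  obtain A where A: "finite A" "A \<subseteq> I" "\<And>i k. i \<in> I - A \<Longrightarrow> k \<le> n \<Longrightarrow> f i $ k = 0"
    "\<And>k. k \<le> n \<Longrightarrow> fsum f I $ k = (\<Sum>i\<in>A. f i $ k)"
    using locfin_obtain[OF assms] by metis
  have "fsum (\<lambda>i. euler (f i)) I $ n = (\<Sum>i\<in>A. euler (f i) $ n)"
    by (rule fsum_nth) (use A in auto)
  then show "euler (fsum f I) $ n = fsum (\<lambda>i. euler (f i)) I $ n"
    by (simp add: A(4) sum_distrib_left)
qed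

lemma fsum_reindex:
  assumes "bij_betw h J I"
  shows "fsum f I = fsum (\<lambda>j. f (h j)) J"
proof (rule fps_ext)
  fix n
  have "bij_betw h {j \<in> J. f (h j) $ n \<noteq> 0} {i \<in> I. f i $ n \<noteq> 0}"
    using assms by (auto simp: bij_betw_def inj_on_def)
  from sum.reindex_bij_betw[OF this, of "\<lambda>i. f i $ n"]
  show "fsum f I $ n = fsum (\<lambda>j. f (h j)) J $ n"
    by (simp add: fsum_def)
qed

lemma locfin_reindex:
  assumes "locfin f I" "bij_betw h J I"
  shows "locfin (\<lambda>j. f (h j)) J"
  unfolding locfin_def
proof
  fix n
  have "bij_betw h {j \<in> J. f (h j) $ n \<noteq> 0} {i \<in> I. f i $ n \<noteq> 0}"
    using assms(2) by (auto simp: bij_betw_def inj_on_def)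
  then show "finite {j \<in> J. f (h j) $ n \<noteq> 0}"
    using assms(1) by (auto simp: locfin_def bij_betw_finite)
qed

lemma fsum_insert:
  assumes "locfin f (insert a I)" "a \<notin> I"
  shows "fsum f (insert a I) = f a + fsum f I"
proof (rule fps_ext)
  fix n
  obtain A where A: "finite A" "A \<subseteq> insert a I" "\<And>i k. i \<in> insert a I - A \<Longrightarrow> k \<le> n \<Longrightarrow> f i $ k = 0"
    using locfin_nth[OF assms(1) assms(1)] by metis
  have "fsum f (insert a I) $ n = (\<Sum>i\<in>insert a (A - {a}). f i $ n)"
    by (rule fsum_nth) (use A in auto)
  moreover have "fsum f I $ n = (\<Sum>i\<in>A - {a}. f i $ n)"
    by (rule fsum_nth) (use A assms(2) in auto)
  moreover have "(\<Sum>i\<in>insert a (A - {a}). f i $ n) = f a $ n + (\<Sum>i\<in>A - {a}. f i $ n)"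
    by (rule sum.insert) (use A(1) in auto)
  ultimately show "fsum f (insert a I) $ n = (f a + fsum f I) $ n"
    by simp
qed

lemma fsum_zero [simp]: "fsum (\<lambda>i. 0) I = 0"
  by (rule fps_ext) (simp add: fsum_def)

lemma locfin_Times_obtain:
  fixes f :: "'i \<Rightarrow> 'a::comm_ring_1 fps"
  assumes "locfin f I" "locfin g J"
  obtains A B where "finite A" "finite B" "A \<subseteq> I" "B \<subseteq> J"
    "\<And>k. k \<le> n \<Longrightarrow> fsum f I $ k = (\<Sum>i\<in>A. f i $ k)" "\<And>k. k \<le> n \<Longrightarrow> fsum g J $ k = (\<Sum>i\<in>B. g i $ k)"
    "\<And>p. p \<in> I \<times> J - A \<times> B \<Longrightarrow> (case p of (i, j) \<Rightarrow> f i * g j) $ n = 0"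
proof -
  obtain A where A: "finite A" "A \<subseteq> I" "\<And>i k. i \<in> I - A \<Longrightarrow> k \<le> n \<Longrightarrow> f i $ k = 0"
    "\<And>k. k \<le> n \<Longrightarrow> fsum f I $ k = (\<Sum>i\<in>A. f i $ k)"
    using locfin_obtain[OF assms(1)] by metis
  obtain B where B: "finite B" "B \<subseteq> J" "\<And>i k. i \<in> J - B \<Longrightarrow> k \<le> n \<Longrightarrow> g i $ k = 0"
    "\<And>k. k \<le> n \<Longrightarrow> fsum g J $ k = (\<Sum>i\<in>B. g i $ k)"
    using locfin_obtain[OF assms(2)] by metis
  have "(case p of (i, j) \<Rightarrow> f i * g j) $ n = 0" if "p \<in> I \<times> J - A \<times> B" for p
  proof -
    obtain i j where p: "p = (i, j)" "i \<in> I" "j \<in> J" "i \<notin> A \<or> j \<notin> B" using \<open>p \<in> _\<close> by auto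
    have "f i $ k * g j $ (n - k) = 0" if "k \<le> n" for k
      using p that A(3)[of i k] B(3)[of j "n - k"] by auto
    then show ?thesis by (simp add: p(1) fps_mult_nth)
  qed
  then show ?thesis using A B that[of A B] by blast
qed

lemma locfin_Times:
  assumes "locfin f I" "locfin g J"
  shows "locfin (\<lambda>(i,j). f i * g j :: 'a::comm_ring_1 fps) (I \<times> J)"
  unfolding locfin_def
proof
  fix n
  obtain A B where AB: "finite A" "finite B"
    "\<And>p. p \<in> I \<times> J - A \<times> B \<Longrightarrow> (case p of (i, j) \<Rightarrow> f i * g j) $ n = 0"
    using locfin_Times_obtain[OF assms] by metis
  have "finite (A \<times> B)" using AB by simp
  then show "finite {p \<in> I \<times> J. (case p of (i,j) \<Rightarrow> f i * g j) $ n \<noteq> 0}"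
    by (rule finite_subset[rotated]) (use AB(3) in blast)
qed

lemma fsum_Times:
  assumes "locfin f I" "locfin g J"
  shows "fsum (\<lambda>(i,j). f i * g j :: 'a::comm_ring_1 fps) (I \<times> J) = fsum f I * fsum g J"
proof (rule fps_ext)
  fix n
  obtain A B where AB: "finite A" "finite B" "A \<subseteq> I" "B \<subseteq> J"
    "\<And>k. k \<le> n \<Longrightarrow> fsum f I $ k = (\<Sum>i\<in>A. f i $ k)" "\<And>k. k \<le> n \<Longrightarrow> fsum g J $ k = (\<Sum>i\<in>B. g i $ k)"
    "\<And>p. p \<in> I \<times> J - A \<times> B \<Longrightarrow> (case p of (i, j) \<Rightarrow> f i * g j) $ n = 0"
    using locfin_Times_obtain[OF assms] by metis
  have "fsum (\<lambda>(i,j). f i * g j) (I \<times> J) $ n = (\<Sum>p\<in>A \<times> B. (case p of (i,j) \<Rightarrow> f i * g j) $ n)"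
    by (rule fsum_nth) (use AB in blast)+
  also have "\<dots> = (\<Sum>(i,j)\<in>A \<times> B. \<Sum>k=0..n. f i $ k * g j $ (n - k))"
    by (intro sum.cong refl) (auto simp: fps_mult_nth)
  also have "\<dots> = (\<Sum>k=0..n. (\<Sum>(i,j)\<in>A \<times> B. f i $ k * g j $ (n - k)))"
    by (simp add: case_prod_unfold sum.swap[of _ "A \<times> B"])
  also have "\<dots> = (\<Sum>k=0..n. fsum f I $ k * fsum g J $ (n - k))"
    by (intro sum.cong refl) (simp add: AB(5,6) sum_product sum.cartesian_product)
  finally show "fsum (\<lambda>(i,j). f i * g j) (I \<times> J) $ n = (fsum f I * fsum g J) $ n"
    by (simp add: fps_mult_nth)
qed

lemma locfin_fsum:
  assumes "locfin (\<lambda>(i,j). f i j) (I \<times> J)"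
  shows "locfin (\<lambda>i. fsum (f i) J) I"
  unfolding locfin_def
proof
  fix n
  have fin: "finite (fst ` {p \<in> I \<times> J. (case p of (i,j) \<Rightarrow> f i j) $ n \<noteq> 0})"
    using assms by (auto simp: locfin_def)
  show "finite {i \<in> I. fsum (f i) J $ n \<noteq> 0}"
  proof (rule finite_subset[OF _ fin], safe)
    fix i assume "i \<in> I" "fsum (f i) J $ n \<noteq> 0"
    then obtain j where "j \<in> J" "f i j $ n \<noteq> 0"
      by (auto simp: fsum_def elim: sum.not_neutral_contains_not_neutral)
    with \<open>i \<in> I\<close> show "i \<in> fst ` {p \<in> I \<times> J. (case p of (i,j) \<Rightarrow> f i j) $ n \<noteq> 0}" by force
  qed
qed

text \<open>Fubini's theorem. Joint local finiteness confines the contributions to one coefficient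
  to a finite rectangle \<open>A \<times> B\<close>, where finite sums may be exchanged.\<close>

lemma fsum_fsum:
  assumes "locfin (\<lambda>(i,j). f i j) (I \<times> J)"
  shows "fsum (\<lambda>i. fsum (f i) J) I = fsum (\<lambda>(i,j). f i j) (I \<times> J)"
proof (rule fps_ext)
  fix n
  let ?S = "{p \<in> I \<times> J. (case p of (i,j) \<Rightarrow> f i j) $ n \<noteq> 0}"
  have fin: "finite ?S" using assms by (auto simp: locfin_def)
  define A where "A = fst ` ?S"
  define B where "B = snd ` ?S"
  have AB: "finite A" "finite B" "A \<subseteq> I" "B \<subseteq> J" using fin by (auto simp: A_def B_def)
  have z: "f i j $ n = 0" if "i \<in> I" "j \<in> J" "(i,j) \<notin> A \<times> B" for i j
  proof (rule ccontr)
    assume "f i j $ n \<noteq> 0"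
    then have "(i,j) \<in> ?S" using that by auto
    then have "i \<in> A" "j \<in> B" unfolding A_def B_def by force+
    then show False using that by auto
  qed
  have "fsum (\<lambda>(i,j). f i j) (I \<times> J) $ n = (\<Sum>p\<in>A \<times> B. (case p of (i,j) \<Rightarrow> f i j) $ n)"
  proof (rule fsum_nth)
    fix p assume "p \<in> I \<times> J - A \<times> B"
    then show "(case p of (i,j) \<Rightarrow> f i j) $ n = 0" using z by (cases p) simp
  qed (use AB in blast)+
  also have "\<dots> = (\<Sum>(i,j)\<in>A \<times> B. f i j $ n)"
    by (intro sum.cong refl) auto
  also have "\<dots> = (\<Sum>i\<in>A. fsum (f i) J $ n)"
  proof (subst sum.cartesian_product[symmetric], intro sum.cong refl)
    fix i assume "i \<in> A"
    then show "(\<Sum>j\<in>B. f i j $ n) = fsum (f i) J $ n"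
      by (subst fsum_nth[of B]) (use AB z in auto)
  qed
  also have "\<dots> = fsum (\<lambda>i. fsum (f i) J) I $ n"
  proof (rule fsum_nth[symmetric])
    fix i assume i: "i \<in> I - A"
    then have "fsum (f i) J $ n = (\<Sum>j\<in>{}. f i j $ n)"
      by (intro fsum_nth) (use z in auto)
    then show "fsum (f i) J $ n = 0" by simp
  qed (use AB in auto)
  finally show "fsum (\<lambda>i. fsum (f i) J) I $ n = fsum (\<lambda>(i,j). f i j) (I \<times> J) $ n" by simp
qed

lemma locfin_X_power:
  assumes "\<And>k. finite {i \<in> I. e i \<le> (k::nat)}"
  shows "locfin (\<lambda>i. fps_X ^ e i * h i :: 'a::comm_ring_1 fps) I"
  unfolding locfin_def
proof
  fix n
  show "finite {i \<in> I. (fps_X ^ e i * h i) $ n \<noteq> 0}"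
    by (rule finite_subset[OF _ assms[of n]]) (auto simp: fps_X_power_mult_nth split: if_splits)
qed

section \<open>A lattice sum and its moments\<close>

lemma locfin_sum:
  assumes "finite S" "\<And>s. s \<in> S \<Longrightarrow> locfin (f s) I"
  shows "locfin (\<lambda>i. \<Sum>s\<in>S. f s i :: 'a::comm_ring_1 fps) I"
    and "fsum (\<lambda>i. \<Sum>s\<in>S. f s i) I = (\<Sum>s\<in>S. fsum (f s) I)"
proof -
  have "locfin (\<lambda>i. \<Sum>s\<in>S. f s i) I \<and> fsum (\<lambda>i. \<Sum>s\<in>S. f s i) I = (\<Sum>s\<in>S. fsum (f s) I)"
    using assms
  proof (induction S rule: finite_induct)
    case empty
    then show ?case by (simp add: locfin_def)
  next
    case (insert x S)
    then show ?case by (auto simp: fsum_add intro!: locfin_add)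
  qed
  then show "locfin (\<lambda>i. \<Sum>s\<in>S. f s i) I" "fsum (\<lambda>i. \<Sum>s\<in>S. f s i) I = (\<Sum>s\<in>S. fsum (f s) I)"
    by auto
qed

text \<open>Reindexing by \<open>h\<close> shows that the sum is its own negative, and 2 is
  invertible.\<close>

lemma fsum_odd:
  fixes f :: "int \<Rightarrow> 'a::char5_field fps"
  assumes "locfin f I" "bij_betw h I I" "\<And>n. n \<in> I \<Longrightarrow> f (h n) = - f n"
  shows "fsum f I = 0"
proof -
  have "fsum f I = fsum (\<lambda>n. - f n) I"
    using fsum_reindex[OF assms(2), of f] fsum_cong[of I "\<lambda>n. f (h n)" "\<lambda>n. - f n"] assms(3) by simp
  then have "fsum f I = - fsum f I" using fsum_uminus[OF assms(1)] by simp
  then have "2 * fsum f I = 0" by (metis add.right_inverse mult_2)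
  moreover have "fps_const (2::'a) \<noteq> 0" by (simp add: two_neq_0)
  ultimately show ?thesis by (simp add: numeral_fps_const)
qed

lemma finite_int_sq: "finite {n \<in> I. nat (n\<^sup>2) \<le> (k::nat)}"
proof (rule finite_subset[of _ "{- int k..int k}"])
  have "\<bar>n\<bar> \<le> int k" if "nat (n\<^sup>2) \<le> k" for n :: int
  proof (cases "n = 0")
    case False
    then have "\<bar>n\<bar> * 1 \<le> \<bar>n\<bar> * \<bar>n\<bar>" by (intro mult_left_mono) auto
    then show ?thesis using that by (simp add: power2_eq_square nat_le_iff)
  qed auto
  then show "{n \<in> I. nat (n\<^sup>2) \<le> k} \<subseteq> {- int k..int k}" by (force simp: abs_le_iff)
qed simp

definition alt_sign :: "int \<Rightarrow> 'a::comm_ring_1"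
  where "alt_sign n = (if even n then 1 else - 1)"

lemma alt_sign_add: "alt_sign (m + n) = alt_sign m * alt_sign n"
  by (auto simp: alt_sign_def)

lemma alt_sign_0 [simp]: "alt_sign 0 = 1" and alt_sign_minus [simp]: "alt_sign (- n) = alt_sign n"
  by (auto simp: alt_sign_def)

definition gauss :: "int \<Rightarrow> 'a::char5_field fps"
  where "gauss n = alt_sign n * fps_X ^ nat (n\<^sup>2)"

text \<open>In \<open>vker\<close>, the function $(1 + q^{2n}) / (1 - q^{2n})$ is expanded at $q = 0$ also for negative \<open>n\<close>,
  which makes it odd; \<open>bker\<close> is the even function $q^{2n} / (1 - q^{2n})^2$.\<close>

definition qabs :: "int \<Rightarrow> 'a::char5_field fps"
  where "qabs n = fps_X ^ nat (2 * \<bar>n\<bar>)"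

definition geom :: "int \<Rightarrow> 'a::char5_field fps"
  where "geom n = inverse (1 - qabs n)"

definition vker :: "int \<Rightarrow> 'a::char5_field fps"
  where "vker n = of_int (sgn n) * (1 + qabs n) * geom n"

definition bker :: "int \<Rightarrow> 'a::char5_field fps"
  where "bker n = qabs n * geom n * geom n"

lemma geom_eq: "n \<noteq> 0 \<Longrightarrow> geom n * (1 - qabs n) = 1"
  unfolding geom_def by (rule inverse_mult_eq_1) (simp add: qabs_def)

lemma minus_simps [simp]: "gauss (- n) = gauss n" "qabs (- n) = qabs n" "geom (- n) = geom n" "vker (- n) = - vker n" "bker (- n) = bker n"
  by (simp_all add: gauss_def qabs_def geom_def vker_def bker_def sgn_minus)

text \<open>Shaped so that passing from $N$ to $N + 1$ produces a factor $1 - q^{2n}$ that cancels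
  the denominators. The shift also lowers the coefficient $2n - N$ by 1 and leaves a stray
  \<open>- vker n\<close>; the summand \<open>2 * bker n\<close> compensates it, since for positive
  $n$ we have $-v + 2 (1 - q^{2n}) b = -1$, with $v$ and $b$ the two kernels.\<close>

definition lattice_term :: "int \<Rightarrow> int \<Rightarrow> 'a::char5_field fps"
  where "lattice_term N n = fps_X ^ nat ((N - n)\<^sup>2 + n\<^sup>2) * (of_int (2 * n - N) * vker n + 2 * bker n)"

lemma finite_sq_add: "finite {n \<in> I. nat ((N - n)\<^sup>2 + n\<^sup>2) \<le> (k::nat)}" for N :: int
proof (rule finite_subset[OF _ finite_int_sq[of I k]], safe)
  fix n assume "nat ((N - n)\<^sup>2 + n\<^sup>2) \<le> k"
  moreover have "nat (n\<^sup>2) \<le> nat ((N - n)\<^sup>2 + n\<^sup>2)" by (rule nat_mono) simp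
  ultimately show "nat (n\<^sup>2) \<le> k" by linarith
qed

lemma locfin_lattice_term: "locfin (lattice_term N) I"
  unfolding lattice_term_def by (rule locfin_X_power) (rule finite_sq_add)

lemma nat_add_eqI: "0 \<le> a \<Longrightarrow> 0 \<le> b \<Longrightarrow> 0 \<le> c \<Longrightarrow> 0 \<le> d \<Longrightarrow> a + b = c + d \<Longrightarrow> nat a + nat b = nat c + nat d"
  by linarith

text \<open>The right-hand side is antisymmetric after summation, so that the sum over \<open>n\<close> is determined by a
  first-order recurrence in \<open>N\<close>.\<close>

lemma lattice_term_step:
  assumes "n \<noteq> 0" "N \<ge> 0"
  shows "lattice_term (N + 1) n - fps_X ^ nat (2 * N + 1) * lattice_term N n =
    (fps_X ^ nat ((N + 1 - n)\<^sup>2 + n\<^sup>2) * of_int (2 * n - (N + 1)) +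
     fps_X ^ nat (2 * N + 1) * (fps_X ^ nat ((N - n)\<^sup>2 + n\<^sup>2) * of_int (2 * n - N)) :: 'a::char5_field fps)"
proof -
  define a :: "'a fps" where "a = of_int (2 * n - N)"
  have a1: "of_int (2 * n - (N + 1)) = a - 1" by (simp add: a_def)
  have R: "geom n * (1 - qabs n) = (1 :: 'a fps)" using geom_eq[OF assms(1)] .
  consider "n > 0" | "n < 0" using assms(1) by linarith
  then show ?thesis
  proof cases
    case 1
    define E :: "'a fps" where "E = fps_X ^ nat ((N + 1 - n)\<^sup>2 + n\<^sup>2)"
    \<comment> \<open>The exponents differ by $(N+1-n)^2 - (N-n)^2 = 2N + 1 - 2n$.\<close>
    have "nat (2 * N + 1) + nat ((N - n)\<^sup>2 + n\<^sup>2) = nat ((N + 1 - n)\<^sup>2 + n\<^sup>2) + nat (2 * \<bar>n\<bar>)"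
      by (rule nat_add_eqI) (use 1 assms(2) in simp_all, simp add: power2_eq_square algebra_simps)
    then have e: "fps_X ^ nat (2 * N + 1) * fps_X ^ nat ((N - n)\<^sup>2 + n\<^sup>2) = E * qabs n"
      unfolding E_def qabs_def power_add[symmetric] by (rule arg_cong)
    have V: "vker n = (1 + qabs n) * (geom n :: 'a fps)" using 1 by (simp add: vker_def)
    \<comment> \<open>Written this way the error is a multiple of
      \<open>geom n * (1 - qabs n) - 1\<close>, which is 0 by \<open>R\<close>.\<close>
    have "E * ((a - 1) * vker n + 2 * bker n) - E * qabs n * (a * vker n + 2 * bker n) - (E * (a - 1) + E * qabs n * a)
        = E * (geom n * (1 - qabs n) - 1) * (a * (1 + qabs n) + 2 * qabs n * geom n - 1)"
      unfolding V bker_def by (simp add: algebra_simps)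
    then have "E * ((a - 1) * vker n + 2 * bker n) - E * qabs n * (a * vker n + 2 * bker n) = E * (a - 1) + E * qabs n * a"
      unfolding R by simp
    then show ?thesis unfolding lattice_term_def a1 a_def[symmetric] E_def[symmetric] e[symmetric] by (simp add: mult.assoc)
  next
    case 2
    \<comment> \<open>For negative $n$ the other exponent is the smaller one; \<open>E\<close> is
      the smaller power in both cases.\<close>
    define E :: "'a fps" where "E = fps_X ^ nat (2 * N + 1) * fps_X ^ nat ((N - n)\<^sup>2 + n\<^sup>2)"
    have "nat (2 * N + 1) + nat ((N - n)\<^sup>2 + n\<^sup>2) = nat (2 * N + 1 + ((N - n)\<^sup>2 + n\<^sup>2)) + nat 0"
      by (rule nat_add_eqI) (use assms(2) in auto)
    moreover have "nat (2 * N + 1 + ((N - n)\<^sup>2 + n\<^sup>2)) + nat (2 * \<bar>n\<bar>) = nat ((N + 1 - n)\<^sup>2 + n\<^sup>2) + nat 0"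
      by (rule nat_add_eqI) (use 2 assms(2) in simp_all, simp add: power2_eq_square algebra_simps)
    ultimately have "nat (2 * N + 1) + nat ((N - n)\<^sup>2 + n\<^sup>2) + nat (2 * \<bar>n\<bar>) = nat ((N + 1 - n)\<^sup>2 + n\<^sup>2)"
      by simp
    then have e: "fps_X ^ nat ((N + 1 - n)\<^sup>2 + n\<^sup>2) = E * qabs n"
      unfolding E_def qabs_def power_add[symmetric] by (rule arg_cong[OF sym])
    have V: "vker n = - ((1 + qabs n) * (geom n :: 'a fps))" using 2 by (simp add: vker_def algebra_simps)
    have "E * qabs n * ((a - 1) * vker n + 2 * bker n) - E * (a * vker n + 2 * bker n) - (E * qabs n * (a - 1) + E * a)
        = E * (geom n * (1 - qabs n) - 1) * (a * (1 + qabs n) - 2 * qabs n * geom n - qabs n)"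
      unfolding V bker_def by (simp add: algebra_simps)
    then have "E * qabs n * ((a - 1) * vker n + 2 * bker n) - E * (a * vker n + 2 * bker n) = E * qabs n * (a - 1) + E * a"
      unfolding R by simp
    then show ?thesis unfolding lattice_term_def a1 a_def[symmetric] e E_def[symmetric] by (simp add: mult.assoc E_def)
  qed
qed

lemma locfin_antisym: "locfin (\<lambda>n. fps_X ^ nat ((K - n)\<^sup>2 + n\<^sup>2) * of_int (2 * n - K) :: 'a::char5_field fps) I"
  by (rule locfin_X_power) (rule finite_sq_add)

text \<open>The reflection $n \<rightarrow> K - n$ negates the summand, so the sum over all integers
  is 0 and the value is minus the omitted term at $n = 0$.\<close>

lemma fsum_antisym:
  "fsum (\<lambda>n. fps_X ^ nat ((K - n)\<^sup>2 + n\<^sup>2) * of_int (2 * n - K)) (UNIV - {0}) = (of_int K * fps_X ^ nat (K\<^sup>2) :: 'a::char5_field fps)"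
proof -
  let ?f = "\<lambda>n. fps_X ^ nat ((K - n)\<^sup>2 + n\<^sup>2) * of_int (2 * n - K) :: 'a fps"
  have "fsum ?f UNIV = 0"
  proof (rule fsum_odd)
    show "bij (\<lambda>n. K - n)" by (rule o_bij[of "\<lambda>n. K - n"]) (auto simp: fun_eq_iff)
    show "?f (K - n) = - ?f n" for n
      by (simp add: algebra_simps)
  qed (rule locfin_antisym)
  moreover have "fsum ?f (insert 0 (UNIV - {0})) = ?f 0 + fsum ?f (UNIV - {0})"
    by (rule fsum_insert[OF locfin_antisym]) simp
  moreover have "insert 0 (UNIV - {0}) = (UNIV :: int set)" by auto
  ultimately show ?thesis by (simp add: mult.commute)
qed

text \<open>The recurrence in $N$ leaves the initial value at $N = 0$ open. It is carried along as
  an unknown until \<open>lattice_sum_eq\<close> identifies it.\<close>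

definition lattice_sum :: "'a::char5_field fps"
  where "lattice_sum = fsum (lattice_term 0) (UNIV - {0})"

text \<open>After division by $q^{(N+1)^2}$ the recurrence adds $(N + 1) + N$, the increment from
  $N^2$ to $(N+1)^2$.\<close>

lemma fsum_lattice_term_nat: "fsum (lattice_term (int N)) (UNIV - {0}) = fps_X ^ nat ((int N)\<^sup>2) * (of_int ((int N)\<^sup>2) + lattice_sum :: 'a::char5_field fps)"
proof (induction N)
  case 0
  then show ?case by (simp add: lattice_sum_def)
next
  case (Suc N)
  let ?N = "int N" and ?I = "UNIV - {0::int}"
  let ?f = "\<lambda>K n. fps_X ^ nat ((K - n)\<^sup>2 + n\<^sup>2) * of_int (2 * n - K) :: 'a fps"
  have "fsum (lattice_term (?N + 1)) ?I - fps_X ^ nat (2 * ?N + 1) * fsum (lattice_term ?N) ?I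
      = fsum (\<lambda>n. lattice_term (?N + 1) n - fps_X ^ nat (2 * ?N + 1) * lattice_term ?N n :: 'a fps) ?I"
    by (simp add: fsum_diff fsum_mult locfin_lattice_term locfin_mult)
  also have "\<dots> = fsum (\<lambda>n. ?f (?N + 1) n + fps_X ^ nat (2 * ?N + 1) * ?f ?N n) ?I"
    by (rule fsum_cong) (rule lattice_term_step, auto)
  also have "\<dots> = of_int (?N + 1) * fps_X ^ nat ((?N + 1)\<^sup>2) + fps_X ^ nat (2 * ?N + 1) * (of_int ?N * fps_X ^ nat (?N\<^sup>2))"
    unfolding fsum_antisym[symmetric]
    by (simp only: fsum_add fsum_mult locfin_mult locfin_antisym)
  finally have "fsum (lattice_term (?N + 1)) ?I = of_int (?N + 1) * fps_X ^ nat ((?N + 1)\<^sup>2)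
      + fps_X ^ nat (2 * ?N + 1) * fps_X ^ nat (?N\<^sup>2) * (of_int ?N + (of_int (?N\<^sup>2) + lattice_sum) :: 'a fps)"
    unfolding Suc.IH by (simp add: algebra_simps)
  also have "fps_X ^ nat (2 * ?N + 1) * fps_X ^ nat (?N\<^sup>2) = (fps_X ^ nat ((?N + 1)\<^sup>2) :: 'a fps)"
    unfolding power_add[symmetric] by (simp add: nat_add_distrib[symmetric] power2_eq_square algebra_simps)
  finally show ?case by (simp add: algebra_simps power2_eq_square)
qed

lemma bij_uminus_int: "bij_betw uminus (UNIV - {0::int}) (UNIV - {0})" "bij (uminus :: int \<Rightarrow> int)"
  by (rule bij_betw_byWitness[of _ uminus]; auto)+

lemma fsum_lattice_term: "fsum (lattice_term N) (UNIV - {0}) = fps_X ^ nat (N\<^sup>2) * (of_int (N\<^sup>2) + lattice_sum :: 'a::char5_field fps)"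
proof (cases "N \<ge> 0")
  case True
  then show ?thesis using fsum_lattice_term_nat[of "nat N"] by simp
next
  case False
  have "lattice_term N (- n) = (lattice_term (- N) n :: 'a fps)" for n
    by (simp add: lattice_term_def algebra_simps power2_eq_square)
  then have "fsum (lattice_term N) (UNIV - {0}) = (fsum (lattice_term (- N)) (UNIV - {0}) :: 'a fps)"
    using fsum_reindex[OF bij_uminus_int(1), of "lattice_term N :: _ \<Rightarrow> 'a fps"] by simp
  then show ?thesis using fsum_lattice_term_nat[of "nat (- N)", where 'a='a] False by simp
qed

section \<open>Moments of the lattice sum and their derivatives\<close>

definition theta :: "nat \<Rightarrow> 'a::char5_field fps"
  where "theta i = fsum (\<lambda>n. of_int (n ^ i) * gauss n) UNIV"

text \<open>\<open>vmom i\<close> is \<Lambda>_i, and \<open>bmom 0\<close> is the series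
  $M$.\<close>

definition vmom :: "nat \<Rightarrow> 'a::char5_field fps"
  where "vmom i = fsum (\<lambda>n. of_int (n ^ i) * (gauss n * vker n)) (UNIV - {0})"

definition bmom :: "nat \<Rightarrow> 'a::char5_field fps"
  where "bmom i = fsum (\<lambda>n. of_int (n ^ i) * (gauss n * bker n)) (UNIV - {0})"

lemma locfin_gauss: "locfin (\<lambda>n. gauss n * h n :: 'a::char5_field fps) I"
proof -
  have "locfin (\<lambda>n. fps_X ^ nat (n\<^sup>2) * (alt_sign n * h n) :: 'a fps) I"
    by (rule locfin_X_power) (rule finite_int_sq)
  then show ?thesis by (simp add: gauss_def mult_ac)
qed

lemma locfin_gauss': "locfin (gauss :: int \<Rightarrow> 'a::char5_field fps) I"
  using locfin_gauss[of "\<lambda>_. 1"] by simp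

lemmas locfin_moments = locfin_mult[OF locfin_gauss] locfin_mult[OF locfin_gauss']

lemma theta_odd: "odd i \<Longrightarrow> theta i = 0"
  unfolding theta_def by (rule fsum_odd[OF _ bij_uminus_int(2)]) (auto intro: locfin_moments)

lemma vmom_even: "even i \<Longrightarrow> vmom i = 0"
  unfolding vmom_def by (rule fsum_odd[OF _ bij_uminus_int(1)]) (auto intro: locfin_moments)

lemma bmom_odd: "odd i \<Longrightarrow> bmom i = 0"
  unfolding bmom_def by (rule fsum_odd[OF _ bij_uminus_int(1)]) (auto intro: locfin_moments)

lemma euler_of_int [simp]: "euler (of_int k) = (0 :: 'a::comm_ring_1 fps)"
  by (cases k) (simp_all add: of_nat_mult)

lemma euler_numeral [simp]: "euler (numeral m) = (0 :: 'a::comm_ring_1 fps)"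
  using euler_of_nat[of "numeral m"] by simp

lemma euler_of_int_power [simp]: "euler (of_int k ^ i) = (0 :: 'a::comm_ring_1 fps)"
  using euler_of_int[of "k ^ i"] by simp

lemma locfin_diff: "locfin f I \<Longrightarrow> locfin g I \<Longrightarrow> locfin (\<lambda>i. f i - g i :: 'a::comm_ring_1 fps) I"
  using locfin_add[of f I "\<lambda>i. - 1 * g i"] locfin_mult[of g I "\<lambda>_. - 1"] by simp

lemma euler_gauss: "euler (gauss n) = of_int (n\<^sup>2) * (gauss n :: 'a::char5_field fps)"
  by (auto simp: gauss_def alt_sign_def euler_X_power euler_mult)

lemma euler_geom: "n \<noteq> 0 \<Longrightarrow> euler (geom n) = geom n * geom n * (euler (qabs n) :: 'a::char5_field fps)"
proof -
  assume "n \<noteq> 0"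
  then have R: "geom n * (1 - qabs n) = (1 :: 'a fps)" by (rule geom_eq)
  have "euler (geom n * (1 - qabs n)) = (0 :: 'a fps)" unfolding R by simp
  then have *: "euler (geom n) * (1 - qabs n) = geom n * (euler (qabs n) :: 'a fps)"
    by (simp add: euler_mult algebra_simps)
  have "euler (geom n) = euler (geom n) * (geom n * (1 - qabs n) :: 'a fps)" unfolding R by simp
  also have "\<dots> = geom n * (euler (geom n) * (1 - qabs n))" by (simp only: mult_ac)
  also have "\<dots> = geom n * geom n * euler (qabs n)" unfolding * by (simp only: mult_ac)
  finally show ?thesis .
qed

text \<open>With $Q = q^{2|n|}$, the derivative of $(1 + Q)/(1 - Q)$ is $2 DQ / (1 - Q)^2$, and $DQ
  = 2|n| Q$; the sign in \<open>vker\<close> turns $|n|$ into $n$.\<close>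

lemma euler_vker: "n \<noteq> 0 \<Longrightarrow> euler (vker n) = 4 * (of_int n * (bker n :: 'a::char5_field fps))"
proof -
  assume n: "n \<noteq> 0"
  then have R: "geom n * (1 - qabs n) = (1 :: 'a fps)" by (rule geom_eq)
  have Q: "euler (qabs n) = 2 * of_int \<bar>n\<bar> * (qabs n :: 'a fps)"
    unfolding qabs_def euler_X_power by (subst of_nat_nat) simp_all
  have s: "of_int (sgn n) * of_int \<bar>n\<bar> = (of_int n :: 'a fps)"
    unfolding of_int_mult[symmetric] sgn_mult_abs by (rule refl)
  have "euler (vker n) = of_int (sgn n) * (euler (qabs n) * geom n + (1 + qabs n) * (geom n * geom n * euler (qabs n)) :: 'a fps)"
    by (simp add: vker_def euler_mult euler_geom[OF n] mult.assoc)
  also have "\<dots> = of_int (sgn n) * euler (qabs n) * (2 * geom n * geom n + geom n * (1 - geom n * (1 - qabs n)))"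
    by (simp add: algebra_simps)
  also have "\<dots> = 4 * ((of_int (sgn n) * of_int \<bar>n\<bar>) * (qabs n * geom n * geom n :: 'a fps))"
    unfolding R Q by (simp add: mult_ac)
  finally show ?thesis unfolding s bker_def .
qed

lemma euler_theta: "euler (theta i) = theta (i + 2)"
  unfolding theta_def
  by (subst fsum_euler, rule locfin_moments, rule fsum_cong) (simp add: euler_mult euler_gauss power_add power2_eq_square mult_ac)

text \<open>The derivative falls either on the Gaussian factor, raising the moment by 2, or on the
  kernel. Thus \<open>bmom 2\<close> and \<open>bmom 4\<close> can be traded for derivatives of
  \<open>vmom\<close>.\<close>

lemma euler_vmom: "euler (vmom i) = vmom (i + 2) + 4 * (bmom (i + 1) :: 'a::char5_field fps)"
proof -
  let ?I = "UNIV - {0::int}"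
  have "euler (vmom i :: 'a fps) = fsum (\<lambda>n. euler (of_int (n ^ i) * (gauss n * vker n))) ?I"
    unfolding vmom_def by (rule fsum_euler) (rule locfin_moments)
  also have "\<dots> = fsum (\<lambda>n. of_int (n ^ (i + 2)) * (gauss n * vker n) + 4 * (of_int (n ^ (i + 1)) * (gauss n * bker n))) ?I"
    by (rule fsum_cong) (simp add: euler_mult euler_gauss euler_vker power_add power2_eq_square algebra_simps)
  also have "\<dots> = vmom (i + 2) + 4 * bmom (i + 1)"
    unfolding vmom_def bmom_def by (simp only: fsum_add fsum_mult locfin_moments locfin_mult)
  finally show ?thesis .
qed

lemma bij_shear: "bij_betw (\<lambda>(a, n). (a + n, n)) (UNIV \<times> I) (UNIV \<times> I)" for I :: "int set"
  by (rule bij_betw_byWitness[of _ "\<lambda>(N, n). (N - n, n)"]) auto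

text \<open>Multiply \<open>fsum_lattice_term\<close> by $(-1)^N N^j$, sum over \<open>N\<close> and substitute $N \to N + n$, which factors the
  left-hand side by the binomial theorem.\<close>

lemma moment_sum:
  "(\<Sum>k\<le>j. of_nat (j choose k) * (theta k * (vmom (j - k + 1) + 2 * bmom (j - k)) - theta (k + 1) * vmom (j - k)))
    = theta (j + 2) + lattice_sum * (theta j :: 'a::char5_field fps)"
proof -
  let ?I = "UNIV - {0::int}"
  define f :: "int \<Rightarrow> int \<Rightarrow> 'a fps" where "f N n = of_int (N ^ j) * alt_sign N * lattice_term N n" for N n
  define A :: "nat \<Rightarrow> int \<Rightarrow> 'a fps" where "A i n = of_int (n ^ i) * gauss n" for i n
  define V :: "nat \<Rightarrow> int \<Rightarrow> 'a fps" where "V i n = of_int (n ^ i) * (gauss n * vker n)" for i n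
  define B :: "nat \<Rightarrow> int \<Rightarrow> 'a fps" where "B i n = of_int (n ^ i) * (gauss n * bker n)" for i n
  have lf: "locfin (A i) J" "locfin (V i) J" "locfin (B i) J" for i J
    unfolding A_def V_def B_def by (rule locfin_moments)+
  define T where "T F G p = (case p of (a, n) \<Rightarrow> F a * G n)" for F G :: "int \<Rightarrow> 'a fps" and p
  have lT: "locfin (T F G) (UNIV \<times> ?I)" and sT: "fsum (T F G) (UNIV \<times> ?I) = fsum F UNIV * fsum G ?I"
    if "locfin F UNIV" "locfin G ?I" for F G
    using locfin_Times[OF that] fsum_Times[OF that] by (simp_all add: T_def[abs_def])
  define h where "h k p = of_nat (j choose k) *
    (T (A k) (V (j - k + 1)) p + 2 * T (A k) (B (j - k)) p - T (A (k + 1)) (V (j - k)) p)" for k p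
  have lh: "locfin (h k) (UNIV \<times> ?I)" for k
    unfolding h_def by (intro locfin_mult locfin_add locfin_diff lT lf)
  have "fsum (A i) UNIV = theta i" "fsum (V i) ?I = vmom i" "fsum (B i) ?I = bmom i" for i
    unfolding A_def V_def B_def theta_def vmom_def bmom_def by (rule refl)+
  note F = this
  have sh: "fsum (h k) (UNIV \<times> ?I) = of_nat (j choose k) * (theta k * (vmom (j - k + 1) + 2 * bmom (j - k)) - theta (k + 1) * vmom (j - k))" for k
  proof -
    have "fsum (h k) (UNIV \<times> ?I) = of_nat (j choose k) * (fsum (T (A k) (V (j - k + 1))) (UNIV \<times> ?I)
      + 2 * fsum (T (A k) (B (j - k))) (UNIV \<times> ?I) - fsum (T (A (k + 1)) (V (j - k))) (UNIV \<times> ?I))"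
      unfolding h_def by (simp only: fsum_mult fsum_add fsum_diff locfin_mult locfin_add locfin_diff lT lf)
    then show ?thesis by (simp only: sT lf F) (simp add: algebra_simps)
  qed
  have fh: "f (a + n) n = (\<Sum>k\<le>j. h k (a, n))" if "n \<noteq> 0" for a n
  proof -
    have g: "gauss a * gauss n = alt_sign (a + n) * (fps_X ^ nat (a\<^sup>2 + n\<^sup>2) :: 'a fps)"
      by (simp add: gauss_def alt_sign_add power_add nat_add_distrib mult_ac)
    have "f (a + n) n = of_int ((a + n) ^ j) * (gauss a * gauss n) * (of_int (n - a) * vker n + 2 * bker n)"
      unfolding g by (simp add: f_def lattice_term_def mult_ac)
    also have "of_int ((a + n) ^ j) = (\<Sum>k\<le>j. of_nat (j choose k) * of_int (a ^ k) * of_int (n ^ (j - k)) :: 'a fps)"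
      by (simp add: binomial_ring)
    also have "\<dots> * (gauss a * gauss n) * (of_int (n - a) * vker n + 2 * bker n) = (\<Sum>k\<le>j. h k (a, n))"
      unfolding sum_distrib_right
      by (rule sum.cong) (simp_all add: h_def T_def A_def V_def B_def algebra_simps)
    finally show ?thesis .
  qed
  have fh': "f N n = (\<Sum>k\<le>j. h k (N - n, n))" if "n \<noteq> 0" for N n
    using fh[OF that, of "N - n"] by simp
  have lH: "locfin (\<lambda>p. \<Sum>k\<le>j. h k p) (UNIV \<times> ?I)"
    and sH: "fsum (\<lambda>p. \<Sum>k\<le>j. h k p) (UNIV \<times> ?I) = (\<Sum>k\<le>j. fsum (h k) (UNIV \<times> ?I))"
    by (rule locfin_sum; auto intro: lh)+
  have fH: "(case (case p of (a, n) \<Rightarrow> (a + n, n)) of (N, n) \<Rightarrow> f N n) = (\<Sum>k\<le>j. h k p)" if "p \<in> UNIV \<times> ?I" for p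
    using that fh by (cases p) auto
  \<comment> \<open>Local finiteness over pairs is pulled back through the shear; it licenses the
    later exchange of the sums over \<open>N\<close> and \<open>n\<close>.\<close>
  have lF: "locfin (\<lambda>(N, n). f N n) (UNIV \<times> ?I)"
  proof -
    have "bij_betw (\<lambda>(N, n). (N - n, n)) (UNIV \<times> ?I) (UNIV \<times> ?I)"
      by (rule bij_betw_byWitness[of _ "\<lambda>(a, n). (a + n, n)"]) auto
    note lH' = locfin_reindex[OF lH this]
    have "(case p of (N, n) \<Rightarrow> f N n) = (\<Sum>k\<le>j. h k (case p of (N, n) \<Rightarrow> (N - n, n)))" if "p \<in> UNIV \<times> ?I" for p
      using that fh' by (cases p) simp
    then show ?thesis
      by (intro locfin_mono[OF lH' order.refl]) simp
  qed
  have "(\<Sum>k\<le>j. fsum (h k) (UNIV \<times> ?I)) = fsum (\<lambda>(N, n). f N n) (UNIV \<times> ?I)"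
    unfolding sH[symmetric] fsum_reindex[OF bij_shear, of "\<lambda>(N, n). f N n"]
    by (rule fsum_cong) (rule fH[symmetric])
  also have "\<dots> = fsum (\<lambda>N. fsum (f N) ?I) UNIV"
    by (rule fsum_fsum[symmetric]) (rule lF)
  also have "\<dots> = fsum (\<lambda>N. A (j + 2) N + lattice_sum * A j N) UNIV"
  proof (rule fsum_cong)
    fix N
    have "fsum (f N) ?I = of_int (N ^ j) * alt_sign N * fsum (lattice_term N) ?I"
      unfolding f_def by (rule fsum_mult) (rule locfin_lattice_term)
    then show "fsum (f N) ?I = A (j + 2) N + lattice_sum * A j N"
      by (simp add: fsum_lattice_term A_def gauss_def power_add power2_eq_square algebra_simps)
  qed
  also have "\<dots> = theta (j + 2) + lattice_sum * theta j"
    by (simp only: fsum_add fsum_mult locfin_mult lf F)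
  finally show ?thesis unfolding sh .
qed

text \<open>Only even \<open>j\<close> carries information: for odd \<open>j\<close> every product
  contains a moment that vanishes by parity.\<close>

lemma moment_0: "theta 0 * vmom 1 + 2 * theta 0 * bmom 0 = theta 2 + lattice_sum * (theta 0 :: 'a::char5_field fps)"
  using moment_sum[of 0, where 'a='a] by (simp add: theta_odd eval_nat_numeral algebra_simps)

lemma moment_2:
  "theta 0 * vmom 3 - theta 2 * vmom 1 + 2 * theta 2 * bmom 0 + 2 * theta 0 * bmom 2 = theta 4 + lattice_sum * (theta 2 :: 'a::char5_field fps)"
  using moment_sum[of 2, where 'a='a]
  by (simp add: theta_odd vmom_even bmom_odd eval_nat_numeral algebra_simps)

lemma moment_4:
  "theta 0 * vmom 5 + 2 * theta 2 * vmom 3 - 3 * theta 4 * vmom 1 + 2 * theta 4 * bmom 0 + 12 * theta 2 * bmom 2 + 2 * theta 0 * bmom 4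
    = theta 6 + lattice_sum * (theta 4 :: 'a::char5_field fps)"
  using moment_sum[of 4, where 'a='a]
  by (simp add: theta_odd vmom_even bmom_odd eval_nat_numeral algebra_simps)

lemma five_fps: "(5 :: 'a::char5_field fps) = 0"
  by (simp add: numeral_fps_const five_eq_0)

lemma of_nat_mod5: "of_nat (n mod 5) = (of_nat n :: 'a::char5_field)"
proof -
  have "of_nat n = (of_nat (5 * (n div 5) + n mod 5) :: 'a)" by simp
  also have "\<dots> = of_nat (n mod 5)" by (simp only: of_nat_add of_nat_mult of_nat_numeral five_eq_0 mult_zero_left add_0)
  finally show ?thesis by simp
qed

lemma of_int_mod5: "of_int (n mod 5) = (of_int n :: 'a::char5_field)"
proof -
  have "of_int n = (of_int (5 * (n div 5) + n mod 5) :: 'a)" by simp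
  also have "\<dots> = of_int (n mod 5)" by (simp only: of_int_add of_int_mult of_int_numeral five_eq_0 mult_zero_left add_0)
  finally show ?thesis by simp
qed

lemma pow5_mod5: "(n ^ 5) mod 5 = n mod (5::int)"
proof -
  have "n mod 5 \<in> {0, 1, 2, 3, 4}" by auto
  then have "(n mod 5) ^ 5 mod 5 = n mod 5" by (elim insertE) (simp_all only: empty_iff, auto)
  then show ?thesis by (simp add: power_mod)
qed

lemma vmom_5: "vmom 5 = (vmom 1 :: 'a::char5_field fps)"
proof -
  have "of_int (n ^ 5) = (of_int (n ^ 1) :: 'a fps)" for n
    unfolding fps_of_int[symmetric] using of_int_mod5[of "n ^ 5", where 'a='a] of_int_mod5[of n, where 'a='a] pow5_mod5[of n] by simp
  then show ?thesis unfolding vmom_def by presburger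
qed

text \<open>Elimination. \<open>bmom 0\<close> and \<open>lattice_sum\<close> occur only in the
  combination \<open>2 * bmom 0 - lattice_sum\<close>, which \<open>moment_0\<close> removes from
  \<open>moment_2\<close> and \<open>moment_4\<close>. \<open>euler_vmom\<close> and
  \<open>vmom_5\<close> then remove \<open>bmom 2\<close> and \<open>bmom 4\<close>, and the
  derivative of the first resulting equation removes \<open>vmom 3\<close>.\<close>

lemma appell_ode:
  fixes x :: "'a::char5_field fps"
  assumes x: "vmom 1 = theta 0 * x"
  shows "theta 0 ^ 4 * (x - euler (euler x)) = - 2 * theta 2 * (theta 0 * theta 4 - theta 2 * theta 2)"
proof -
  define f a b c l Y M2 M4 M0 where d: "f = (theta 0 :: 'a fps)" "a = (theta 2 :: 'a fps)" "b = (theta 4 :: 'a fps)" "c = (theta 6 :: 'a fps)"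
    "l = (vmom 1 :: 'a fps)" "Y = (vmom 3 :: 'a fps)" "M2 = (bmom 2 :: 'a fps)" "M4 = (bmom 4 :: 'a fps)" "M0 = (bmom 0 :: 'a fps)"
  have e: "euler f = a" "euler a = b" "euler b = c"
    unfolding d by (simp_all add: euler_theta eval_nat_numeral)
  have el: "euler l = Y + 4 * M2" and eY: "euler Y = l + 4 * M4"
    using euler_vmom[of 1, where 'a='a] euler_vmom[of 3, where 'a='a] vmom_5[where 'a='a]
    unfolding d by (simp_all add: eval_nat_numeral)
  have l: "l = f * x" using x unfolding d .
  have el': "euler l = a * x + f * euler x"
    unfolding l by (simp add: euler_mult e)
  have m0: "f * l + 2 * f * M0 - (a + lattice_sum * f) = 0"
    unfolding d using moment_0 by (simp add: algebra_simps)
  have m2: "f * Y - a * l + 2 * a * M0 + 2 * f * M2 - (b + lattice_sum * a) = 0"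
    unfolding d using moment_2 by (simp add: algebra_simps)
  have m4: "f * l + 2 * a * Y - 3 * b * l + 2 * b * M0 + 12 * a * M2 + 2 * f * M4 - (c + lattice_sum * b) = 0"
    unfolding d using moment_4 by (simp add: algebra_simps vmom_5)
  \<comment> \<open>\<open>f\<close> times \<open>m2\<close> minus \<open>a\<close> times
    \<open>m0\<close>, doubled so that \<open>Y + 4 * M2\<close>, which is \<open>euler l\<close>,
    can be split off.\<close>
  have "2 * (f * (f * Y - a * l + 2 * a * M0 + 2 * f * M2 - (b + lattice_sum * a)) - a * (f * l + 2 * f * M0 - (a + lattice_sum * f)))
     = f * f * Y + f * f * (Y + 4 * M2) - 4 * f * a * l - 2 * (f * b - a * a)"
    by (simp add: algebra_simps)
  then have "f * f * Y + f * f * (a * x + f * euler x) - 4 * f * a * l - 2 * (f * b - a * a) = 0"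
    unfolding m0 m2 el[symmetric] el' by simp
  then have i1: "f * f * Y + f * f * (a * x + f * euler x) - 4 * f * a * (f * x) - 2 * (f * b - a * a) = 0"
    unfolding l .
  have "2 * (f * (f * l + 2 * a * Y - 3 * b * l + 2 * b * M0 + 12 * a * M2 + 2 * f * M4 - (c + lattice_sum * b))
      - b * (f * l + 2 * f * M0 - (a + lattice_sum * f)))
     = f * f * l - 2 * f * a * Y - 8 * f * b * l + 6 * f * a * (Y + 4 * M2) + f * f * (l + 4 * M4) - 2 * (f * c - a * b)"
    by (simp add: algebra_simps)
  then have "f * f * l - 2 * f * a * Y - 8 * f * b * l + 6 * f * a * (a * x + f * euler x) + f * f * euler Y - 2 * (f * c - a * b) = 0"
    unfolding m0 m4 el[symmetric] el' eY[symmetric] by simp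
  then have i2: "f * f * (f * x) - 2 * f * a * Y - 8 * f * b * (f * x) + 6 * f * a * (a * x + f * euler x) + f * f * euler Y - 2 * (f * c - a * b) = 0"
    unfolding l .
  have "euler (f * f * Y + f * f * (a * x + f * euler x) - 4 * f * a * (f * x) - 2 * (f * b - a * a)) = 0"
    unfolding i1 by simp
  then have i3: "2 * f * a * Y + f * f * euler Y - (2 * (f * c - a * b) + 6 * f * a * a * x + 3 * f * f * b * x - f * f * f * euler (euler x)) = 0"
    by (simp add: euler_mult e algebra_simps)
  \<comment> \<open>The multipliers \<open>f\<close>, \<open>- f\<close> and \<open>4 * a\<close> of
    \<open>i2\<close>, \<open>i3\<close> and \<open>i1\<close> make \<open>euler Y\<close> and then
    \<open>Y\<close> cancel; what is left over is an explicit multiple of 5.\<close>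
  have "f ^ 4 * (x - euler (euler x)) + 2 * a * (f * b - a * a) =
     f * (f * f * (f * x) - 2 * f * a * Y - 8 * f * b * (f * x) + 6 * f * a * (a * x + f * euler x) + f * f * euler Y - 2 * (f * c - a * b))
     - f * (2 * f * a * Y + f * f * euler Y - (2 * (f * c - a * b) + 6 * f * a * a * x + 3 * f * f * b * x - f * f * f * euler (euler x)))
     + 4 * a * (f * f * Y + f * f * (a * x + f * euler x) - 4 * f * a * (f * x) - 2 * (f * b - a * a))
     + 5 * (2 * a * (f * b - a * a) + f * f * f * b * x - 2 * f * f * f * a * euler x)"
    by (simp add: algebra_simps eval_nat_numeral)
  then have "f ^ 4 * (x - euler (euler x)) + 2 * a * (f * b - a * a) = 0"
    unfolding i1 i2 i3 five_fps by simp
  then show ?thesis unfolding d[symmetric] by (simp add: eq_neg_iff_add_eq_0)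
qed

section \<open>Exponents modulo 5\<close>

definition supp5 :: "nat \<Rightarrow> 'a::zero fps \<Rightarrow> bool"
  where "supp5 r f \<longleftrightarrow> (\<forall>n. f $ n \<noteq> 0 \<longrightarrow> n mod 5 = r mod 5)"

definition vanish5 :: "nat \<Rightarrow> 'a::zero fps \<Rightarrow> bool"
  where "vanish5 r f \<longleftrightarrow> (\<forall>n. n mod 5 = r \<longrightarrow> f $ n = 0)"

lemma supp5_mult:
  assumes "supp5 r f" "supp5 s (g :: 'a::comm_ring_1 fps)"
  shows "supp5 (r + s) (f * g)"
  unfolding supp5_def
proof (intro allI impI)
  fix n assume "(f * g) $ n \<noteq> 0"
  then obtain i where i: "i \<in> {0..n}" "f $ i * g $ (n - i) \<noteq> 0"
    by (auto simp: fps_mult_nth elim: sum.not_neutral_contains_not_neutral)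
  then have "i mod 5 = r mod 5" "(n - i) mod 5 = s mod 5"
    using assms unfolding supp5_def by force+
  then have "(i + (n - i)) mod 5 = (r + s) mod 5" by (rule mod_add_cong)
  then show "n mod 5 = (r + s) mod 5" using i by simp
qed

lemma vanish5_supp5: "supp5 r f \<Longrightarrow> r mod 5 \<noteq> s \<Longrightarrow> vanish5 s f"
  unfolding vanish5_def supp5_def by metis

lemma vanish5_add: "vanish5 r f \<Longrightarrow> vanish5 r g \<Longrightarrow> vanish5 r (f + g :: 'a::comm_ring_1 fps)"
  and vanish5_diff: "vanish5 r f \<Longrightarrow> vanish5 r g \<Longrightarrow> vanish5 r (f - g :: 'a::comm_ring_1 fps)"
  and vanish5_uminus: "vanish5 r f \<Longrightarrow> vanish5 r (- f :: 'a::comm_ring_1 fps)"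
  and vanish5_numeral: "vanish5 r f \<Longrightarrow> vanish5 r (numeral m * f :: 'a::comm_ring_1 fps)"
  unfolding vanish5_def by (auto simp: numeral_fps_const)

lemma diff_mod5:
  assumes "i \<le> n" "i mod 5 = 0" shows "(n - i) mod 5 = n mod (5::nat)"
proof -
  obtain k where "i = 5 * k" using assms(2) by (metis mod_0_imp_dvd dvd_def)
  then have "n = (n - i) + 5 * k" using assms(1) by simp
  then show ?thesis by (metis mod_mult_self2)
qed

text \<open>Convolution with \<open>h\<close> links only coefficients in the same residue class, and
  the constant term of \<open>h\<close> is invertible, so the coefficients of \<open>f\<close> in
  that class vanish one after another.\<close>

lemma vanish5_cancel:
  fixes f h :: "'a::field fps"
  assumes "supp5 0 h" "h $ 0 \<noteq> 0" "vanish5 r (h * f)"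
  shows "vanish5 r f"
proof -
  have "n mod 5 = r \<longrightarrow> f $ n = 0" for n
  proof (induction n rule: less_induct)
    case (less n)
    show ?case
    proof
      assume n: "n mod 5 = r"
      have "h $ i * f $ (n - i) = 0" if "i \<in> {0<..n}" for i
      proof (cases "h $ i = 0")
        case False
        then have "i mod 5 = 0" using assms(1) by (auto simp: supp5_def)
        then have "(n - i) mod 5 = r" using n that diff_mod5[of i n] by simp
        then show ?thesis using less.IH[of "n - i"] that by auto
      qed simp
      then have "(\<Sum>i\<in>{0<..n}. h $ i * f $ (n - i)) = 0" by (rule sum.neutral[OF ballI])
      moreover have "(h * f) $ n = h $ 0 * f $ n + (\<Sum>i\<in>{0<..n}. h $ i * f $ (n - i))"
        unfolding fps_mult_nth by (subst sum.head) auto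
      moreover have "(h * f) $ n = 0" using assms(3) n by (simp add: vanish5_def)
      ultimately show "f $ n = 0" using assms(2) by simp
    qed
  qed
  then show ?thesis by (simp add: vanish5_def)
qed

lemma of_nat_eq_0_char5:
  assumes "of_nat n = (0 :: 'a::char5_field)"
  shows "n mod 5 = 0"
proof -
  have z: "of_nat (n mod 5) = (0 :: 'a)" using assms of_nat_mod5[of n, where 'a='a] by simp
  have "(3::'a) \<noteq> 0"
  proof
    assume "(3::'a) = 0"
    moreover have "(5::'a) = 3 + 2" by simp
    ultimately show False using five_eq_0[where 'a='a] two_neq_0[where 'a='a] by simp
  qed
  moreover have "(4::'a) = 2 * 2" by simp
  then have "(4::'a) \<noteq> 0" using two_neq_0[where 'a='a] by (metis mult_eq_0_iff)
  moreover have "n mod 5 \<in> {0, 1, 2, 3, 4}" by auto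
  ultimately show ?thesis using z two_neq_0[where 'a='a] by (elim insertE) auto
qed

text \<open>The derivative of a fifth power is 0 here, so $n$ times its $n$-th coefficient
  vanishes.\<close>

lemma supp5_pow5: "supp5 0 (f ^ 5 :: 'a::char5_field fps)"
proof -
  have "euler (f ^ 5) = 0" by (simp add: euler_power five_fps)
  then have "of_nat n * (f ^ 5) $ n = 0" for n using euler_nth[of "f ^ 5" n] by simp
  then show ?thesis unfolding supp5_def using of_nat_eq_0_char5 by (metis mod_0 mult_eq_0_iff)
qed

definition part5 :: "nat \<Rightarrow> 'a::zero fps \<Rightarrow> 'a fps"
  where "part5 r f = Abs_fps (\<lambda>n. if n mod 5 = r then f $ n else 0)"

lemma supp5_part5: "r < 5 \<Longrightarrow> supp5 r (part5 r f)"
  by (auto simp: supp5_def part5_def)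

lemma of_nat_mod5_0: "n mod 5 = 0 \<Longrightarrow> of_nat n = (0 :: 'a::char5_field)"
  and of_nat_mod5_1: "n mod 5 = 1 \<Longrightarrow> of_nat n = (1 :: 'a)"
  using of_nat_mod5[of n, where 'a='a] by simp_all

lemma of_nat_part5:
  assumes "n mod 5 = 4" shows "of_nat n = (- 1 :: 'a::char5_field)"
proof -
  have "of_nat n = (4 :: 'a)" using assms of_nat_mod5[of n, where 'a='a] by simp
  also have "\<dots> = 5 - 1" by simp
  finally show ?thesis by (simp add: five_eq_0)
qed

lemma square_mod5: "nat (n\<^sup>2) mod 5 \<in> {0, 1, 4}"
proof -
  have "n mod 5 \<in> {0, 1, 2, 3, 4}" by auto
  then have "(n mod 5)\<^sup>2 mod 5 \<in> {0, 1, 4}" by (elim insertE) (simp_all only: empty_iff, auto)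
  then have "n\<^sup>2 mod 5 \<in> {0, 1, 4}" by (simp add: power_mod)
  moreover have "nat (n\<^sup>2) mod 5 = nat (n\<^sup>2 mod 5)" by (simp add: nat_mod_distrib)
  ultimately show ?thesis by auto
qed

lemma theta_nth:
  assumes "n mod 5 = 2 \<or> n mod 5 = 3" shows "theta 0 $ n = (0 :: 'a::char5_field)"
proof -
  have "gauss k $ n = (0::'a)" for k
    using square_mod5[of k] assms by (auto simp: gauss_def alt_sign_def)
  then show ?thesis unfolding theta_def by (subst fsum_nth[of "{}"]) auto
qed

text \<open>\<open>A\<close>, \<open>B\<close>, \<open>C\<close> collect the exponents 0, 1, 4
  modulo 5, on which \<open>euler\<close> acts as 0, 1, -1; so all three theta series are linear in
  them. The quartic monomials of class 2 are \<open>A * A * B * B\<close>,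
  \<open>A * C * C * C\<close> and \<open>B * B * B * C\<close>: the first two get the coefficient
  -5 and the third cancels.\<close>

lemma theta_vanish:
  "vanish5 2 (theta 0 * theta 0 * (theta 2 * theta 4) - theta 0 * (theta 2 * theta 2 * theta 2) - theta 0 * theta 0 * theta 0 * (theta 0 :: 'a::char5_field fps))"
proof -
  define A B C where "A = part5 0 (theta 0 :: 'a fps)" "B = part5 1 (theta 0 :: 'a fps)" "C = part5 4 (theta 0 :: 'a fps)"
  note d = this
  have s: "supp5 0 A" "supp5 1 B" "supp5 4 C" unfolding d by (simp_all add: supp5_part5)
  have 0: "theta 0 = A + B + C"
  proof (rule fps_ext)
    fix n :: nat
    have "n mod 5 \<in> {0, 1, 2, 3, 4}" by auto
    then show "theta 0 $ n = (A + B + C) $ n" unfolding d part5_def using theta_nth[of n, where 'a='a] by (elim insertE) auto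
  qed
  have eB: "euler B = B" and eC: "euler C = - C" and eA: "euler A = 0"
  proof -
    show "euler B = B"
      by (rule fps_ext) (auto simp: d part5_def of_nat_mod5_1)
    show "euler C = - C"
      by (rule fps_ext) (auto simp: d part5_def of_nat_part5)
    show "euler A = 0"
      by (rule fps_ext) (auto simp: d part5_def of_nat_mod5_0)
  qed
  have 2: "theta 2 = B - C"
    using euler_theta[of 0, where 'a='a] by (simp add: 0 eA eB eC eval_nat_numeral)
  have 4: "theta 4 = B + C"
    using euler_theta[of 2, where 'a='a] by (simp add: 2 eB eC)
  have "theta 0 * theta 0 * (theta 2 * theta 4) - theta 0 * (theta 2 * theta 2 * theta 2) - theta 0 * theta 0 * theta 0 * (theta 0 :: 'a fps) =
    - (C * C * C * C) - 8 * (B * C * C * C) - 6 * (B * B * C * C) - B * B * B * B - 17 * (A * B * C * C) - 7 * (A * B * B * C)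
    - 3 * (A * B * B * B) - 7 * (A * A * C * C) - 12 * (A * A * B * C) - 4 * (A * A * A * C) - 4 * (A * A * A * B)
    - A * A * A * A - 5 * (A * C * C * C + A * A * B * B)"
    unfolding 0 2 4 by (simp add: algebra_simps)
  also have "\<dots> = - (C * C * C * C) - 8 * (B * C * C * C) - 6 * (B * B * C * C) - B * B * B * B - 17 * (A * B * C * C) - 7 * (A * B * B * C)
    - 3 * (A * B * B * B) - 7 * (A * A * C * C) - 12 * (A * A * B * C) - 4 * (A * A * A * C) - 4 * (A * A * A * B)
    - A * A * A * A"
    by (simp only: five_fps mult_zero_left diff_zero)
  finally have eq: "theta 0 * theta 0 * (theta 2 * theta 4) - theta 0 * (theta 2 * theta 2 * theta 2) - theta 0 * theta 0 * theta 0 * (theta 0 :: 'a fps) = \<dots>" .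
  show ?thesis
    unfolding eq
    by (intro vanish5_diff vanish5_uminus vanish5_numeral vanish5_supp5, ((rule supp5_mult s)+, simp)+)
qed

text \<open>Multiplying \<open>appell_ode\<close> by \<open>theta 0\<close> produces a fifth power
  on the left, and the summand \<open>2 * P\<close> supplies the term in \<open>theta 0 ^ 4\<close>
  that completes the polynomial of \<open>theta_vanish\<close>. In class 2 the second derivative is
  multiplication by 4, and $1 - 4 = 2$.\<close>

lemma appell_coeff:
  fixes x :: "'a::char5_field fps"
  assumes x: "vmom 1 = theta 0 * x" and P: "P * theta 0 = 1" and n: "n mod 5 = 2"
  shows "x $ n = - P $ n"
proof -
  let ?f = "theta 0 :: 'a fps" and ?a = "theta 2 :: 'a fps" and ?b = "theta 4 :: 'a fps"
  let ?E = "?f * ?f * (?a * ?b) - ?f * (?a * ?a * ?a) - ?f * ?f * ?f * ?f"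
  have "?f ^ 5 * (x - euler (euler x) + 2 * P) = ?f * (?f ^ 4 * (x - euler (euler x))) + 2 * ?f ^ 4 * (P * ?f)"
    by (simp add: eval_nat_numeral algebra_simps)
  also have "\<dots> = - (2 * ?E)"
    unfolding appell_ode[OF x] P by (simp add: eval_nat_numeral algebra_simps)
  finally have e: "?f ^ 5 * (x - euler (euler x) + 2 * P) = - (2 * ?E)" .
  have f0: "?f $ 0 = 1"
  proof -
    have "?f $ 0 = (\<Sum>k\<in>{0}. (of_int (k ^ 0) * gauss k) $ 0)"
      unfolding theta_def by (rule fsum_nth) (auto simp: gauss_def alt_sign_def)
    then show ?thesis by (simp add: gauss_def)
  qed
  have "vanish5 2 (x - euler (euler x) + 2 * P)"
  proof (rule vanish5_cancel[of "?f ^ 5"])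
    show "vanish5 2 (?f ^ 5 * (x - euler (euler x) + 2 * P))"
      unfolding e by (intro vanish5_uminus vanish5_numeral theta_vanish)
  qed (simp_all add: supp5_pow5 f0)
  then have "x $ n - of_nat n * (of_nat n * x $ n) + 2 * P $ n = 0"
    using n by (simp add: vanish5_def numeral_fps_const)
  moreover have "of_nat n = (2 :: 'a)" using n of_nat_mod5[of n, where 'a='a] by simp
  ultimately have "x $ n - 2 * (2 * x $ n) + 2 * P $ n = 0" by simp
  then have "2 * (x $ n + P $ n) = 5 * x $ n" by (simp add: algebra_simps)
  then have "2 * (x $ n + P $ n) = 0" by (simp only: five_eq_0 mult_zero_left)
  then have "x $ n + P $ n = 0" using two_neq_0[where 'a='a] by (metis mult_eq_0_iff)
  then show ?thesis by (simp add: eq_neg_iff_add_eq_0)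
qed

text \<open>This is \<open>moment_0\<close> times \<open>P * P\<close>; differentiating
  \<open>P * theta 0 = 1\<close> turns \<open>P * P * theta 2\<close> into
  \<open>- euler P\<close>.\<close>

lemma appell_M0:
  fixes x :: "'a::char5_field fps"
  assumes x: "vmom 1 = theta 0 * x" and P: "P * theta 0 = 1"
  shows "2 * P * bmom 0 = P * lattice_sum - euler P - x"
proof -
  have "euler (P * theta 0) = 0" unfolding P by simp
  then have "(euler P * theta 0 + P * theta 2) * P = 0"
    using euler_theta[of 0, where 'a='a] by (simp add: euler_mult eval_nat_numeral)
  then have e: "euler P * (P * theta 0) + P * P * theta 2 = 0" by (simp add: algebra_simps)
  have "P * P * (theta 0 * vmom 1 + 2 * theta 0 * bmom 0) = P * P * (theta 2 + lattice_sum * theta 0)"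
    using moment_0[where 'a='a] by simp
  then have "(P * theta 0) * (P * theta 0) * x + (P * theta 0) * (2 * P * bmom 0) = P * P * theta 2 + (P * theta 0) * (P * lattice_sum)"
    unfolding x by (simp add: algebra_simps)
  then have "x + 2 * P * bmom 0 = P * P * theta 2 + P * lattice_sum" unfolding P by simp
  moreover have "P * P * theta 2 = - euler P" using e unfolding P by (simp add: eq_neg_iff_add_eq_0 add.commute)
  ultimately show ?thesis by (simp add: algebra_simps)
qed

text \<open>In class 2 the three terms of \<open>appell_M0\<close> contribute 1, -2 and 1 times the
  coefficient of \<open>P\<close>.\<close>

lemma appell_M0_coeff:
  assumes P: "P * theta 0 = (1 :: 'a::char5_field fps)" and n: "n mod 5 = 2" and c: "(P * lattice_sum) $ n = P $ n"
  shows "(P * bmom 0) $ n = 0"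
proof -
  define x where "x = P * vmom 1"
  have x: "vmom 1 = theta 0 * x" using P unfolding x_def by (metis mult.assoc mult.commute mult_1)
  have "(2 * (P * bmom 0)) $ n = (P * lattice_sum - euler P - x) $ n"
    unfolding appell_M0[OF x P, symmetric] by (simp add: mult.assoc)
  moreover have "of_nat n = (2 :: 'a)" using n of_nat_mod5[of n, where 'a='a] by simp
  ultimately have "2 * (P * bmom 0) $ n = 0"
    using appell_coeff[OF x P n] c by (simp add: numeral_fps_const)
  then show ?thesis using two_neq_0[where 'a='a] by simp
qed

section \<open>Jacobi's identity for the cube of an infinite product\<close>

text \<open>Congruence modulo $q^k$, which stands in for limits when finite products are compared
  with infinite ones.\<close>

definition eqm :: "nat \<Rightarrow> 'a fps \<Rightarrow> 'a fps \<Rightarrow> bool"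
  where "eqm k f g \<longleftrightarrow> (\<forall>j<k. f $ j = g $ j)"

lemma eqm_refl [simp]: "eqm k f f" and eqm_sym: "eqm k f g \<Longrightarrow> eqm k g f"
  and eqm_trans: "eqm k f g \<Longrightarrow> eqm k g h \<Longrightarrow> eqm k f h"
  and eqm_mono: "eqm k f g \<Longrightarrow> l \<le> k \<Longrightarrow> eqm l f g"
  by (auto simp: eqm_def)

lemma eqm_mult: "eqm k f f' \<Longrightarrow> eqm k g g' \<Longrightarrow> eqm k (f * g) (f' * g' :: 'a::comm_ring_1 fps)"
  by (simp add: eqm_def fps_mult_nth)

lemma eqm_X_mult: "eqm k f g \<Longrightarrow> eqm (k + l) (fps_X ^ l * f) (fps_X ^ l * g :: 'a::comm_ring_1 fps)"
  by (auto simp: eqm_def fps_X_power_mult_nth)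

lemma eqm_sum: "(\<And>i. i \<in> A \<Longrightarrow> eqm k (f i) (g i)) \<Longrightarrow> eqm k (sum f A) (sum g A :: 'a::comm_ring_1 fps)"
  by (simp add: eqm_def fps_sum_nth)

lemma eqm_euler: "eqm k f g \<Longrightarrow> eqm k (euler f) (euler g :: 'a::comm_ring_1 fps)"
  by (simp add: eqm_def)

lemma eqm_uminus: "eqm k f g \<Longrightarrow> eqm k (- f) (- g :: 'a::comm_ring_1 fps)"
  by (simp add: eqm_def)

lemma eqm_X_power: "k \<le> l \<Longrightarrow> eqm k (fps_X ^ l * f) (0 :: 'a::comm_ring_1 fps)"
  by (simp add: eqm_def fps_X_power_mult_nth)

lemma eqm_eq: "(\<And>k. eqm (Suc k) f g) \<Longrightarrow> f = g"
  by (rule fps_ext) (auto simp: eqm_def)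

lemma eqm_fsum:
  assumes "locfin f I" "finite A" "A \<subseteq> I" "\<And>i. i \<in> I - A \<Longrightarrow> eqm k (f i) 0"
  shows "eqm k (fsum f I) (sum f A :: 'a::comm_ring_1 fps)"
  unfolding eqm_def fps_sum_nth using assms by (auto intro!: fsum_nth simp: eqm_def)

section \<open>Finite and infinite $q$-products and their logarithmic derivatives\<close>

definition qpoch :: "nat \<Rightarrow> nat \<Rightarrow> 'a::char5_field fps"
  where "qpoch r n = (\<Prod>i=1..n. 1 - fps_X ^ (r * i))"

lemma qpoch_0 [simp]: "qpoch r 0 = 1" and qpoch_Suc: "qpoch r (Suc n) = qpoch r n * (1 - fps_X ^ (r * Suc n))"
  by (simp_all add: qpoch_def)

lemma qpoch_nth_0: "r > 0 \<Longrightarrow> qpoch r n $ 0 = 1"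
  by (induction n) (simp_all add: qpoch_Suc)

lemma qpoch_inverse: "r > 0 \<Longrightarrow> qpoch r n * inverse (qpoch r n) = 1"
  by (subst mult.commute, rule inverse_mult_eq_1) (simp add: qpoch_nth_0)

lemma qpoch_eqm:
  assumes r: "r > 0" and nm: "n \<le> m"
  shows "eqm (Suc n) (qpoch r m) (qpoch r n :: 'a::char5_field fps)"
  using nm
proof (induction m rule: dec_induct)
  case (step m)
  have "eqm (Suc n) (qpoch r (Suc m)) (qpoch r m * 1 :: 'a fps)"
    unfolding qpoch_Suc
  proof (rule eqm_mult[OF eqm_refl])
    have "Suc n \<le> 1 * Suc m" using step by simp
    also have "\<dots> \<le> r * Suc m" using r by (intro mult_le_mono1) simp
    finally have "Suc n \<le> r * Suc m" .
    then show "eqm (Suc n) (1 - fps_X ^ (r * Suc m)) (1 :: 'a fps)" by (auto simp: eqm_def)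
  qed
  then show ?case using step by (auto intro: eqm_trans)
qed simp

text \<open>The diagonal suffices: for positive \<open>r\<close> the coefficient of $q^n$ in
  \<open>qpoch r m\<close> is constant from \<open>m = n\<close> on.\<close>

definition qinf :: "nat \<Rightarrow> 'a::char5_field fps"
  where "qinf r = Abs_fps (\<lambda>n. qpoch r n $ n)"

lemma qinf_eqm:
  assumes "r > 0" shows "eqm (Suc n) (qinf r) (qpoch r n)"
  unfolding eqm_def
proof (intro allI impI)
  fix j assume "j < Suc n"
  then show "qinf r $ j = (qpoch r n :: 'a fps) $ j"
    using qpoch_eqm[OF assms, of j n, where 'a='a] by (simp add: qinf_def eqm_def)
qed

lemma qinf_eqm_inverse:
  assumes "r > 0" shows "eqm (Suc n) (qinf r * inverse (qpoch r n)) (1 :: 'a::char5_field fps)"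
  using eqm_mult[OF qinf_eqm[OF assms, of n] eqm_refl, of "inverse (qpoch r n :: 'a fps)"]
  by (simp add: qpoch_inverse[OF assms])

lemma qinf_nth_0: "r > 0 \<Longrightarrow> qinf r $ 0 = 1"
  by (simp add: qinf_def)

definition lambert :: "nat \<Rightarrow> 'a::char5_field fps"
  where "lambert r = fsum (\<lambda>i. fps_X ^ (r * i) * (of_nat i * inverse (1 - fps_X ^ (r * i)))) {1..}"

lemma le_mult_pos: "r > 0 \<Longrightarrow> i \<le> r * (i :: nat)"
  by (cases r) simp_all

lemma finite_le_mult: "r > 0 \<Longrightarrow> finite {i \<in> {1..}. r * i \<le> (k::nat)}"
  by (rule finite_subset[of _ "{..k}"]) (auto intro: order_trans[OF le_mult_pos])

text \<open>Logarithmic differentiation: the factor $1 - q^{ri}$ contributes $- r i q^{ri} / (1 -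
  q^{ri})$. In the limit this gives \<open>lambert\<close>.\<close>

lemma euler_qpoch:
  assumes "r > 0"
  shows "euler (qpoch r n) = - (of_nat r * (\<Sum>i=1..n. fps_X ^ (r * i) * (of_nat i * inverse (1 - fps_X ^ (r * i)))) * qpoch r n)"
proof (induction n)
  case (Suc n)
  let ?t = "1 - fps_X ^ (r * Suc n) :: 'a fps"
  have t: "?t * inverse ?t = 1"
    by (subst mult.commute, rule inverse_mult_eq_1) (use assms in simp)
  have e: "euler ?t = - (of_nat r * of_nat (Suc n) * fps_X ^ (r * Suc n))"
    by (simp only: euler_diff euler_1 euler_X_power of_nat_mult diff_0)
  have "euler (qpoch r (Suc n)) = euler (qpoch r n) * ?t - qpoch r n * (of_nat r * of_nat (Suc n) * fps_X ^ (r * Suc n)) * (?t * inverse ?t)"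
    unfolding qpoch_Suc euler_mult e t by simp
  also have "\<dots> = - (of_nat r * ((\<Sum>i=1..n. fps_X ^ (r * i) * (of_nat i * inverse (1 - fps_X ^ (r * i)))) +
      fps_X ^ (r * Suc n) * (of_nat (Suc n) * inverse ?t)) * (qpoch r n * ?t))"
    unfolding Suc.IH by (simp only: mult_ac distrib_left distrib_right minus_add_distrib mult_minus_left mult_minus_right diff_conv_add_uminus)
  finally show ?case by (simp add: qpoch_Suc)
qed simp

lemma euler_qinf:
  assumes "r > 0"
  shows "euler (qinf r) = - (of_nat r * lambert r * (qinf r :: 'a::char5_field fps))"
proof (rule eqm_eq)
  fix n
  let ?f = "\<lambda>i. fps_X ^ (r * i) * (of_nat i * inverse (1 - fps_X ^ (r * i))) :: 'a fps"
  have "eqm (Suc n) (lambert r) (\<Sum>i=1..n. ?f i)"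
    unfolding lambert_def
  proof (rule eqm_fsum)
    show "locfin ?f {1..}" by (rule locfin_X_power) (rule finite_le_mult[OF assms])
    fix i assume "i \<in> {1..} - {1..n}"
    then have "Suc n \<le> i" by auto
    also have "i \<le> r * i" using assms by simp
    finally show "eqm (Suc n) (?f i) 0" by (rule eqm_X_power)
  qed auto
  then have "eqm (Suc n) (- (of_nat r * lambert r * qinf r)) (- (of_nat r * (\<Sum>i=1..n. ?f i) * qpoch r n))"
    by (intro eqm_uminus eqm_mult eqm_refl qinf_eqm assms)
  then show "eqm (Suc n) (euler (qinf r)) (- (of_nat r * lambert r * (qinf r :: 'a fps)))"
    using eqm_euler[OF qinf_eqm[OF assms, of n, where 'a='a]] unfolding euler_qpoch[OF assms]
    by (rule eqm_trans[OF _ eqm_sym, rotated])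
qed

section \<open>A finite form of Jacobi's identity\<close>

definition inv_qpoch :: "nat \<Rightarrow> int \<Rightarrow> 'a::char5_field fps"
  where "inv_qpoch r m = (if m < 0 then 0 else inverse (qpoch r (nat m)))"

lemma inv_qpoch_neg [simp]: "m < 0 \<Longrightarrow> inv_qpoch r m = 0"
  by (simp add: inv_qpoch_def)

text \<open>The value 0 at negative indices agrees with the vanishing factor $1 - q^0$ at
  \<open>m = 0\<close>, so the recurrence holds at the edge of the support as well.\<close>

lemma inv_qpoch_diff1:
  assumes "r > 0" "m \<ge> 0"
  shows "inv_qpoch r (m - 1) = inv_qpoch r m * (1 - fps_X ^ (r * nat m) :: 'a::char5_field fps)"
proof (cases "m = 0")
  case False
  then obtain k where k: "nat m = Suc k" "nat (m - 1) = k" using assms(2) by (cases "nat m") auto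
  have "inv_qpoch r (m - 1) = inverse (qpoch r k) * (qpoch r (Suc k) * inverse (qpoch r (Suc k) :: 'a fps))"
    unfolding qpoch_inverse[OF assms(1)] using False assms(2) k by (simp add: inv_qpoch_def)
  also have "\<dots> = (qpoch r k * inverse (qpoch r k)) * inverse (qpoch r (Suc k)) * (1 - fps_X ^ (r * Suc k))"
    by (subst (1) qpoch_Suc) (simp only: mult_ac)
  finally show ?thesis using assms(2) k by (simp add: inv_qpoch_def qpoch_inverse[OF assms(1)])
qed (simp add: assms)

definition tri :: "int \<Rightarrow> nat" where "tri k = nat (k * (k + 1) div 2)"

lemma tri_minus: "tri (- k - 1) = tri k"
  by (simp add: tri_def algebra_simps)

lemma tri_int: "2 * int (tri k) = k * (k + 1)"
proof -
  have "0 \<le> k * (k + 1)" by (cases "k \<ge> 0") (auto simp: mult_nonneg_nonneg mult_nonpos_nonpos)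
  moreover have "even (k * (k + 1))" by simp
  ultimately show ?thesis by (simp add: tri_def)
qed

lemma tri_add1: "int (tri (k + 1)) = int (tri k) + k + 1"
  using tri_int[of k] tri_int[of "k + 1"] by (simp add: algebra_simps)

text \<open>\<open>eJ r n k\<close> is a finite form of the terms in $(q)_\infty^3 = \sum_k (-1)^k k q^{k(k+1)/2}$ (all integers \<open>k\<close>),
  and \<open>mJ\<close> sums these terms; \<open>mJ_step\<close> evaluates the sum as a product.\<close>

definition cJ :: "nat \<Rightarrow> int \<Rightarrow> 'a::char5_field fps"
  where "cJ r k = alt_sign k * fps_X ^ (r * tri k)"

definition eJ :: "nat \<Rightarrow> int \<Rightarrow> int \<Rightarrow> 'a::char5_field fps"
  where "eJ r n k = cJ r k * inv_qpoch r (n - k) * inv_qpoch r (n + k + 1)"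

text \<open>Companion of \<open>eJ\<close> with only the numerator advanced to \<open>k + 1\<close>;
  the shift of \<open>k\<close> closes on the pair, not on \<open>eJ\<close> alone.\<close>

definition fJ :: "nat \<Rightarrow> int \<Rightarrow> int \<Rightarrow> 'a::char5_field fps"
  where "fJ r n k = cJ r (k + 1) * inv_qpoch r (n - k) * inv_qpoch r (n + k + 1)"

lemma eJ_zero: "k < - n - 1 \<or> k > n \<Longrightarrow> eJ r n k = 0" and fJ_zero: "k < - n - 1 \<or> k > n \<Longrightarrow> fJ r n k = 0"
  by (auto simp: eJ_def fJ_def)

lemma cJ_reflect: "cJ r (- k - 1) = - cJ r k"
  by (auto simp: cJ_def tri_minus alt_sign_def)

lemma eJ_reflect: "eJ r n (- k - 1) = - eJ r n k"
  by (simp add: eJ_def cJ_reflect algebra_simps)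

text \<open>Triangular numbers grow by \<open>tri (k + 1) - tri k = k + 1\<close>, so a power of $q$
  can be traded for a step in \<open>k\<close>, which also flips the sign.\<close>

lemma cJ_shift:
  assumes "0 \<le> a" "0 \<le> b" "a = b + k + 1"
  shows "fps_X ^ (r * nat a) * cJ r k = - (fps_X ^ (r * nat b) * cJ r (k + 1) :: 'a::char5_field fps)"
proof -
  have "nat a + tri k = nat b + tri (k + 1)" using assms tri_add1[of k] by linarith
  then have "fps_X ^ (r * nat a) * fps_X ^ (r * tri k) = (fps_X ^ (r * nat b) * fps_X ^ (r * tri (k + 1)) :: 'a fps)"
    by (simp flip: power_add distrib_left)
  then show ?thesis by (auto simp: cJ_def alt_sign_def)
qed

lemma eJ_shift1: "n \<ge> 0 \<Longrightarrow> fps_X ^ (r * nat (n + k + 1)) * eJ r n k = - (fps_X ^ (r * nat n) * fJ r n k)"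
proof (cases "k < - n - 1 \<or> k > n")
  case False
  assume "n \<ge> 0"
  then have "fps_X ^ (r * nat (n + k + 1)) * cJ r k = - (fps_X ^ (r * nat n) * cJ r (k + 1))"
    by (intro cJ_shift) (use False in auto)
  then have "fps_X ^ (r * nat (n + k + 1)) * cJ r k * (inv_qpoch r (n - k) * inv_qpoch r (n + k + 1))
    = - (fps_X ^ (r * nat n) * cJ r (k + 1)) * (inv_qpoch r (n - k) * inv_qpoch r (n + k + 1))" by (rule arg_cong)
  then show ?thesis by (simp add: eJ_def fJ_def mult_ac)
qed (simp_all add: eJ_zero fJ_zero)

lemma eJ_shift2: "n \<ge> 0 \<Longrightarrow> fps_X ^ (r * nat (n - k)) * fJ r n k = - (fps_X ^ (r * nat (n + 1)) * eJ r n k)"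
proof (cases "k < - n - 1 \<or> k > n")
  case False
  assume "n \<ge> 0"
  then have "fps_X ^ (r * nat (n + 1)) * cJ r k = - (fps_X ^ (r * nat (n - k)) * cJ r (k + 1))"
    by (intro cJ_shift) (use False in auto)
  then have "fps_X ^ (r * nat (n + 1)) * cJ r k * (inv_qpoch r (n - k) * inv_qpoch r (n + k + 1))
    = - (fps_X ^ (r * nat (n - k)) * cJ r (k + 1)) * (inv_qpoch r (n - k) * inv_qpoch r (n + k + 1))" by (rule arg_cong)
  then have "fps_X ^ (r * nat (n + 1)) * eJ r n k = - (fps_X ^ (r * nat (n - k)) * fJ r n k)"
    by (simp add: eJ_def fJ_def mult_ac)
  then show ?thesis by (metis minus_minus)
qed (simp_all add: eJ_zero fJ_zero)

text \<open>The ratio of consecutive terms involves powers of $q$ that depend on \<open>k\<close>.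
  \<open>eJ_shift1\<close> and \<open>eJ_shift2\<close> absorb them, so the coefficients no longer
  depend on \<open>k\<close> and the relation can be summed.\<close>

lemma eJ_rec:
  assumes "r > 0" "n \<ge> 0"
  shows "eJ r n (k + 1) + fps_X ^ (r * nat n) * fJ r n (k + 1) = fJ r n k + fps_X ^ (r * nat (n + 1)) * (eJ r n k :: 'a::char5_field fps)"
proof -
  have 1: "inv_qpoch r (n - (k + 1)) = inv_qpoch r (n - k) * (1 - fps_X ^ (r * nat (n - k)) :: 'a fps)"
    using inv_qpoch_diff1[OF assms(1), of "n - k", where 'a='a] by (cases "n - k \<ge> 0") (auto simp: algebra_simps)
  have 2: "inv_qpoch r (n + k + 1) = inv_qpoch r (n + (k + 1) + 1) * (1 - fps_X ^ (r * nat (n + (k + 1) + 1)) :: 'a fps)"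
    using inv_qpoch_diff1[OF assms(1), of "n + (k + 1) + 1", where 'a='a] by (cases "n + (k + 1) + 1 \<ge> 0") (auto simp: algebra_simps)
  have "eJ r n (k + 1) * (1 - fps_X ^ (r * nat (n + (k + 1) + 1))) = (1 - fps_X ^ (r * nat (n - k))) * (fJ r n k :: 'a fps)"
    unfolding eJ_def fJ_def 1 2 by (simp only: mult_ac)
  then have "eJ r n (k + 1) - fps_X ^ (r * nat (n + (k + 1) + 1)) * eJ r n (k + 1) = fJ r n k - fps_X ^ (r * nat (n - k)) * (fJ r n k :: 'a fps)"
    by (simp only: right_diff_distrib left_diff_distrib mult_1 mult_1_right mult.commute)
  then show ?thesis unfolding eJ_shift1[OF assms(2)] eJ_shift2[OF assms(2)] by simp
qed

definition mJ :: "nat \<Rightarrow> int \<Rightarrow> 'a::char5_field fps"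
  where "mJ r n = (\<Sum>k\<in>{- n - 2..n + 1}. of_int k * eJ r n k)"

text \<open>The range in \<open>mJ\<close> is one step wider on each side than the support of
  \<open>eJ\<close> and \<open>fJ\<close>. So the end terms required to vanish here do vanish, and
  the range stays symmetric under \<open>k \<rightarrow> - k - 1\<close>.\<close>

lemma sum_shift_int:
  fixes G :: "int \<Rightarrow> 'a::comm_monoid_add"
  assumes "G a = 0" "G (b + 1) = 0" "a \<le> b"
  shows "(\<Sum>k\<in>{a..b}. G (k + 1)) = (\<Sum>k\<in>{a..b}. G k)"
proof -
  have "bij_betw (\<lambda>k. k + 1) {a..b} {a + 1..b + 1}"
    by (rule bij_betw_byWitness[of _ "\<lambda>k. k - 1"]) auto
  then have "(\<Sum>k\<in>{a..b}. G (k + 1)) = (\<Sum>k\<in>{a + 1..b + 1}. G k)"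
    by (rule sum.reindex_bij_betw)
  also have "{a + 1..b + 1} = insert (b + 1) {a + 1..b}" using assms(3) by auto
  also have "sum G \<dots> = sum G (insert a {a + 1..b})" using assms(1,2) by simp
  also have "insert a {a + 1..b} = {a..b}" using assms(3) by auto
  finally show ?thesis .
qed

lemma sum_reflect_int:
  fixes G :: "int \<Rightarrow> 'a::comm_monoid_add"
  shows "(\<Sum>k\<in>{- n - 2..n + 1}. G (- k - 1)) = (\<Sum>k\<in>{- n - 2..n + 1}. G k)"
proof -
  have "bij_betw (\<lambda>k. - k - 1) {- n - 2..n + 1} {- n - 2..n + 1}"
    by (rule bij_betw_byWitness[of _ "\<lambda>k. - k - 1"]) auto
  then show ?thesis by (rule sum.reindex_bij_betw)
qed

lemma mJ_step:
  assumes r: "r > 0" and n: "n \<ge> 1"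
  shows "mJ r (n - 1) * (1 - fps_X ^ (r * nat n))
    = mJ r n * (1 + fps_X ^ (r * nat n)) * (1 - fps_X ^ (r * nat (2 * n + 1)) :: 'a::char5_field fps)"
proof -
  let ?S = "{- n - 2..n + 1}" and ?z = "\<lambda>m. fps_X ^ (r * nat m) :: 'a fps"
  let ?e = "eJ r n :: int \<Rightarrow> 'a fps" and ?f = "fJ r n :: int \<Rightarrow> 'a fps"
  define mu where "mu = (\<Sum>k\<in>?S. of_int k * ?f k)"
  define si where "si = (\<Sum>k\<in>?S. ?f k)"
  have n0: "n \<ge> 0" using n by simp
  have e0: "(\<Sum>k\<in>?S. ?e k) = 0"
  proof -
    have "(\<Sum>k\<in>?S. ?e k) = - (\<Sum>k\<in>?S. ?e k)"
      using sum_reflect_int[of ?e n] by (simp add: eJ_reflect sum_negf)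
    then have "2 * (\<Sum>k\<in>?S. ?e k) = 0" by (metis add.right_inverse mult_2)
    moreover have "(2 :: 'a fps) \<noteq> 0" using two_neq_0[where 'a='a] by (simp add: numeral_fps_const)
    ultimately show ?thesis by simp
  qed
  have zn1: "1 - ?z n \<noteq> 0"
  proof
    assume "1 - ?z n = 0"
    then have "(1 - ?z n) $ 0 = 0" by simp
    then show False using r n by simp
  qed
  \<comment> \<open>\<open>eJ_rec\<close> summed against a weight \<open>F\<close>: the constant
    weight shows that \<open>si\<close> is 0, and the weight \<open>k\<close> expresses
    \<open>mu\<close> through \<open>mJ r n\<close>.\<close>
  have shift: "(\<Sum>k\<in>?S. of_int (F (k + 1)) * (?f k + ?z (n + 1) * ?e k)) = (\<Sum>k\<in>?S. of_int (F k) * (?e k + ?z n * ?f k))" for F :: "int \<Rightarrow> int"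
  proof -
    have "(\<Sum>k\<in>?S. of_int (F (k + 1)) * (?e (k + 1) + ?z n * ?f (k + 1))) = (\<Sum>k\<in>?S. of_int (F k) * (?e k + ?z n * ?f k))"
      by (rule sum_shift_int[of "\<lambda>k. of_int (F k) * (?e k + ?z n * ?f k)"]) (use n in \<open>simp_all add: eJ_zero fJ_zero\<close>)
    then show ?thesis unfolding eJ_rec[OF r n0] .
  qed
  have "si + ?z (n + 1) * 0 = 0 + ?z n * si"
    using shift[of "\<lambda>_. 1"] by (simp add: si_def sum.distrib sum_distrib_left[symmetric] e0)
  then have "si * (1 - ?z n) = 0" by (simp add: algebra_simps)
  then have si: "si = 0" using zn1 by simp
  have "(\<Sum>k\<in>?S. of_int (k + 1) * (?f k + ?z (n + 1) * ?e k)) = (mu + si) + ?z (n + 1) * (mJ r n + (\<Sum>k\<in>?S. ?e k))"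
    unfolding si_def mu_def mJ_def by (simp add: sum.distrib sum_distrib_left algebra_simps)
  moreover have "(\<Sum>k\<in>?S. of_int k * (?e k + ?z n * ?f k)) = mJ r n + ?z n * mu"
    unfolding mu_def mJ_def by (simp add: sum.distrib sum_distrib_left algebra_simps)
  ultimately have "(mu + si) + ?z (n + 1) * (mJ r n + 0) = mJ r n + ?z n * mu"
    using shift[of "\<lambda>k. k"] unfolding e0 by simp
  then have mu: "mu * (1 - ?z n) = mJ r n * (1 - ?z (n + 1))"
    by (simp add: si algebra_simps)
  \<comment> \<open>Lowering \<open>n\<close> by one multiplies the term by $(1 - q^{r(n-k)}) (1 -
    q^{r(n+k+1)})$, which is expanded; the two middle sums are \<open>b\<close> and \<open>a\<close>
    below.\<close>
  have step: "eJ r (n - 1) k = ?e k - ?z (n - k) * ?e k - ?z (n + k + 1) * ?e k + ?z (2 * n + 1) * ?e k" for k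
  proof (cases "k < - n - 1 \<or> k > n")
    case False
    have 1: "inv_qpoch r (n - 1 - k) = inv_qpoch r (n - k) * (1 - ?z (n - k))"
      using inv_qpoch_diff1[OF r, of "n - k", where 'a='a] False by (simp add: algebra_simps)
    have 2: "inv_qpoch r (n - 1 + k + 1) = inv_qpoch r (n + k + 1) * (1 - ?z (n + k + 1))"
      using inv_qpoch_diff1[OF r, of "n + k + 1", where 'a='a] False by (simp add: algebra_simps)
    have "nat (n - k) + nat (n + k + 1) = nat (2 * n + 1)" using False by linarith
    then have 3: "?z (n - k) * ?z (n + k + 1) = ?z (2 * n + 1)"
      by (simp flip: power_add distrib_left)
    have "eJ r (n - 1) k = ?e k * ((1 - ?z (n - k)) * (1 - ?z (n + k + 1)))"
      unfolding eJ_def 1 2 by (simp only: mult_ac)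
    also have "\<dots> = ?e k * (1 - ?z (n - k) - ?z (n + k + 1) + ?z (n - k) * ?z (n + k + 1))"
      by (simp add: algebra_simps)
    finally show ?thesis unfolding 3 by (simp add: algebra_simps)
  qed (auto simp: eJ_zero)
  have a: "(\<Sum>k\<in>?S. of_int k * (?z (n + k + 1) * ?e k)) = - (?z n * mu)"
    unfolding eJ_shift1[OF n0] mu_def by (simp add: sum_distrib_left sum_negf mult_ac)
  \<comment> \<open>The reflection \<open>k \<rightarrow> - k - 1\<close> exchanges the exponents
    \<open>n - k\<close> and \<open>n + k + 1\<close>, so this reduces to the case treated in
    \<open>a\<close>.\<close>
  have b: "(\<Sum>k\<in>?S. of_int k * (?z (n - k) * ?e k)) = - (?z n * mu)"
  proof -
    have "(\<Sum>k\<in>?S. of_int k * (?z (n - k) * ?e k)) = (\<Sum>k\<in>?S. of_int (- k - 1) * (?z (n - (- k - 1)) * ?e (- k - 1)))"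
      by (rule sum_reflect_int[symmetric])
    also have "\<dots> = (\<Sum>k\<in>?S. of_int (k + 1) * (?z (n + k + 1) * ?e k))"
      unfolding eJ_reflect by (intro sum.cong refl) (simp add: algebra_simps)
    also have "\<dots> = - (?z n * (mu + si))"
      unfolding eJ_shift1[OF n0] mu_def si_def
      by (simp add: sum_distrib_left sum_negf[symmetric] sum.distrib[symmetric] algebra_simps)
    finally show ?thesis by (simp add: si)
  qed
  have "mJ r (n - 1) = (\<Sum>k\<in>?S. of_int k * eJ r (n - 1) k)"
    unfolding mJ_def by (rule sum.mono_neutral_left) (auto simp: eJ_zero)
  also have "\<dots> = (\<Sum>k\<in>?S. of_int k * ?e k) - (\<Sum>k\<in>?S. of_int k * (?z (n - k) * ?e k))
      - (\<Sum>k\<in>?S. of_int k * (?z (n + k + 1) * ?e k)) + (\<Sum>k\<in>?S. ?z (2 * n + 1) * (of_int k * ?e k))"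
    unfolding step by (simp add: sum.distrib sum_subtractf algebra_simps)
  also have "\<dots> = mJ r n * (1 + ?z (2 * n + 1)) + 2 * ?z n * mu"
    unfolding a b sum_distrib_left[symmetric] mJ_def[symmetric] by (simp add: algebra_simps)
  finally have "mJ r (n - 1) * (1 - ?z n) = mJ r n * (1 + ?z (2 * n + 1)) * (1 - ?z n) + 2 * ?z n * (mu * (1 - ?z n))"
    by (simp add: algebra_simps)
  also have "\<dots> = mJ r n * ((1 + ?z (2 * n + 1)) * (1 - ?z n) + 2 * ?z n * (1 - ?z (n + 1)))"
    unfolding mu by (simp add: algebra_simps)
  also have "(1 + ?z (2 * n + 1)) * (1 - ?z n) + 2 * ?z n * (1 - ?z (n + 1)) = (1 + ?z n) * (1 - ?z (2 * n + 1))"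
  proof -
    have "nat n + nat (n + 1) = nat (2 * n + 1)" using n by linarith
    then have "?z n * ?z (n + 1) = ?z (2 * n + 1)" by (simp flip: power_add distrib_left)
    then show ?thesis by (simp add: algebra_simps)
  qed
  finally show ?thesis by (simp add: mult_ac)
qed

text \<open>As \<open>n\<close> grows, the right-hand side tends to one Euler product, while each
  \<open>eJ\<close> tends to its numerator divided by two of them. This is how the cube
  arises.\<close>

lemma mJ_eq:
  assumes r: "r > 0"
  shows "mJ r (int n) = qpoch r n * qpoch r n * (inv_qpoch r (2 * int n + 1) :: 'a::char5_field fps)"
proof (induction n)
  case 0
  have "{- 2..1} = {-2, -1, 0, 1 :: int}" by auto
  then have "mJ r 0 = (inv_qpoch r 1 :: 'a fps)"
    by (simp add: mJ_def eJ_def) (simp add: inv_qpoch_def cJ_def tri_def alt_sign_def)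
  then show ?case by simp
next
  case (Suc n)
  let ?z = "\<lambda>m. fps_X ^ (r * m) :: 'a fps"
  have 1: "inv_qpoch r (2 * int n + 1) = inv_qpoch r (2 * int (Suc n) + 1) * (1 - ?z (2 * Suc n + 1)) * (1 - ?z (2 * Suc n))"
  proof -
    have "inv_qpoch r (2 * int n + 1) = inv_qpoch r (2 * int (Suc n)) * (1 - ?z (2 * Suc n))"
      using inv_qpoch_diff1[OF r, of "2 * int (Suc n)", where 'a='a] by (simp add: nat_add_distrib nat_mult_distrib algebra_simps)
    moreover have "inv_qpoch r (2 * int (Suc n)) = inv_qpoch r (2 * int (Suc n) + 1) * (1 - ?z (2 * Suc n + 1))"
      using inv_qpoch_diff1[OF r, of "2 * int (Suc n) + 1", where 'a='a] by (simp add: nat_add_distrib nat_mult_distrib algebra_simps)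
    ultimately show ?thesis by simp
  qed
  have zz: "?z (2 * Suc n) = ?z (Suc n) * ?z (Suc n)" by (simp flip: power_add add: algebra_simps)
  have "(1 + ?z (Suc n)) $ 0 \<noteq> 0" "(1 - ?z (2 * Suc n + 1)) $ 0 \<noteq> 0" using r by simp_all
  then have nz: "(1 + ?z (Suc n)) * (1 - ?z (2 * Suc n + 1)) \<noteq> 0"
    by (metis fps_zero_nth mult_eq_0_iff)
  have "mJ r (int (Suc n)) * ((1 + ?z (Suc n)) * (1 - ?z (2 * Suc n + 1))) = mJ r (int n) * (1 - ?z (Suc n))"
    using mJ_step[OF r, of "int (Suc n)", where 'a='a] by (simp add: nat_add_distrib nat_mult_distrib mult_ac algebra_simps)
  also have "\<dots> = qpoch r (Suc n) * qpoch r (Suc n) * inv_qpoch r (2 * int (Suc n) + 1) * ((1 + ?z (Suc n)) * (1 - ?z (2 * Suc n + 1)))"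
    unfolding Suc.IH 1 qpoch_Suc zz by (simp add: algebra_simps)
  finally show ?case using nz by (metis mult_right_cancel)
qed

text \<open>The indices \<open>k\<close> and \<open>- k - 1\<close> have equal exponents and
  opposite signs, so folding them turns the weight \<open>k\<close> into
  \<open>k - (- k - 1) = 2 * k + 1\<close>.\<close>

definition jacobi :: "nat \<Rightarrow> 'a::char5_field fps"
  where "jacobi r = fsum (\<lambda>k. fps_X ^ (r * tri (int k)) * (alt_sign (int k) * of_nat (2 * k + 1))) UNIV"

lemma tri_ge: "k \<le> tri (int k)"
proof (cases k)
  case (Suc j)
  have "2 * int k \<le> int k * (int k + 1)" by (simp add: Suc algebra_simps)
  then show ?thesis using tri_int[of "int k"] by linarith
qed simp

lemma mJ_half: "mJ r (int n) = (\<Sum>k\<le>n. of_nat (2 * k + 1) * eJ r (int n) (int k))"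
proof -
  let ?g = "\<lambda>k. of_int k * eJ r (int n) k :: 'a fps"
  have "mJ r (int n) = sum ?g ({- int n - 2..-1} \<union> {0..int n + 1})"
    unfolding mJ_def by (rule sum.cong) auto
  also have "\<dots> = sum ?g {- int n - 2..-1} + sum ?g {0..int n + 1}"
    by (rule sum.union_disjoint) auto
  also have "sum ?g {- int n - 2..-1} = (\<Sum>k\<in>{0..int n + 1}. ?g (- k - 1))"
    by (rule sum.reindex_bij_witness[of _ "\<lambda>k. - k - 1" "\<lambda>k. - k - 1"]) auto
  also have "\<dots> + sum ?g {0..int n + 1} = (\<Sum>k\<in>{0..int n + 1}. of_int (2 * k + 1) * eJ r (int n) k)"
    unfolding sum.distrib[symmetric] eJ_reflect by (intro sum.cong refl) (simp add: algebra_simps)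
  also have "\<dots> = (\<Sum>k\<in>{0..int n}. of_int (2 * k + 1) * eJ r (int n) k)"
    by (rule sum.mono_neutral_right) (auto simp: eJ_zero)
  also have "\<dots> = (\<Sum>k\<le>n. of_nat (2 * k + 1) * eJ r (int n) (int k))"
    by (rule sum.reindex_bij_witness[of _ int nat]) auto
  finally show ?thesis .
qed

lemma jacobi_cube:
  assumes r: "r > 0"
  shows "jacobi r = (qinf r ^ 3 :: 'a::char5_field fps)"
proof (rule eqm_eq)
  fix n
  let ?w = "qinf r :: 'a fps"
  let ?t = "\<lambda>k. fps_X ^ (r * tri (int k)) * (alt_sign (int k) * of_nat (2 * k + 1)) :: 'a fps"
  have ge: "k \<le> r * tri (int k)" for k
    using tri_ge[of k] le_mult_pos[OF r] by (rule order_trans)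
  have "eqm (Suc n) (jacobi r) (sum ?t {..n})"
    unfolding jacobi_def
  proof (rule eqm_fsum)
    show "locfin ?t UNIV"
    proof (rule locfin_X_power)
      fix m show "finite {k \<in> UNIV. r * tri (int k) \<le> m}"
        by (rule finite_subset[of _ "{..m}"]) (auto intro: order_trans[OF ge])
    qed
    fix k assume "k \<in> UNIV - {..n}"
    then have "Suc n \<le> k" by auto
    then show "eqm (Suc n) (?t k) 0" by (intro eqm_X_power order_trans[OF _ ge])
  qed auto
  moreover have "eqm (Suc n) (?w * ?w * mJ r (int n)) (sum ?t {..n})"
    unfolding mJ_half sum_distrib_left
  proof (rule eqm_sum)
    fix k assume k: "k \<in> {..n}"
    have n1: "nat (int n + int k + 1) = n + k + 1" "nat (int n - int k) = n - k" using k by auto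
    have 1: "eqm (Suc (n - k)) (?w * inv_qpoch r (int n - int k)) 1"
      using qinf_eqm_inverse[OF r, of "n - k", where 'a='a] k by (simp add: inv_qpoch_def n1)
    have "eqm (Suc (n + k + 1)) (?w * inv_qpoch r (int n + int k + 1)) 1"
      using qinf_eqm_inverse[OF r, of "n + k + 1", where 'a='a] by (simp add: inv_qpoch_def n1)
    then have 2: "eqm (Suc (n - k)) (?w * inv_qpoch r (int n + int k + 1)) 1" by (rule eqm_mono) simp
    \<comment> \<open>The inverse products are reliable only up to degree \<open>n - k\<close>; the
      factor $q^{r tri(k)}$ with exponent at least \<open>k\<close> restores the precision
      \<open>n\<close>.\<close>
    have "eqm (Suc (n - k)) ((?w * inv_qpoch r (int n - int k)) * (?w * inv_qpoch r (int n + int k + 1)) * (alt_sign (int k) * of_nat (2 * k + 1))) (1 * 1 * (alt_sign (int k) * of_nat (2 * k + 1)))"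
      by (intro eqm_mult 1 2 eqm_refl)
    from eqm_X_mult[OF this, of "r * tri (int k)"]
    have "eqm (Suc (n - k) + r * tri (int k)) (?w * ?w * (of_nat (2 * k + 1) * eJ r (int n) (int k))) (?t k)"
      by (simp add: eJ_def cJ_def mult_ac)
    then show "eqm (Suc n) (?w * ?w * (of_nat (2 * k + 1) * eJ r (int n) (int k))) (?t k)"
      by (rule eqm_mono) (use ge[of k] k in auto)
  qed
  moreover have "eqm (Suc n) (?w * ?w * mJ r (int n)) (?w ^ 3)"
  proof -
    have n1: "nat (2 * int n + 1) = 2 * n + 1" by simp
    have "eqm (Suc (2 * n + 1)) (?w * inv_qpoch r (2 * int n + 1)) 1"
      using qinf_eqm_inverse[OF r, of "2 * n + 1", where 'a='a] by (simp add: inv_qpoch_def n1)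
    then have 1: "eqm (Suc n) (?w * inv_qpoch r (2 * int n + 1)) 1" by (rule eqm_mono) simp
    have 2: "eqm (Suc n) (qpoch r n) ?w" using qinf_eqm[OF r] eqm_sym by blast
    have "eqm (Suc n) (?w * (qpoch r n * qpoch r n * (?w * inv_qpoch r (2 * int n + 1)))) (?w * (?w * ?w * 1))"
      by (intro eqm_mult 1 2 eqm_refl)
    then show ?thesis unfolding mJ_eq[OF r] by (simp add: mult_ac power3_eq_cube)
  qed
  ultimately show "eqm (Suc n) (jacobi r) (?w ^ 3)"
    by (meson eqm_sym eqm_trans)
qed

section \<open>The constant of the lattice sum as a Lambert series\<close>

lemma fsum_Un:
  assumes "locfin f (A \<union> B)" "A \<inter> B = {}"
  shows "fsum f (A \<union> B) = fsum f A + (fsum f B :: 'a::comm_ring_1 fps)"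
proof (rule fps_ext)
  fix n
  obtain S where S: "finite S" "S \<subseteq> A \<union> B" "\<And>i k. i \<in> A \<union> B - S \<Longrightarrow> k \<le> n \<Longrightarrow> f i $ k = 0"
    "\<And>k. k \<le> n \<Longrightarrow> fsum f (A \<union> B) $ k = (\<Sum>i\<in>S. f i $ k)"
    using locfin_obtain[OF assms(1)] by metis
  have "fsum f A $ n = (\<Sum>i\<in>S \<inter> A. f i $ n)" "fsum f B $ n = (\<Sum>i\<in>S \<inter> B. f i $ n)"
    by (rule fsum_nth; use S in auto)+
  moreover have "(\<Sum>i\<in>S. f i $ n) = (\<Sum>i\<in>(S \<inter> A) \<union> (S \<inter> B). f i $ n)"
    by (rule sum.cong) (use S(2) in auto)
  moreover have "\<dots> = (\<Sum>i\<in>S \<inter> A. f i $ n) + (\<Sum>i\<in>S \<inter> B. f i $ n)"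
    by (rule sum.union_disjoint) (use S(1) assms(2) in auto)
  ultimately show "fsum f (A \<union> B) $ n = (fsum f A + fsum f B) $ n"
    by (simp add: S(4))
qed

lemma locfin_geometric:
  assumes "e > 0" shows "locfin (\<lambda>d::nat. fps_X ^ (e * d) * h d :: 'a::comm_ring_1 fps) I"
proof (rule locfin_X_power)
  fix k show "finite {i \<in> I. e * i \<le> k}"
    by (rule finite_subset[of _ "{..k}"]) (use assms in \<open>auto intro: order_trans[OF le_mult_pos]\<close>)
qed

lemma fsum_nat_Suc:
  assumes "locfin f UNIV"
  shows "fsum f UNIV = f 0 + fsum (\<lambda>d. f (Suc d)) (UNIV :: nat set)"
proof -
  have "n \<in> insert 0 (range Suc)" for n by (cases n) auto
  then have U: "UNIV = insert 0 (range Suc)" by blast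
  have "fsum f (insert 0 (range Suc)) = f 0 + fsum f (range Suc)"
    by (rule fsum_insert) (use assms U in auto)
  also have "fsum f (range Suc) = fsum (\<lambda>d. f (Suc d)) UNIV"
    by (rule fsum_reindex) (simp add: bij_betw_def)
  finally show ?thesis using U by simp
qed

lemma fsum_even:
  fixes f :: "int \<Rightarrow> 'a::comm_ring_1 fps"
  assumes "locfin f UNIV" "\<And>n. f (- n) = f n"
  shows "fsum f (UNIV - {0}) = 2 * fsum (\<lambda>n. f (int (Suc n))) UNIV"
proof -
  have "s \<in> range (\<lambda>n. int (Suc n)) \<union> range (\<lambda>n. - int (Suc n))" if "s \<noteq> 0" for s :: int
  proof (cases "s > 0")
    case True
    then have "s = int (Suc (nat s - 1))" by simp
    then show ?thesis by blast
  next
    case False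
    then have "s = - int (Suc (nat (- s) - 1))" using that by simp
    then show ?thesis by blast
  qed
  then have U: "UNIV - {0} = range (\<lambda>n. int (Suc n)) \<union> range (\<lambda>n. - int (Suc n))" by auto
  have "fsum f (range (\<lambda>n. int (Suc n)) \<union> range (\<lambda>n. - int (Suc n)))
      = fsum f (range (\<lambda>n. int (Suc n))) + fsum f (range (\<lambda>n. - int (Suc n)))"
    by (rule fsum_Un) (auto intro: locfin_subset[OF assms(1)])
  also have "fsum f (range (\<lambda>n. int (Suc n))) = fsum (\<lambda>n. f (int (Suc n))) UNIV"
    by (rule fsum_reindex) (simp add: bij_betw_def inj_on_def)
  also have "fsum f (range (\<lambda>n. - int (Suc n))) = fsum (\<lambda>n. f (- int (Suc n))) UNIV"
    by (rule fsum_reindex) (simp add: bij_betw_def inj_on_def)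
  finally show ?thesis unfolding U assms(2) by simp
qed

lemma fsum_atLeast_1: "fsum f {1..} = fsum (\<lambda>n. f (Suc n)) UNIV"
proof (rule fsum_reindex)
  have "n \<in> range Suc" if "1 \<le> n" for n using that by (cases n) auto
  then show "bij_betw Suc UNIV {1..}" by (auto simp: bij_betw_def)
qed

lemma fsum_geometric:
  assumes e: "e > 0"
  shows "fsum (\<lambda>d::nat. fps_X ^ (e * d) * 1) UNIV = (inverse (1 - fps_X ^ e) :: 'a::field fps)" (is "?g0 = ?R")
    and "fsum (\<lambda>d::nat. fps_X ^ (e * d) * of_nat d) UNIV = (fps_X ^ e * inverse (1 - fps_X ^ e) * inverse (1 - fps_X ^ e) :: 'a fps)" (is "?g1 = _")
proof -
  let ?Q = "fps_X ^ e :: 'a fps"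
  have R: "?R * (1 - ?Q) = 1" by (rule inverse_mult_eq_1) (use e in simp)
  have "?g0 = fps_X ^ (e * 0) * 1 + fsum (\<lambda>d. fps_X ^ (e * Suc d) * 1) UNIV"
    by (rule fsum_nat_Suc) (rule locfin_geometric[OF e])
  also have "fsum (\<lambda>d. fps_X ^ (e * Suc d) * 1) UNIV = ?Q * ?g0"
    by (subst fsum_mult[OF locfin_geometric[OF e], symmetric]) (simp add: power_add)
  finally have "?g0 * (1 - ?Q) = 1" by (simp add: algebra_simps)
  then have "?g0 * (?R * (1 - ?Q)) = ?R" by (simp add: mult.left_commute[of ?g0])
  then show g0: "?g0 = ?R" unfolding R by simp
  have "?g1 = fps_X ^ (e * 0) * of_nat 0 + fsum (\<lambda>d. fps_X ^ (e * Suc d) * of_nat (Suc d)) UNIV"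
    by (rule fsum_nat_Suc) (rule locfin_geometric[OF e])
  also have "fsum (\<lambda>d. fps_X ^ (e * Suc d) * of_nat (Suc d)) UNIV = fsum (\<lambda>d. ?Q * (fps_X ^ (e * d) * of_nat d) + ?Q * (fps_X ^ (e * d) * 1)) UNIV"
    by (rule fsum_cong) (simp add: power_add algebra_simps)
  also have "\<dots> = ?Q * ?g1 + ?Q * ?g0"
    by (simp only: fsum_add fsum_mult locfin_mult locfin_geometric[OF e])
  finally have "?g1 * (1 - ?Q) = ?Q * ?R" unfolding g0 by (simp add: algebra_simps)
  then have "?g1 * (?R * (1 - ?Q)) = ?Q * ?R * ?R" by (simp add: mult.left_commute[of ?g1] mult_ac)
  then show "?g1 = ?Q * ?R * ?R" unfolding R by simp
qed

lemma finite_pairs_le: "r > 0 \<Longrightarrow> finite {p \<in> {1..} \<times> {1..}. (case p of (i, k) \<Rightarrow> r * (i * k)) \<le> (m::nat)}"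
proof -
  assume r: "r > 0"
  have "i \<le> m \<and> k \<le> m" if "1 \<le> i" "1 \<le> k" "r * (i * k) \<le> m" for i k
  proof -
    have "i * k \<le> m" using le_mult_pos[OF r] that(3) order_trans by blast
    moreover have "i \<le> i * k" "k \<le> i * k" using that(1,2) by simp_all
    ultimately show ?thesis by linarith
  qed
  then have "{p \<in> {1..} \<times> {1..}. (case p of (i, k) \<Rightarrow> r * (i * k)) \<le> m} \<subseteq> {..m} \<times> {..m}" by auto
  then show ?thesis by (rule finite_subset) simp
qed

lemma lambert_pairs:
  assumes r: "r > 0"
  shows "lambert r = fsum (\<lambda>(i, k). fps_X ^ (r * (i * k)) * of_nat i :: 'a::char5_field fps) ({1..} \<times> {1..} :: (nat \<times> nat) set)"
    and "locfin (\<lambda>(i, k). fps_X ^ (r * (i * k)) * of_nat i :: 'a fps) ({1..} \<times> {1..} :: (nat \<times> nat) set)"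
proof -
  let ?f = "\<lambda>i k. fps_X ^ (r * (i * k)) * of_nat i :: 'a fps"
  show lf: "locfin (\<lambda>(i, k). ?f i k) ({1..} \<times> {1..} :: (nat \<times> nat) set)"
    using locfin_X_power[OF finite_pairs_le[OF r], of "\<lambda>(i, k). of_nat i"]
    by (simp add: case_prod_unfold)
  have "fsum (?f i) {1..} = fps_X ^ (r * i) * (of_nat i * inverse (1 - fps_X ^ (r * i)))" if "i \<in> {1..}" for i
  proof -
    have e: "r * i > 0" using r that by simp
    have "fsum (?f i) {1..} = fsum (\<lambda>d. ?f i (Suc d)) UNIV"
      by (rule fsum_reindex) (rule bij_betw_byWitness[of _ "\<lambda>k. k - 1"], auto)
    also have "\<dots> = fsum (\<lambda>d. fps_X ^ (r * i) * of_nat i * (fps_X ^ (r * i * d) * 1)) UNIV"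
      by (rule fsum_cong) (simp add: power_add algebra_simps)
    also have "\<dots> = fps_X ^ (r * i) * of_nat i * inverse (1 - fps_X ^ (r * i))"
      by (simp only: fsum_mult locfin_geometric[OF e] fsum_geometric[OF e])
    finally show ?thesis by (simp add: mult.assoc)
  qed
  then have "lambert r = fsum (\<lambda>i. fsum (?f i) {1..}) {1..}"
    unfolding lambert_def by (intro fsum_cong) simp
  then show "lambert r = fsum (\<lambda>(i, k). ?f i k) ({1..} \<times> {1..} :: (nat \<times> nat) set)"
    by (simp only: fsum_fsum[OF lf])
qed

text \<open>The weight is \<open>n\<close> plus the positive part of \<open>s\<close>. Its constant
  part \<open>n\<close> is summed over both signs and gives $(1 + Q)/(1 - Q)$; the positive part
  gives the derivative of a geometric series.\<close>

lemma fsum_int_geometric: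
  assumes e: "e > 0"
  shows "fsum (\<lambda>s::int. fps_X ^ (e * nat \<bar>s\<bar>) * of_nat (n + nat s)) UNIV
    = (of_nat n * (1 + fps_X ^ e) * inverse (1 - fps_X ^ e) + fps_X ^ e * inverse (1 - fps_X ^ e) * inverse (1 - fps_X ^ e) :: 'a::field fps)"
proof -
  let ?f = "\<lambda>s::int. fps_X ^ (e * nat \<bar>s\<bar>) * of_nat (n + nat s) :: 'a fps" and ?Q = "fps_X ^ e :: 'a fps"
  let ?A = "range int" and ?B = "range (\<lambda>d. - int (Suc d))"
  have "s \<in> ?A \<union> ?B" for s :: int
  proof (cases "s \<ge> 0")
    case True
    then have "s = int (nat s)" by simp
    then show ?thesis by blast
  next
    case False
    then have "s = - int (Suc (nat (- s - 1)))" by simp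
    then show ?thesis by blast
  qed
  then have U: "UNIV = ?A \<union> ?B" by blast
  have lf: "locfin ?f UNIV"
  proof (rule locfin_X_power)
    fix k show "finite {i \<in> UNIV. e * nat \<bar>i\<bar> \<le> k}"
    proof (rule finite_subset[of _ "{- int k..int k}"], safe)
      fix s assume "e * nat \<bar>s\<bar> \<le> k"
      then have "nat \<bar>s\<bar> \<le> k" using le_mult_pos[OF e] order_trans by blast
      then show "s \<in> {- int k..int k}" by auto
    qed
  qed
  have "fsum ?f (?A \<union> ?B) = fsum ?f ?A + fsum ?f ?B"
    by (rule fsum_Un) (use lf U in auto)
  also have "fsum ?f ?A = fsum (\<lambda>d. ?f (int d)) UNIV"
    by (rule fsum_reindex) (simp add: bij_betw_def)
  also have "\<dots> = fsum (\<lambda>d. of_nat n * (fps_X ^ (e * d) * 1) + fps_X ^ (e * d) * of_nat d) UNIV"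
    by (rule fsum_cong) (simp add: algebra_simps)
  also have "\<dots> = of_nat n * inverse (1 - ?Q) + ?Q * inverse (1 - ?Q) * inverse (1 - ?Q)"
    by (simp only: fsum_add fsum_mult locfin_mult locfin_geometric[OF e] fsum_geometric[OF e])
  also have "fsum ?f ?B = fsum (\<lambda>d. ?f (- int (Suc d))) UNIV"
    by (rule fsum_reindex) (simp add: bij_betw_def inj_def)
  also have "\<dots> = fsum (\<lambda>d. of_nat n * ?Q * (fps_X ^ (e * d) * 1)) UNIV"
    by (rule fsum_cong) (simp add: nat_add_distrib power_add algebra_simps)
  also have "\<dots> = of_nat n * ?Q * inverse (1 - ?Q)"
    by (simp only: fsum_mult locfin_geometric[OF e] fsum_geometric[OF e])
  finally show ?thesis unfolding U[symmetric] by (simp add: algebra_simps)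
qed

text \<open>A pair \<open>(i, k)\<close> is encoded by its minimum \<open>n\<close> and the
  difference \<open>s = i - k\<close>. Then $i k = n^2 + n |s|$, so the sum over \<open>s\<close> is
  geometric and gives half of \<open>lattice_term 0 n\<close>; the negative indices in
  \<open>lattice_sum\<close> account for another factor 2.\<close>

lemma lattice_sum_eq: "lattice_sum = 4 * (lambert 2 :: 'a::char5_field fps)"
proof -
  let ?f = "\<lambda>(i, k). fps_X ^ (2 * (i * k)) * of_nat i :: 'a fps"
  let ?h = "\<lambda>(n, s). (n + nat s, n + nat (- s))"
  let ?g = "\<lambda>n s. ?f (?h (n, s))"
  let ?K = "{1..} \<times> {1..} :: (nat \<times> nat) set"
  have bij: "bij_betw ?h ({1..} \<times> (UNIV :: int set)) ?K"
    by (rule bij_betw_byWitness[of _ "\<lambda>(i, k). (min i k, int i - int k)"]) auto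
  have lfK: "locfin ?f ?K" using lambert_pairs(2)[of 2, where 'a='a] by simp
  have lf: "locfin (\<lambda>(n, s). ?g n s) ({1..} \<times> (UNIV :: int set))"
    using locfin_reindex[OF lfK bij] by (simp add: case_prod_unfold)
  have "lambert 2 = fsum ?f ?K" using lambert_pairs(1)[of 2, where 'a='a] by simp
  also have "\<dots> = fsum (\<lambda>(n, s). ?g n s) ({1..} \<times> UNIV)"
    using fsum_reindex[OF bij, of ?f] by (simp add: case_prod_unfold)
  also have "\<dots> = fsum (\<lambda>n. fsum (?g n) UNIV) {1..}"
    by (rule fsum_fsum[OF lf, symmetric])
  finally have lambert: "lambert 2 = fsum (\<lambda>n. fsum (?g n) UNIV) {1..}" .
  have lattice_term: "2 * (2 * fsum (?g n) UNIV) = 2 * (lattice_term 0 (int n) :: 'a fps)" if "n \<in> {1..}" for n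
  proof -
    have n: "2 * n > 0" "n > 0" using that by auto
    have "fsum (?g n) UNIV = fsum (\<lambda>s::int. fps_X ^ (2 * n * n) * (fps_X ^ (2 * n * nat \<bar>s\<bar>) * of_nat (n + nat s))) UNIV"
    proof (rule fsum_cong)
      fix s :: int
      have "2 * ((n + nat s) * (n + nat (- s))) = 2 * n * n + 2 * n * nat \<bar>s\<bar>"
        by (cases "s \<ge> 0") (auto simp: algebra_simps)
      then show "?g n s = fps_X ^ (2 * n * n) * (fps_X ^ (2 * n * nat \<bar>s\<bar>) * of_nat (n + nat s))"
        by (simp add: power_add mult.assoc)
    qed
    also have "\<dots> = fps_X ^ (2 * n * n) * fsum (\<lambda>s::int. fps_X ^ (2 * n * nat \<bar>s\<bar>) * of_nat (n + nat s)) UNIV"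
    proof (rule fsum_mult, rule locfin_X_power)
      fix k show "finite {i \<in> UNIV. 2 * n * nat \<bar>i\<bar> \<le> k}"
      proof (rule finite_subset[of _ "{- int k..int k}"], safe)
        fix s assume "2 * n * nat \<bar>s\<bar> \<le> k"
        then have "nat \<bar>s\<bar> \<le> k" using le_mult_pos[OF n(1)] order_trans by blast
        then show "s \<in> {- int k..int k}" by auto
      qed
    qed
    finally have 1: "fsum (?g n) UNIV = fps_X ^ (2 * n * n) * (of_nat n * (1 + fps_X ^ (2 * n)) * inverse (1 - fps_X ^ (2 * n))
        + fps_X ^ (2 * n) * inverse (1 - fps_X ^ (2 * n)) * inverse (1 - fps_X ^ (2 * n)))"
      unfolding fsum_int_geometric[OF n(1)] .
    have 2: "qabs (int n) = (fps_X ^ (2 * n) :: 'a fps)" by (simp add: qabs_def nat_mult_distrib)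
    have 3: "fps_X ^ nat ((0 - int n)\<^sup>2 + (int n)\<^sup>2) = (fps_X ^ (2 * n * n) :: 'a fps)"
    proof -
      have "nat ((0 - int n)\<^sup>2 + (int n)\<^sup>2) = nat (int (2 * n * n))" by (simp add: power2_eq_square)
      then show ?thesis by (simp only: nat_int)
    qed
    show ?thesis unfolding 1 lattice_term_def 3 vker_def bker_def geom_def 2 using n by (simp add: algebra_simps)
  qed
  have half: "fsum (lattice_term 0) (UNIV - {0}) = 2 * fsum (\<lambda>n. lattice_term 0 (int n) :: 'a fps) {1..}"
    unfolding fsum_atLeast_1 by (rule fsum_even[OF locfin_lattice_term]) (simp add: lattice_term_def)
  have lt: "locfin (\<lambda>n. lattice_term 0 (int n) :: 'a fps) {1..}"
    by (rule locfin_reindex[OF locfin_lattice_term[of 0 "int ` {1..}"]]) (simp add: bij_betw_def)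
  have "4 * lambert 2 = 4 * fsum (\<lambda>n. fsum (?g n) UNIV) {1..}" unfolding lambert ..
  also have "\<dots> = fsum (\<lambda>n. 4 * fsum (?g n) UNIV) {1..}"
    by (rule fsum_mult[symmetric]) (rule locfin_fsum[OF lf])
  also have "\<dots> = fsum (\<lambda>n. 2 * (lattice_term 0 (int n))) {1..}"
    by (rule fsum_cong) (use lattice_term in simp)
  also have "\<dots> = 2 * fsum (\<lambda>n. lattice_term 0 (int n)) {1..}"
    by (rule fsum_mult) (rule lt)
  finally show ?thesis unfolding lattice_sum_def half by simp
qed

text \<open>The remaining residue 3 of a triangular number occurs only for $k$ congruent to 2,
  exactly where the coefficient \<open>2 * k + 1\<close> vanishes.\<close>

lemma tri_mod5:
  assumes "of_nat (2 * k + 1) \<noteq> (0 :: 'a::char5_field)"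
  shows "tri (int k) mod 5 \<in> {0, 1}"
proof -
  have nz: "(2 * k + 1) mod 5 \<noteq> 0"
    using assms of_nat_mod5_0[of "2 * k + 1", where 'a='a] by blast
  have "int (2 * tri (int k)) = int (k * (k + 1))"
    using tri_int[of "int k"] by (simp add: algebra_simps)
  then have t: "2 * tri (int k) = k * (k + 1)" by (simp only: of_nat_eq_iff)
  define a r where "a = k div 5" and "r = k mod 5"
  have k: "k = 5 * a + r" by (simp add: a_def r_def)
  have "r < 5" by (simp add: r_def)
  then have "r \<in> {0, 1, 2, 3, 4}" by auto
  then consider "r = 0" | "r = 1" | "r = 2" | "r = 3" | "r = 4" by auto
  then show ?thesis
  proof cases
    case 1
    then have "2 * tri (int k) = 5 * (a * (5 * a + 1))" using t k by (simp add: algebra_simps)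
    then have "tri (int k) mod 5 = 0" by presburger
    then show ?thesis by simp
  next
    case 2
    then have "2 * tri (int k) = 5 * (a * (5 * a + 3)) + 2" using t k by (simp add: algebra_simps)
    then have "tri (int k) mod 5 = 1" by presburger
    then show ?thesis by simp
  next
    case 3
    then have "2 * k + 1 = 5 * (2 * a + 1)" using k by simp
    then show ?thesis using nz by simp
  next
    case 4
    then have "2 * tri (int k) = 5 * (a * (5 * a + 7) + 2) + 2" using t k by (simp add: algebra_simps)
    then have "tri (int k) mod 5 = 1" by presburger
    then show ?thesis by simp
  next
    case 5
    then have "2 * tri (int k) = 5 * (a * (5 * a + 9) + 4)" using t k by (simp add: algebra_simps)
    then have "tri (int k) mod 5 = 0" by presburger
    then show ?thesis by simp
  qed
qed

lemma alt_sign_fps: "alt_sign n = (fps_const (alt_sign n) :: 'a::comm_ring_1 fps)"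
  by (simp add: alt_sign_def flip: fps_const_neg)

lemma jacobi_nth:
  assumes "jacobi r $ n \<noteq> (0 :: 'a::char5_field)"
  shows "\<exists>t. n = r * t \<and> t mod 5 \<in> {0, 1}"
proof (rule ccontr)
  assume c: "\<not> ?thesis"
  have "(fps_X ^ (r * tri (int k)) * (alt_sign (int k) * of_nat (2 * k + 1))) $ n = (0 :: 'a)" for k
  proof (cases "n = r * tri (int k)")
    case True
    then have "of_nat (2 * k + 1) = (0 :: 'a)" using c tri_mod5 by blast
    then have "of_nat (2 * k + 1) = (0 :: 'a fps)" by (simp only: fps_of_nat[symmetric] fps_const_0_eq_0)
    then show ?thesis by simp
  next
    case False
    have "alt_sign (int k) * of_nat (2 * k + 1) = (fps_const (alt_sign (int k) * of_nat (2 * k + 1)) :: 'a fps)"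
      unfolding alt_sign_fps fps_of_nat[symmetric] by simp
    then show ?thesis using False by (simp only: fps_X_power_mult_nth fps_nth_fps_const) auto
  qed
  then have "jacobi r $ n = (0 :: 'a)" unfolding jacobi_def by (subst fsum_nth[of "{}"]) auto
  then show False using assms by simp
qed

text \<open>Multiplication by the fifth power of \<open>?W * ?u\<close> turns
  \<open>P * (lattice_sum - 1)\<close> into products of Jacobi series. Since
  \<open>lattice_sum\<close> is the logarithmic derivative of \<open>jacobi 2\<close>, it acts on
  \<open>C + D\<close> as \<open>euler\<close>, giving \<open>2 * D\<close>. The result is $(A +
  B)(D^2 - C^2)$, whose four terms have exponents in the classes 4, 0, 0, 1.\<close>

lemma lattice_sum_coeff:
  fixes P :: "'a::char5_field fps"
  assumes P: "P * (qinf 1 * qinf 1) = qinf 2" and n: "n mod 5 = 2"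
  shows "(P * lattice_sum) $ n = P $ n"
proof -
  let ?W = "qinf 1 :: 'a fps" and ?u = "qinf 2 :: 'a fps"
  define A B C D where "A = part5 0 (jacobi 1 :: 'a fps)" "B = part5 1 (jacobi 1 :: 'a fps)" "C = part5 0 (jacobi 2 :: 'a fps)" "D = part5 2 (jacobi 2 :: 'a fps)"
  note d = this
  have s: "supp5 0 A" "supp5 1 B" "supp5 0 C" "supp5 2 D" unfolding d by (simp_all add: supp5_part5)
  have J1: "jacobi 1 = A + B"
  proof (rule fps_ext)
    fix n :: nat
    show "jacobi 1 $ n = (A + B) $ n" using jacobi_nth[of 1 n, where 'a='a] by (cases "jacobi 1 $ n = (0::'a)") (auto simp: d part5_def)
  qed
  have J2: "jacobi 2 = C + D"
  proof (rule fps_ext)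
    fix n :: nat
    have "n mod 5 \<in> {0, 2}" if nz: "jacobi 2 $ n \<noteq> (0 :: 'a)"
    proof -
      obtain t where t: "n = 2 * t" "t mod 5 \<in> {0, 1}" using jacobi_nth[OF nz] by (elim exE conjE)
      have "n mod 5 = (2 * (t mod 5)) mod 5" unfolding t(1) by (rule mod_mult_right_eq[symmetric])
      moreover have "t mod 5 = 0 \<or> t mod 5 = 1" using t(2) by simp
      ultimately show ?thesis by (elim disjE) simp_all
    qed
    then show "jacobi 2 $ n = (C + D) $ n" by (cases "jacobi 2 $ n = (0::'a)") (auto simp: d part5_def)
  qed
  have eC: "euler C = 0" by (rule fps_ext) (auto simp: d part5_def of_nat_mod5_0)
  have eD: "euler D = 2 * D"
  proof (rule fps_ext)
    fix n show "euler D $ n = (2 * D) $ n"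
      using of_nat_mod5[of n, where 'a='a] by (cases "n mod 5 = 2") (auto simp: d part5_def numeral_fps_const)
  qed
  have "euler (jacobi 2 :: 'a fps) = 3 * ?u ^ 2 * euler ?u"
    unfolding jacobi_cube[of 2, where 'a='a, simplified] euler_power by simp
  \<comment> \<open>The factor 3 of the cube and -2 of \<open>euler_qinf\<close> give $-6 = 4 - 10$,
    and \<open>lattice_sum\<close> is \<open>4 * lambert 2\<close>.\<close>
  also have "\<dots> = lattice_sum * jacobi 2 - 5 * (2 * lambert 2 * jacobi 2)"
    unfolding euler_qinf[of 2, where 'a='a, simplified] lattice_sum_eq jacobi_cube[of 2, where 'a='a, simplified]
    by (simp add: algebra_simps power2_eq_square power3_eq_cube)
  finally have ev: "lattice_sum * jacobi 2 = (2 * D :: 'a fps)" by (simp add: five_fps J2 eC eD)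
  have "(w * v) ^ 5 * (P * (lattice_sum - 1)) = w ^ 3 * v ^ 5 * (P * (w * w)) * (lattice_sum - 1)" for w v :: "'a fps"
    by (simp add: power_mult_distrib eval_nat_numeral algebra_simps)
  then have "(?W * ?u) ^ 5 * (P * (lattice_sum - 1)) = ?W ^ 3 * ?u ^ 5 * ?u * (lattice_sum - 1)"
    by (simp only: P)
  also have "w ^ 3 * v ^ 5 * v * (lattice_sum - 1) = w ^ 3 * v ^ 3 * (lattice_sum * v ^ 3 - v ^ 3)" for w v :: "'a fps"
    by (simp add: eval_nat_numeral algebra_simps)
  also have "?W ^ 3 * ?u ^ 3 * (lattice_sum * ?u ^ 3 - ?u ^ 3) = jacobi 1 * jacobi 2 * (lattice_sum * jacobi 2 - jacobi 2)"
    using jacobi_cube[of 1, where 'a='a] jacobi_cube[of 2, where 'a='a] by simp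
  also have "\<dots> = A * D * D + B * D * D - A * C * C - B * C * C"
    unfolding ev unfolding J1 J2 by (simp add: algebra_simps)
  finally have e: "(?W * ?u) ^ 5 * (P * (lattice_sum - 1)) = \<dots>" .
  have "vanish5 2 (P * (lattice_sum - 1))"
  proof (rule vanish5_cancel[of "(?W * ?u) ^ 5"])
    show "vanish5 2 ((?W * ?u) ^ 5 * (P * (lattice_sum - 1)))"
      unfolding e
      using vanish5_supp5[OF supp5_mult[OF supp5_mult[OF s(1) s(4)] s(4)], of 2]
        vanish5_supp5[OF supp5_mult[OF supp5_mult[OF s(2) s(4)] s(4)], of 2]
        vanish5_supp5[OF supp5_mult[OF supp5_mult[OF s(1) s(3)] s(3)], of 2]
        vanish5_supp5[OF supp5_mult[OF supp5_mult[OF s(2) s(3)] s(3)], of 2]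
      by (intro vanish5_add vanish5_diff) simp_all
  qed (simp_all add: supp5_pow5 qinf_nth_0)
  then have "(P * lattice_sum - P) $ n = 0" using n by (simp add: vanish5_def right_diff_distrib)
  then show ?thesis by simp
qed

section \<open>Overpartitions with bounded parts\<close>

definition key :: "part \<Rightarrow> nat" where "key r = 2 * fst r + of_bool (snd r)"

text \<open>The keys order the parts. The part after an overlined $k$ has key at most $2k$, as has the part after
  a plain $k$.\<close>

lemma Cons_overpartitions:
  "p # \<pi> \<in> overpartitions N \<longleftrightarrow> 0 < fst p \<and> fst p \<le> N \<and> \<pi> \<in> overpartitions (N - fst p)
     \<and> (\<forall>r\<in>set \<pi>. key r \<le> 2 * fst p)"
proof -
  define C where "C \<rho> \<longleftrightarrow> (\<forall>i<length \<rho>. snd (\<rho> ! i) \<longrightarrow> (\<forall>j<i. fst (\<rho> ! j) \<noteq> fst (\<rho> ! i)))" for \<rho> :: "part list"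
  have mem: "\<rho> \<in> overpartitions M \<longleftrightarrow> sorted_wrt (\<ge>) (map fst \<rho>) \<and> (\<forall>x\<in>set \<rho>. 0 < fst x)
      \<and> sum_list (map fst \<rho>) = M \<and> C \<rho>" for \<rho> M
    unfolding overpartitions_def is_partition_def C_def by auto
  have "C (p # \<pi>) \<longleftrightarrow> C \<pi> \<and> (\<forall>r\<in>set \<pi>. snd r \<longrightarrow> fst p \<noteq> fst r)"
  proof -
    have "C (p # \<pi>) \<longleftrightarrow> (\<forall>i<length \<pi>. snd (\<pi> ! i) \<longrightarrow> (\<forall>j<Suc i. fst ((p # \<pi>) ! j) \<noteq> fst (\<pi> ! i)))"
      unfolding C_def by (simp add: All_less_Suc2)
    also have "\<dots> \<longleftrightarrow> (\<forall>i<length \<pi>. snd (\<pi> ! i) \<longrightarrow> fst p \<noteq> fst (\<pi> ! i) \<and> (\<forall>j<i. fst (\<pi> ! j) \<noteq> fst (\<pi> ! i)))"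
      by (simp add: All_less_Suc2)
    also have "\<dots> \<longleftrightarrow> C \<pi> \<and> (\<forall>r\<in>set \<pi>. snd r \<longrightarrow> fst p \<noteq> fst r)"
      unfolding C_def all_set_conv_all_nth by blast
    finally show ?thesis .
  qed
  moreover have "key r \<le> 2 * fst p \<longleftrightarrow> fst r \<le> fst p \<and> (snd r \<longrightarrow> fst p \<noteq> fst r)" for r
    by (auto simp: key_def)
  ultimately show ?thesis unfolding mem by auto
qed

lemma Nil_overpartitions: "[] \<in> overpartitions N \<longleftrightarrow> N = 0"
  by (auto simp: overpartitions_def is_partition_def)

definition key_bounded :: "nat \<Rightarrow> nat \<Rightarrow> part list set" where
  "key_bounded t N = {\<pi> \<in> overpartitions N. \<forall>r\<in>set \<pi>. key r \<le> t}"

lemma finite_key_bounded [simp]: "finite (key_bounded t N)"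
  by (simp add: key_bounded_def finite_overpartitions)

text \<open>The first part has the largest key, so either the key \<open>Suc t\<close> is absent or
  the list starts with \<open>(k, v)\<close>. For a plain \<open>k\<close> the bound of the tail is
  again \<open>Suc t\<close>, which permits repetitions.\<close>

lemma key_bounded_Suc:
  assumes t: "Suc t = 2 * k + of_bool v" and k: "0 < k"
  shows "key_bounded (Suc t) N = key_bounded t N \<union> (if k \<le> N then Cons (k, v) ` key_bounded (2 * k) (N - k) else {})"
proof (intro equalityI subsetI)
  fix \<pi> assume p: "\<pi> \<in> key_bounded (Suc t) N"
  show "\<pi> \<in> key_bounded t N \<union> (if k \<le> N then Cons (k, v) ` key_bounded (2 * k) (N - k) else {})"
  proof (cases \<pi>)
    case Nil
    then show ?thesis using p by (simp add: key_bounded_def)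
  next
    case (Cons a \<rho>)
    obtain k' v' where a: "a = (k', v')" by (cases a)
    have c: "0 < k'" "k' \<le> N" "\<rho> \<in> overpartitions (N - k')" "\<forall>r\<in>set \<rho>. key r \<le> 2 * k'"
      using p unfolding key_bounded_def Cons a by (simp_all add: Cons_overpartitions)
    show ?thesis
    proof (cases "key a = Suc t")
      case True
      then have "k' = k \<and> v' = v" unfolding t key_def a fst_conv snd_conv by (cases v; cases v') (simp_all, presburger+)
      then show ?thesis using c Cons a by (auto simp: key_bounded_def)
    next
      case False
      then have "key a \<le> t" using p Cons by (simp add: key_bounded_def)
      moreover have "key r \<le> key a" if "r \<in> set \<rho>" for r
        using c(4) that by (force simp: key_def a)
      ultimately have "\<pi> \<in> key_bounded t N" using p Cons by (fastforce simp: key_bounded_def)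
      then show ?thesis ..
    qed
  qed
next
  fix \<pi> assume "\<pi> \<in> key_bounded t N \<union> (if k \<le> N then Cons (k, v) ` key_bounded (2 * k) (N - k) else {})"
  then consider "\<pi> \<in> key_bounded t N" | \<rho> where "k \<le> N" "\<pi> = (k, v) # \<rho>" "\<rho> \<in> key_bounded (2 * k) (N - k)"
    by (auto split: if_splits)
  then show "\<pi> \<in> key_bounded (Suc t) N"
  proof cases
    case 1
    then show ?thesis by (fastforce simp: key_bounded_def)
  next
    case 2
    then show ?thesis using k t by (auto simp: key_bounded_def Cons_overpartitions key_def)
  qed
qed

lemma key_bounded_1: "key_bounded (Suc 0) N = (if N = 0 then {[]} else {})"
proof -
  have "\<pi> \<in> key_bounded (Suc 0) N \<longleftrightarrow> \<pi> = [] \<and> N = 0" for \<pi>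
    by (cases \<pi>) (auto simp: key_bounded_def Nil_overpartitions Cons_overpartitions key_def)
  then show ?thesis by auto
qed

lemma key_bounded_large: "2 * N < t \<Longrightarrow> key_bounded t N = overpartitions N"
proof -
  assume t: "2 * N < t"
  have "key r \<le> t" if "\<pi> \<in> overpartitions N" "r \<in> set \<pi>" for \<pi> r
  proof -
    have "fst r \<le> N" using that member_le_sum_list[of "fst r" "map fst \<pi>"]
      by (simp add: overpartitions_def is_partition_def)
    then show ?thesis using t by (simp add: key_def)
  qed
  then show ?thesis by (auto simp: key_bounded_def)
qed

section \<open>Generating functions for additive statistics\<close>

definition stat :: "(part \<Rightarrow> nat) \<Rightarrow> part list \<Rightarrow> nat" where
  "stat s \<pi> = sum_list (map s \<pi>)"

text \<open>Bivariate series: the outer variable marks the statistic, the inner variable is $q$.\<close>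

definition key_gf :: "(part \<Rightarrow> nat) \<Rightarrow> nat \<Rightarrow> 'a::comm_ring_1 fps fps" where
  "key_gf s t = Abs_fps (\<lambda>i. Abs_fps (\<lambda>N. of_nat (card {\<pi> \<in> key_bounded t N. stat s \<pi> = i})))"

definition qq :: "'a::comm_ring_1 fps fps" where "qq = fps_const fps_X"

lemma key_gf_nth: "key_gf s t $ i $ N = of_nat (card {\<pi> \<in> key_bounded t N. stat s \<pi> = i})"
  by (simp add: key_gf_def)

lemma biv_nth: "(fps_X ^ a * qq ^ k * f) $ i $ N = (if a \<le> i \<and> k \<le> N then f $ (i - a) $ (N - k) else 0)"
proof -
  have "(fps_X ^ a * qq ^ k * f) = fps_X ^ a * (fps_const (fps_X ^ k) * f)"
    by (simp only: qq_def fps_const_power mult.assoc)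
  then show ?thesis by (auto simp only: fps_X_power_mult_nth fps_mult_left_const_nth fps_zero_nth not_le split: if_splits)
qed

lemma key_gf_Suc:
  assumes t: "Suc t = 2 * k + of_bool v" and k: "0 < k"
  shows "key_gf s (Suc t) = key_gf s t + fps_X ^ s (k, v) * qq ^ k * (key_gf s (2 * k) :: 'a::comm_ring_1 fps fps)"
proof (intro fps_ext)
  fix i N
  let ?S = "\<lambda>t N i. {\<pi> \<in> key_bounded t N. stat s \<pi> = i}"
  have fin: "finite (?S t N i)" for t N i by simp
  have a: "Cons (k, v) ` ?S (2 * k) (N - k) (i - s (k, v)) \<inter> ?S t N i = {}"
  proof -
    have "\<not> key (k, v) \<le> t" using t by (simp add: key_def)
    then show ?thesis by (auto simp: key_bounded_def)
  qed
  have "?S (Suc t) N i = ?S t N i \<union> (if s (k, v) \<le> i \<and> k \<le> N then Cons (k, v) ` ?S (2 * k) (N - k) (i - s (k, v)) else {})"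
    unfolding key_bounded_Suc[OF t k] by (auto simp: stat_def image_iff)
  then have "card (?S (Suc t) N i) = card (?S t N i) + (if s (k, v) \<le> i \<and> k \<le> N then card (?S (2 * k) (N - k) (i - s (k, v))) else 0)"
    using a by (simp add: card_Un_disjoint fin card_image Int_commute)
  then show "key_gf s (Suc t) $ i $ N = (key_gf s t + fps_X ^ s (k, v) * qq ^ k * (key_gf s (2 * k) :: 'a fps fps)) $ i $ N"
    unfolding fps_add_nth biv_nth key_gf_nth by simp
qed

lemma key_gf_1: "key_gf s (Suc 0) = 1"
proof (intro fps_ext)
  fix i N
  have "{\<pi> \<in> key_bounded (Suc 0) N. stat s \<pi> = i} = (if i = 0 \<and> N = 0 then {[]} else {})"
    by (auto simp: key_bounded_1 stat_def split: if_splits)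
  then show "key_gf s (Suc 0) $ i $ N = (1 :: 'a::comm_ring_1 fps fps) $ i $ N"
    by (auto simp: key_gf_nth)
qed

text \<open>An overlined part occurs at most once and contributes a factor $1 + x$; a plain part may
  repeat and contributes $1/(1 - x)$, as in \<open>key_gf_plain\<close>.\<close>

lemma key_gf_over: "0 < k \<Longrightarrow> key_gf s (2 * k + 1) = key_gf s (2 * k) * (1 + fps_X ^ s (k, True) * qq ^ k)"
  using key_gf_Suc[of "2 * k" k True s] by (simp add: algebra_simps)

lemma key_gf_plain: "key_gf s (2 * k + 2) * (1 - fps_X ^ s (k + 1, False) * qq ^ (k + 1)) = key_gf s (2 * k + 1)"
  using key_gf_Suc[of "2 * k + 1" "k + 1" False s] by (simp add: algebra_simps)

text \<open>The bound \<open>4 * m + 2\<close> is the key of the plain part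
  \<open>2 * m + 1\<close>, the largest part that keeps $L$ at most \<open>m\<close>.\<close>

definition level_gf :: "(part \<Rightarrow> nat) \<Rightarrow> nat \<Rightarrow> 'a::comm_ring_1 fps fps" where
  "level_gf s m = key_gf s (4 * m + 2)"

lemma level_gf_0: "level_gf s 0 * (1 - fps_X ^ s (1, False) * qq) = 1"
  using key_gf_plain[of s 0] by (simp add: level_gf_def key_gf_1)

text \<open>Four keys are new: overlined \<open>2 * m + 1\<close>, both kinds of
  \<open>2 * m + 2\<close>, and plain \<open>2 * m + 3\<close>.\<close>

lemma level_gf_Suc:
  "level_gf s (Suc m) * ((1 - fps_X ^ s (2 * m + 2, False) * qq ^ (2 * m + 2)) * (1 - fps_X ^ s (2 * m + 3, False) * qq ^ (2 * m + 3)))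
   = level_gf s m * ((1 + fps_X ^ s (2 * m + 1, True) * qq ^ (2 * m + 1)) * (1 + fps_X ^ s (2 * m + 2, True) * qq ^ (2 * m + 2)))"
proof -
  have e: "2 * (2 * m + 1) + 1 = 4 * m + 3" "2 * (2 * m + 1) = 4 * m + 2" "2 * (2 * m + 1) + 2 = 4 * m + 4"
    "2 * m + 1 + 1 = 2 * m + 2" "2 * m + 2 + 1 = 2 * m + 3" "2 * (2 * m + 2) + 1 = 4 * m + 5"
    "2 * (2 * m + 2) = 4 * m + 4" "2 * (2 * m + 2) + 2 = 4 * Suc m + 2"
    "4 * m + 2 + 1 = 4 * m + 3" "4 * m + 4 + 1 = 4 * m + 5" "4 * m + 2 + 2 = 4 * m + 4" "4 * m + 4 + 2 = 4 * Suc m + 2"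
    by simp_all
  have pos: "0 < 2 * m + 1" "0 < 2 * m + 2" by simp_all
  have 1: "key_gf s (4 * m + 3) = level_gf s m * (1 + fps_X ^ s (2 * m + 1, True) * qq ^ (2 * m + 1))"
    using key_gf_over[of "2 * m + 1" s, OF pos(1)] unfolding e level_gf_def .
  have 2: "key_gf s (4 * m + 4) * (1 - fps_X ^ s (2 * m + 2, False) * qq ^ (2 * m + 2)) = key_gf s (4 * m + 3)"
    using key_gf_plain[of s "2 * m + 1"] unfolding e .
  have 3: "key_gf s (4 * m + 5) = key_gf s (4 * m + 4) * (1 + fps_X ^ s (2 * m + 2, True) * qq ^ (2 * m + 2))"
    using key_gf_over[of "2 * m + 2" s, OF pos(2)] unfolding e .
  have 4: "level_gf s (Suc m) * (1 - fps_X ^ s (2 * m + 3, False) * qq ^ (2 * m + 3)) = key_gf s (4 * m + 5)"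
    using key_gf_plain[of s "2 * m + 2"] unfolding e level_gf_def .
  have "level_gf s (Suc m) * ((1 - fps_X ^ s (2 * m + 2, False) * qq ^ (2 * m + 2)) * (1 - fps_X ^ s (2 * m + 3, False) * qq ^ (2 * m + 3)))
     = level_gf s (Suc m) * (1 - fps_X ^ s (2 * m + 3, False) * qq ^ (2 * m + 3)) * (1 - fps_X ^ s (2 * m + 2, False) * qq ^ (2 * m + 2))"
    by (simp only: mult_ac)
  also have "\<dots> = key_gf s (4 * m + 4) * (1 - fps_X ^ s (2 * m + 2, False) * qq ^ (2 * m + 2)) * (1 + fps_X ^ s (2 * m + 2, True) * qq ^ (2 * m + 2))"
    unfolding 4 3 by (simp only: mult_ac)
  finally have "level_gf s (Suc m) * ((1 - fps_X ^ s (2 * m + 2, False) * qq ^ (2 * m + 2)) * (1 - fps_X ^ s (2 * m + 3, False) * qq ^ (2 * m + 3))) = \<dots>" .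
  then show ?thesis unfolding 2 1 by (simp only: mult.assoc)
qed

text \<open>The substitution $y \to q^2 y$ in the outer variable $y$.\<close>

definition dil :: "'a::comm_ring_1 fps fps \<Rightarrow> 'a fps fps" where
  "dil f = Abs_fps (\<lambda>i. fps_X ^ (2 * i) * f $ i)"

lemma dil_nth: "dil f $ i = fps_X ^ (2 * i) * f $ i"
  by (simp add: dil_def)

lemma dil_add: "dil (f + g) = dil f + dil g"
  and dil_diff: "dil (f - g) = dil f - dil g"
  and dil_1: "dil 1 = 1"
  and dil_0: "dil 0 = 0"
  and dil_qq: "dil (qq ^ k) = qq ^ k"
  by (rule fps_ext; simp add: dil_nth algebra_simps qq_def fps_const_power)+

lemma dil_mult: "dil (f * g) = dil f * dil g"
proof (rule fps_ext)
  fix n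
  have "dil (f * g) $ n = (\<Sum>i=0..n. fps_X ^ (2 * n) * (f $ i * g $ (n - i)))"
    by (simp add: dil_nth fps_mult_nth sum_distrib_left)
  also have "\<dots> = (\<Sum>i=0..n. (fps_X ^ (2 * i) * f $ i) * (fps_X ^ (2 * (n - i)) * g $ (n - i)))"
  proof (rule sum.cong)
    fix i assume "i \<in> {0..n}"
    then have "2 * n = 2 * i + 2 * (n - i)" by simp
    then have "fps_X ^ (2 * n) = fps_X ^ (2 * i) * (fps_X ^ (2 * (n - i)) :: 'a fps)" by (metis power_add)
    then show "fps_X ^ (2 * n) * (f $ i * g $ (n - i)) = (fps_X ^ (2 * i) * f $ i) * (fps_X ^ (2 * (n - i)) * g $ (n - i))"
      by (simp only: mult_ac)
  qed simp
  finally show "dil (f * g) $ n = (dil f * dil g) $ n" by (simp add: fps_mult_nth dil_nth)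
qed

lemma dil_X: "dil fps_X = qq ^ 2 * fps_X"
proof (rule fps_ext)
  fix n show "dil fps_X $ n = (qq ^ 2 * fps_X :: 'a fps fps) $ n"
    by (simp add: dil_nth qq_def fps_const_power fps_X_def)
qed

lemma dil_X_power: "dil (fps_X ^ m) = qq ^ (2 * m) * fps_X ^ m"
  by (induction m) (simp_all add: dil_1 dil_mult dil_X algebra_simps power2_eq_square)

lemmas dil_simps = dil_add dil_diff dil_mult dil_1 dil_0 dil_X dil_qq dil_qq[of 1, simplified]

lemma dil_fsum:
  assumes "locfin f I"
  shows "dil (fsum f I) = fsum (\<lambda>i. dil (f i)) I"
proof (rule fps_ext)
  fix n
  obtain A where A: "finite A" "A \<subseteq> I" "\<And>i k. i \<in> I - A \<Longrightarrow> k \<le> n \<Longrightarrow> f i $ k = 0"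
    "\<And>k. k \<le> n \<Longrightarrow> fsum f I $ k = (\<Sum>i\<in>A. f i $ k)"
    using locfin_obtain[OF assms, of n] by blast
  have "fsum (\<lambda>i. dil (f i)) I $ n = (\<Sum>i\<in>A. dil (f i) $ n)"
    using A by (intro fsum_nth) (auto simp: dil_nth)
  then show "dil (fsum f I) $ n = fsum (\<lambda>i. dil (f i)) I $ n"
    using A(4)[of n] by (simp add: dil_nth sum_distrib_left)
qed

section \<open>$q$-difference equations at a finite level\<close>

definition s_odd :: "part \<Rightarrow> nat" where "s_odd r = of_bool (odd_nonoverlined r)"
definition s_rest :: "part \<Rightarrow> nat" where "s_rest r = of_bool (\<not> odd_nonoverlined r)"

lemma qq_nz: "1 - fps_X ^ a * qq ^ Suc b \<noteq> (0 :: 'a::field fps fps)"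
proof
  assume "1 - fps_X ^ a * qq ^ Suc b = (0 :: 'a fps fps)"
  then have "(1 - fps_X ^ a * qq ^ Suc b) $ 0 $ 0 = (0 :: 'a)" by simp
  moreover have "(fps_X ^ a * qq ^ Suc b * 1) $ 0 $ 0 = (0 :: 'a)" unfolding biv_nth by simp
  ultimately show False by simp
qed

lemma qq_exps: "qq ^ (2 * m + 1) = qq * (qq ^ 2) ^ m" "qq ^ (2 * m + 2) = qq ^ 2 * (qq ^ 2) ^ m"
   "qq ^ (2 * m + 3) = qq ^ 3 * (qq ^ 2) ^ m"
  by (simp_all only: power_add power_mult power_one_right) (simp_all only: mult.commute)

lemma dil_M: "dil ((qq ^ 2) ^ m) = (qq ^ 2) ^ m"
  unfolding power_mult[symmetric] by (rule dil_qq)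

lemma odd_0: "level_gf s_odd 0 * (1 - fps_X * qq) = 1"
  using level_gf_0[of s_odd] by (simp add: s_odd_def odd_nonoverlined_def)

lemma odd_Suc: "level_gf s_odd (Suc m) * ((1 - qq ^ 2 * (qq ^ 2) ^ m) * (1 - fps_X * (qq ^ 3 * (qq ^ 2) ^ m)))
   = level_gf s_odd m * ((1 + qq * (qq ^ 2) ^ m) * (1 + qq ^ 2 * (qq ^ 2) ^ m))"
  using level_gf_Suc[of s_odd m] unfolding s_odd_def odd_nonoverlined_def qq_exps by simp

lemma rest_0: "level_gf s_rest 0 * (1 - qq) = 1"
  using level_gf_0[of s_rest] by (simp add: s_rest_def odd_nonoverlined_def)

lemma rest_Suc: "level_gf s_rest (Suc m) * ((1 - fps_X * (qq ^ 2 * (qq ^ 2) ^ m)) * (1 - qq ^ 3 * (qq ^ 2) ^ m))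
   = level_gf s_rest m * ((1 + fps_X * (qq * (qq ^ 2) ^ m)) * (1 + fps_X * (qq ^ 2 * (qq ^ 2) ^ m)))"
  using level_gf_Suc[of s_rest m] unfolding s_rest_def odd_nonoverlined_def qq_exps by simp

abbreviation s_all :: "part \<Rightarrow> nat" where "s_all \<equiv> \<lambda>_. 1"

lemma all_0: "level_gf s_all 0 * (1 - fps_X * qq) = 1"
  using level_gf_0[of s_all] by simp

lemma all_Suc: "level_gf s_all (Suc m) * ((1 - fps_X * (qq ^ 2 * (qq ^ 2) ^ m)) * (1 - fps_X * (qq ^ 3 * (qq ^ 2) ^ m)))
   = level_gf s_all m * ((1 + fps_X * (qq * (qq ^ 2) ^ m)) * (1 + fps_X * (qq ^ 2 * (qq ^ 2) ^ m)))"
  using level_gf_Suc[of s_all m] unfolding qq_exps by simp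

lemma nz_M:
  assumes "0 < a"
  shows "1 - qq ^ a * (qq ^ 2) ^ m \<noteq> (0 :: 'a::field fps fps)"
    "1 - fps_X * (qq ^ a * (qq ^ 2) ^ m) \<noteq> (0 :: 'a::field fps fps)"
proof -
  obtain b where b: "a = Suc b" using assms by (cases a) auto
  have e: "qq ^ a * (qq ^ 2) ^ m = (qq ^ Suc (b + 2 * m) :: 'a fps fps)"
    unfolding power_mult[symmetric] power_add[symmetric] b by simp
  show "1 - qq ^ a * (qq ^ 2) ^ m \<noteq> (0 :: 'a::field fps fps)"
    "1 - fps_X * (qq ^ a * (qq ^ 2) ^ m) \<noteq> (0 :: 'a::field fps fps)"
    unfolding e using qq_nz[of 0 "b + 2 * m", where 'a='a] qq_nz[of 1 "b + 2 * m", where 'a='a] by simp_all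
qed

text \<open>Here the outer variable $y$ occurs only in the factors $1/(1 - y q^i)$ with
  \<open>i\<close> odd, $i \<le> 2m + 1$, and dilation moves this product up by one factor.\<close>

lemma dil_odd: "dil (level_gf s_odd m) * (1 - fps_X * (qq ^ 3 * (qq ^ 2) ^ m)) = (1 - fps_X * qq) * (level_gf s_odd m :: 'a::field fps fps)"
proof (induction m)
  case 0
  have "dil (level_gf s_odd 0) * (1 - fps_X * qq ^ 3) = (1 :: 'a fps fps)"
    using arg_cong[OF odd_0[where 'a='a], of dil] by (simp add: dil_simps power2_eq_square power3_eq_cube algebra_simps)
  then show ?case using odd_0[where 'a='a] by (simp add: mult.commute)
next
  case (Suc m)
  define M :: "'a fps fps" where "M = (qq ^ 2) ^ m"
  define q y :: "'a fps fps" where "q = qq" and "y = fps_X"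
  define F F' where "F = (level_gf s_odd m :: 'a fps fps)" and "F' = (level_gf s_odd (Suc m) :: 'a fps fps)"
  have S: "F' * ((1 - q ^ 2 * M) * (1 - y * (q ^ 3 * M))) = F * ((1 + q * M) * (1 + q ^ 2 * M))"
    using odd_Suc[of m, where 'a='a] by (simp add: M_def q_def y_def F_def F'_def)
  have D: "dil F' * ((1 - q ^ 2 * M) * (1 - q ^ 2 * y * (q ^ 3 * M))) = dil F * ((1 + q * M) * (1 + q ^ 2 * M))"
    using arg_cong[OF odd_Suc[of m, where 'a='a], of dil]
    by (simp add: M_def q_def y_def F_def F'_def dil_simps dil_M)
  have I: "dil F * (1 - y * (q ^ 3 * M)) = (1 - y * q) * F"
    using Suc.IH by (simp add: M_def q_def y_def F_def)
  have "(1 - q ^ 2 * M) * (1 - y * (q ^ 3 * M)) * (dil F' * (1 - q ^ 2 * y * (q ^ 3 * M)))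
      = (dil F' * ((1 - q ^ 2 * M) * (1 - q ^ 2 * y * (q ^ 3 * M)))) * (1 - y * (q ^ 3 * M))"
    by (simp only: mult_ac)
  also have "\<dots> = (dil F * (1 - y * (q ^ 3 * M))) * ((1 + q * M) * (1 + q ^ 2 * M))"
    unfolding D by (simp only: mult_ac)
  also have "\<dots> = (1 - y * q) * (F' * ((1 - q ^ 2 * M) * (1 - y * (q ^ 3 * M))))"
    unfolding I S by (simp only: mult_ac)
  also have "\<dots> = (1 - q ^ 2 * M) * (1 - y * (q ^ 3 * M)) * ((1 - y * q) * F')"
    by (simp only: mult_ac)
  finally have "dil F' * (1 - q ^ 2 * y * (q ^ 3 * M)) = (1 - y * q) * F'"
    using nz_M(1)[of 2 m, where 'a='a] nz_M(2)[of 3 m, where 'a='a]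
    unfolding M_def q_def y_def by (simp only: mult_cancel_left no_zero_divisors) simp
  moreover have "q ^ 2 * y * (q ^ 3 * M) = y * (q ^ 3 * (q ^ 2 * M))" by (simp only: mult_ac)
  ultimately show ?case unfolding power_Suc M_def[symmetric] F'_def[symmetric] unfolding q_def y_def by simp
qed

text \<open>Telescoping certificate: multiplied by $y^m$ and summed over \<open>m\<close>, it yields the $q$-difference
  equation \<open>shifted_gf_eq\<close>.\<close>

lemma odd_certificate:
  fixes m :: nat
  defines "Y \<equiv> \<lambda>m. (1 - fps_X * qq) * (1 - (qq ^ 2) ^ m) * (level_gf s_odd m :: 'a::field fps fps)"
  shows "(1 - fps_X) * (1 - fps_X * qq) * level_gf s_odd m
     - (1 + fps_X * qq) * (1 + fps_X * qq ^ 2) * ((qq ^ 2) ^ m * dil (level_gf s_odd m)) = Y m - fps_X * Y (Suc m)"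
proof -
  define M :: "'a fps fps" where "M = (qq ^ 2) ^ m"
  define q y :: "'a fps fps" where "q = qq" and "y = fps_X"
  define F F' where "F = (level_gf s_odd m :: 'a fps fps)" and "F' = (level_gf s_odd (Suc m) :: 'a fps fps)"
  define T where "T = 1 - y * (q ^ 3 * M)"
  have S: "F' * ((1 - q ^ 2 * M) * T) = F * ((1 + q * M) * (1 + q ^ 2 * M))"
    using odd_Suc[of m, where 'a='a] by (simp add: T_def M_def q_def y_def F_def F'_def)
  have D: "dil F * T = (1 - y * q) * F"
    using dil_odd[of m, where 'a='a] by (simp add: T_def M_def q_def y_def F_def)
  have id1: "A * F * (a * T - y * b) = A * a * F * T - y * A * (F * b)"
    and id2: "A * a * F * T - y * A * (F' * (c * T)) = T * (A * a * F - y * (A * c * F'))"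
    and id3: "T * (x * A * F - u * v * (M * G)) = T * x * A * F - u * v * M * (G * T)"
    and id4: "T * x * A * F - u * v * M * (A * F) = A * F * (x * T - u * v * M)"
    for A F F' G T M a b c x y u v :: "'a fps fps" by (simp_all add: algebra_simps)
  have "T * ((1 - y) * (1 - y * q) * F - (1 + y * q) * (1 + y * q ^ 2) * (M * dil F))
     = T * (1 - y) * (1 - y * q) * F - (1 + y * q) * (1 + y * q ^ 2) * M * (dil F * T)"
    by (rule id3)
  also have "\<dots> = (1 - y * q) * F * ((1 - y) * T - (1 + y * q) * (1 + y * q ^ 2) * M)"
    unfolding D by (rule id4)
  \<comment> \<open>The only real computation, an identity of polynomials in \<open>y\<close>,
    \<open>q\<close> and \<open>M\<close>; \<open>id1\<close> to \<open>id4\<close> merely regroup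
    the opaque factors around it.\<close>
  also have "(1 - y) * T - (1 + y * q) * (1 + y * q ^ 2) * M = (1 - M) * T - y * ((1 + q * M) * (1 + q ^ 2 * M))"
    unfolding T_def by (simp add: algebra_simps power2_eq_square power3_eq_cube)
  also have "(1 - y * q) * F * ((1 - M) * T - y * ((1 + q * M) * (1 + q ^ 2 * M)))
    = (1 - y * q) * (1 - M) * F * T - y * (1 - y * q) * (F * ((1 + q * M) * (1 + q ^ 2 * M)))"
    by (rule id1)
  also have "\<dots> = T * ((1 - y * q) * (1 - M) * F - y * ((1 - y * q) * (1 - q ^ 2 * M) * F'))"
    unfolding S[symmetric] by (rule id2)
  finally have "T * ((1 - y) * (1 - y * q) * F - (1 + y * q) * (1 + y * q ^ 2) * (M * dil F)) = \<dots>" .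
  moreover have "T \<noteq> 0" using nz_M(2)[of 3 m, where 'a='a] by (simp add: T_def M_def q_def y_def)
  ultimately have "(1 - y) * (1 - y * q) * F - (1 + y * q) * (1 + y * q ^ 2) * (M * dil F)
     = (1 - y * q) * (1 - M) * F - y * ((1 - y * q) * (1 - q ^ 2 * M) * F')" by (simp only: mult_cancel_left) simp
  then show ?thesis by (simp only: Y_def M_def q_def y_def F_def F'_def power_Suc)
qed

text \<open>The product runs over $1 + y q^i$ for $i \<le> 2m$ and $1/(1 - y q^i)$ for $i \<le> 2m +
  1$. Dilation drops the two lowest factors of each kind and adds two at the top; only the lowest
  survive as \<open>m\<close> grows.\<close>

lemma dil_all: "level_gf s_all m * (1 - fps_X * qq) * (1 - fps_X * qq ^ 2) * ((1 + fps_X * (qq * (qq ^ 2) ^ m)) * (1 + fps_X * (qq ^ 2 * (qq ^ 2) ^ m)))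
   = (1 + fps_X * qq) * (1 + fps_X * qq ^ 2) * dil (level_gf s_all m) * 
     ((1 - fps_X * (qq ^ 2 * (qq ^ 2) ^ m)) * (1 - fps_X * (qq ^ 3 * (qq ^ 2) ^ m)) :: 'a::field fps fps)"
proof (induction m)
  case 0
  have "dil (level_gf s_all 0) * (1 - fps_X * qq ^ 3) = (1 :: 'a fps fps)"
    using arg_cong[OF all_0[where 'a='a], of dil] by (simp add: dil_simps power2_eq_square power3_eq_cube algebra_simps)
  moreover have "(a :: 'a fps fps) * u = 1 \<Longrightarrow> b * v = 1 \<Longrightarrow> a * u * c * (d * e) = d * e * b * (c * v)" for a b c d e u v
  proof -
    assume "a * u = 1" "b * v = 1"
    moreover have "a * u * c * (d * e) = (a * u) * (c * d * e)" by (simp only: mult_ac)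
    moreover have "d * e * b * (c * v) = (b * v) * (c * d * e)" by (simp only: mult_ac)
    ultimately show ?thesis by simp
  qed
  ultimately show ?case using all_0[where 'a='a] by simp
next
  case (Suc m)
  define M :: "'a fps fps" where "M = (qq ^ 2) ^ m"
  define q y :: "'a fps fps" where "q = qq" and "y = fps_X"
  define F F' where "F = (level_gf s_all m :: 'a fps fps)" and "F' = (level_gf s_all (Suc m) :: 'a fps fps)"
  define u v a b where "u = (1 - y * (q ^ 2 * M)) * (1 - y * (q ^ 3 * M))"
    and "v = (1 + y * (q * M)) * (1 + y * (q ^ 2 * M))"
    and "a = (1 - y * (q ^ 4 * M)) * (1 - y * (q ^ 5 * M))"
    and "b = (1 + y * (q ^ 3 * M)) * (1 + y * (q ^ 4 * M))"
  have pd: "q ^ 2 * y * (q * M) = y * (q ^ 3 * M)" "q ^ 2 * y * (q ^ 2 * M) = y * (q ^ 4 * M)"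
    "q ^ 2 * y * (q ^ 3 * M) = y * (q ^ 5 * M)" by (simp_all add: eval_nat_numeral)
  have S: "F' * u = F * v"
    using all_Suc[of m, where 'a='a] by (simp add: u_def v_def M_def q_def y_def F_def F'_def)
  have D: "dil F' * a = dil F * b"
    using arg_cong[OF all_Suc[of m, where 'a='a], of dil] unfolding dil_simps dil_M
    unfolding M_def[symmetric] F_def[symmetric] F'_def[symmetric]
    unfolding q_def[symmetric] y_def[symmetric] pd a_def b_def .
  have I: "F * (1 - y * q) * (1 - y * q ^ 2) * v = (1 + y * q) * (1 + y * q ^ 2) * dil F * u"
    using Suc.IH by (simp add: u_def v_def M_def q_def y_def F_def)
  have "u * (F' * (1 - y * q) * (1 - y * q ^ 2) * b) = (F' * u) * (1 - y * q) * (1 - y * q ^ 2) * b"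
    by (simp only: mult_ac)
  also have "\<dots> = (F * (1 - y * q) * (1 - y * q ^ 2) * v) * b" unfolding S by (simp only: mult_ac)
  also have "\<dots> = u * ((1 + y * q) * (1 + y * q ^ 2)) * (dil F * b)" unfolding I by (simp only: mult_ac)
  also have "\<dots> = u * ((1 + y * q) * (1 + y * q ^ 2) * dil F' * a)" unfolding D[symmetric] by (simp only: mult_ac)
  finally have e: "F' * (1 - y * q) * (1 - y * q ^ 2) * b = (1 + y * q) * (1 + y * q ^ 2) * dil F' * a"
    using nz_M(2)[of 2 m, where 'a='a] nz_M(2)[of 3 m, where 'a='a]
    unfolding u_def M_def q_def y_def by (simp only: mult_cancel_left no_zero_divisors) simp
  have p: "q * (q ^ 2 * M) = q ^ 3 * M" "q ^ 2 * (q ^ 2 * M) = q ^ 4 * M" "q ^ 3 * (q ^ 2 * M) = q ^ 5 * M"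
    by (simp_all add: eval_nat_numeral)
  show ?case using e unfolding power_Suc M_def[symmetric] F'_def[symmetric]
    unfolding q_def[symmetric] y_def[symmetric] p b_def a_def .
qed

text \<open>The marked parts are the overlined and the even ones. Dilation raises their sizes by 2,
  so level \<open>m\<close> is compared with level \<open>m + 1\<close>, up to the lowest marked
  factors and the new unmarked odd part \<open>2 * m + 3\<close>.\<close>

lemma dil_rest: "level_gf s_rest (Suc m) * ((1 - fps_X * qq ^ 2) * (1 - qq ^ 3 * (qq ^ 2) ^ m))
   = dil (level_gf s_rest m) * ((1 + fps_X * qq) * (1 + fps_X * qq ^ 2) :: 'a::field fps fps)"
proof (induction m)
  case 0
  have "dil (level_gf s_rest 0) * (1 - qq) = (1 :: 'a fps fps)"
    using arg_cong[OF rest_0[where 'a='a], of dil] by (simp add: dil_simps)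
  then have "dil (level_gf s_rest 0) * (1 - qq) = level_gf s_rest 0 * (1 - qq :: 'a fps fps)" using rest_0[where 'a='a] by simp
  then have "dil (level_gf s_rest 0) = (level_gf s_rest 0 :: 'a fps fps)"
    using qq_nz[of 0 0, where 'a='a] by simp
  then show ?case using rest_Suc[of 0, where 'a='a] by simp
next
  case (Suc m)
  define M :: "'a fps fps" where "M = (qq ^ 2) ^ m"
  define q y :: "'a fps fps" where "q = qq" and "y = fps_X"
  define F F' F'' where "F = (level_gf s_rest m :: 'a fps fps)" and "F' = (level_gf s_rest (Suc m) :: 'a fps fps)"
    and "F'' = (level_gf s_rest (Suc (Suc m)) :: 'a fps fps)"
  define a b c d where "a = 1 - y * (q ^ 4 * M)" and "b = (1 + y * (q ^ 3 * M)) * (1 + y * (q ^ 4 * M))"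
    and "c = 1 - q ^ 3 * M" and "d = 1 - q ^ 5 * M"
  have p: "q * (q ^ 2 * M) = q ^ 3 * M" "q ^ 2 * (q ^ 2 * M) = q ^ 4 * M" "q ^ 3 * (q ^ 2 * M) = q ^ 5 * M"
    by (simp_all add: eval_nat_numeral)
  have pd: "q ^ 2 * y * (q * M) = y * (q ^ 3 * M)" "q ^ 2 * y * (q ^ 2 * M) = y * (q ^ 4 * M)"
    "q ^ 2 * y * (q ^ 3 * M) = y * (q ^ 5 * M)" by (simp_all add: eval_nat_numeral)
  have S: "F'' * (a * d) = F' * b"
    using rest_Suc[of "Suc m", where 'a='a] unfolding power_Suc M_def[symmetric] F'_def[symmetric] F''_def[symmetric]
    unfolding q_def[symmetric] y_def[symmetric] p a_def b_def d_def .
  have D: "dil F' * (a * c) = dil F * b"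
    using arg_cong[OF rest_Suc[of m, where 'a='a], of dil] unfolding dil_simps dil_M
    unfolding M_def[symmetric] F_def[symmetric] F'_def[symmetric]
    unfolding q_def[symmetric] y_def[symmetric] pd a_def b_def c_def .
  have I: "F' * ((1 - y * q ^ 2) * c) = dil F * ((1 + y * q) * (1 + y * q ^ 2))"
    using Suc.IH by (simp add: c_def M_def q_def y_def F_def F'_def)
  have "(a * c) * (F'' * ((1 - y * q ^ 2) * d)) = (F'' * (a * d)) * ((1 - y * q ^ 2) * c)"
    by (simp only: mult_ac)
  also have "\<dots> = (F' * ((1 - y * q ^ 2) * c)) * b" unfolding S by (simp only: mult_ac)
  also have "\<dots> = (dil F * b) * ((1 + y * q) * (1 + y * q ^ 2))" unfolding I by (simp only: mult_ac)
  also have "\<dots> = (a * c) * (dil F' * ((1 + y * q) * (1 + y * q ^ 2)))" unfolding D[symmetric] by (simp only: mult_ac)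
  finally have "F'' * ((1 - y * q ^ 2) * d) = dil F' * ((1 + y * q) * (1 + y * q ^ 2))"
    using nz_M(1)[of 3 m, where 'a='a] nz_M(2)[of 4 m, where 'a='a]
    unfolding a_def c_def M_def q_def y_def by (simp only: mult_cancel_left no_zero_divisors) simp
  then show ?case unfolding power_Suc M_def[symmetric] F'_def[symmetric] F''_def[symmetric]
    unfolding q_def[symmetric] y_def[symmetric] p d_def .
qed

text \<open>The coefficient of $y^e$ is \<open>rest_pair_certificate\<close>; its sum over $m - e = j$ telescopes to a recurrence
  for the rank generating functions.\<close>

lemma rest_certificate_Suc:
  fixes m :: nat
  defines "M \<equiv> (qq ^ 2) ^ Suc m"
  defines "F \<equiv> level_gf s_rest m :: 'a::field fps fps" and "F' \<equiv> level_gf s_rest (Suc m) :: 'a fps fps"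
  shows "qq * (1 + fps_X) * (1 - qq ^ 2 * fps_X) * (M * F')
    = (1 + qq ^ 2 * fps_X) * (dil F' - dil F - qq ^ 2 * fps_X * M * (dil F' - fps_X * dil F))"
proof -
  define q y :: "'a fps fps" where "q = qq" and "y = fps_X"
  define T where "T = 1 - q * M"
  have p: "q ^ 3 * (q ^ 2) ^ m = q * M" unfolding M_def q_def[symmetric] by (simp add: eval_nat_numeral)
  have I: "F' * ((1 - y * q ^ 2) * T) = dil F * ((1 + y * q) * (1 + y * q ^ 2))"
    using dil_rest[of m, where 'a='a] unfolding q_def[symmetric] y_def[symmetric] p T_def F_def F'_def .
  have D: "dil F' * ((1 - q ^ 2 * y * M) * T) = dil F * ((1 + q * y * M) * (1 + q ^ 2 * y * M))"
    using arg_cong[OF rest_Suc[of m, where 'a='a], of dil]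
    by (simp add: M_def T_def q_def y_def F_def F'_def dil_simps dil_M eval_nat_numeral algebra_simps)
  have id5: "A * (F' * ((1 - b) * T) - F * (T * (1 - b * y))) = T * (A * (F' - F - b * (F' - y * F)))"
    for A F F' T b y :: "'a fps fps" by (simp add: algebra_simps)
  have "T * (q * (1 + y) * (1 - q ^ 2 * y) * (M * F')) = q * (1 + y) * M * (F' * ((1 - y * q ^ 2) * T))"
    by (simp only: mult_ac)
  also have "\<dots> = (1 + q ^ 2 * y) * dil F * (q * M * (1 + y) * (1 + y * q))" unfolding I by (simp only: mult_ac)
  also have "q * M * (1 + y) * (1 + y * q) = (1 + q * y * M) * (1 + q ^ 2 * y * M) - T * (1 - q ^ 2 * y * M * y)"
    unfolding T_def by (simp add: algebra_simps power2_eq_square)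
  also have "(1 + q ^ 2 * y) * dil F * ((1 + q * y * M) * (1 + q ^ 2 * y * M) - T * (1 - q ^ 2 * y * M * y))
    = (1 + q ^ 2 * y) * (dil F * ((1 + q * y * M) * (1 + q ^ 2 * y * M)) - dil F * (T * (1 - q ^ 2 * y * M * y)))"
    by (simp only: right_diff_distrib[of "dil F"] mult.assoc)
  also have "\<dots> = T * ((1 + q ^ 2 * y) * (dil F' - dil F - q ^ 2 * y * M * (dil F' - y * dil F)))"
    unfolding D[symmetric] by (rule id5)
  finally have "T * (q * (1 + y) * (1 - q ^ 2 * y) * (M * F')) = \<dots>" .
  moreover have "T \<noteq> 0" using nz_M(1)[of 3 m, where 'a='a] p unfolding T_def q_def by simp
  ultimately show ?thesis unfolding q_def y_def by (simp only: mult_cancel_left) simp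
qed

lemma dil_rest_0: "dil (level_gf s_rest 0) = (level_gf s_rest 0 :: 'a::field fps fps)"
proof -
  have "dil (level_gf s_rest 0) * (1 - qq) = (1 :: 'a fps fps)"
    using arg_cong[OF rest_0[where 'a='a], of dil] by (simp add: dil_simps)
  then have "dil (level_gf s_rest 0) * (1 - qq) = level_gf s_rest 0 * (1 - qq :: 'a fps fps)" using rest_0[where 'a='a] by simp
  then show ?thesis using qq_nz[of 0 0, where 'a='a] by simp
qed

text \<open>The bottom case of \<open>rest_certificate_Suc\<close>, with 0 in place of the level
  below; this costs an inhomogeneous term, the source of \<open>defect\<close>.\<close>

lemma rest_certificate_0:
  "qq * (1 + fps_X) * (1 - qq ^ 2 * fps_X) * level_gf s_rest 0
    = (1 + qq ^ 2 * fps_X) * (dil (level_gf s_rest 0) - qq ^ 2 * fps_X * dil (level_gf s_rest 0))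
      + (1 - qq ^ 2 * fps_X) * (qq * fps_X - (1 :: 'a::field fps fps))"
proof -
  define q y F :: "'a fps fps" where "q = qq" and "y = fps_X" and "F = level_gf s_rest 0"
  have 1: "F * (1 - q) = 1" using rest_0[where 'a='a] by (simp add: F_def q_def)
  have "q * (1 + y) * (1 - q ^ 2 * y) * F = (1 + q ^ 2 * y) * (F - q ^ 2 * y * F)
      + (1 - q ^ 2 * y) * (q * y - 1) * (F * (1 - q))"
    by (simp add: algebra_simps power2_eq_square)
  then show ?thesis unfolding 1 dil_rest_0 unfolding F_def q_def y_def by simp
qed

section \<open>Equidistribution of the shifted level and the number of parts\<close>

text \<open>The statistic $L$. The division rounds half the largest part up, and \<open>chi\<close>
  is 1 only when that part is odd, so the subtraction never truncates.\<close>

definition level :: "part list \<Rightarrow> nat" where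
  "level \<pi> = (largest_part_size \<pi> + 1) div 2 - chi \<pi>"

text \<open>Subtracting \<open>chi\<close> makes the level monotone in the order of keys: both kinds
  of $2j$ and the plain $2j + 1$ have level $j$, the overlined $2j + 1$ already has level $j +
  1$.\<close>

lemma level_le:
  assumes "\<pi> \<in> overpartitions N"
  shows "(\<forall>r\<in>set \<pi>. key r \<le> 4 * m + 2) \<longleftrightarrow> level \<pi> \<le> m"
proof (cases \<pi>)
  case Nil
  then show ?thesis by (simp add: level_def largest_part_size_def)
next
  case (Cons p \<rho>)
  obtain k v where p: "p = (k, v)" by (cases p)
  have k: "0 < k" and r: "\<forall>r\<in>set \<rho>. key r \<le> 2 * k"
    using assms unfolding Cons p by (simp_all add: Cons_overpartitions)
  have "(\<forall>r\<in>set \<pi>. key r \<le> 4 * m + 2) \<longleftrightarrow> key p \<le> 4 * m + 2"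
    using r unfolding Cons p key_def by fastforce
  also have "\<dots> \<longleftrightarrow> level \<pi> \<le> m"
  proof (cases "odd k \<and> \<not> v")
    case True
    then obtain j where "k = 2 * j + 1" by (auto elim: oddE)
    then show ?thesis using True unfolding Cons p
      by (simp add: key_def level_def chi_def odd_nonoverlined_def largest_part_size_def)
  next
    case False
    then show ?thesis unfolding Cons p
      by (cases v) (simp_all add: key_def level_def chi_def odd_nonoverlined_def largest_part_size_def; presburger)+
  qed
  finally show ?thesis .
qed

lemma level_gf_nth: "level_gf s m $ i $ N = of_nat (card {\<pi> \<in> overpartitions N. level \<pi> \<le> m \<and> stat s \<pi> = i})"
proof -
  have "{\<pi> \<in> key_bounded (4 * m + 2) N. stat s \<pi> = i} = {\<pi> \<in> overpartitions N. level \<pi> \<le> m \<and> stat s \<pi> = i}"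
    using level_le by (auto simp: key_bounded_def)
  then show ?thesis by (simp add: level_gf_def key_gf_nth)
qed

lemma stat_s_all: "stat s_all \<pi> = length \<pi>"
  by (simp add: stat_def sum_list_triv)

lemma length_stat: "length \<pi> = stat s_rest \<pi> + stat s_odd \<pi>"
  by (induction \<pi>) (auto simp: stat_def s_rest_def s_odd_def)

lemma M2_rank_level: "M2_rank \<pi> = int (level \<pi>) - int (stat s_rest \<pi>)"
proof -
  have f: "length (filter odd_nonoverlined \<pi>) = stat s_odd \<pi>"
    by (induction \<pi>) (auto simp: stat_def s_odd_def)
  have c: "\<lceil>real n / 2\<rceil> = int ((n + 1) div 2)" for n
  proof (cases "even n")
    case True
    then show ?thesis by (auto elim: evenE)
  next
    case False
    then obtain j where "n = 2 * j + 1" by (auto elim: oddE)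
    then show ?thesis by (simp add: ceiling_eq_iff add_divide_distrib)
  qed
  have "chi \<pi> \<le> (largest_part_size \<pi> + 1) div 2"
    by (auto simp: chi_def largest_part_size_def odd_nonoverlined_def elim!: oddE)
  then show ?thesis unfolding M2_rank_def c f level_def length_stat[of \<pi>] by simp
qed

lemma stat_le:
  assumes "\<pi> \<in> overpartitions N" shows "length \<pi> \<le> N" "level \<pi> \<le> N" "stat s_odd \<pi> \<le> N" "stat s_rest \<pi> \<le> N"
proof -
  have p: "\<forall>x\<in>set (map fst \<pi>). 0 < x" "sum_list (map fst \<pi>) = N"
    using assms by (auto simp: overpartitions_def is_partition_def)
  show l: "length \<pi> \<le> N" using length_le_sum_list[OF p(1)] p(2) by simp
  show "stat s_odd \<pi> \<le> N" "stat s_rest \<pi> \<le> N" using l length_stat[of \<pi>] by simp_all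
  have "largest_part_size \<pi> \<le> N" using p(2) by (cases \<pi>) (auto simp: largest_part_size_def)
  then show "level \<pi> \<le> N" by (auto simp: level_def)
qed

definition stat_gf :: "(part \<Rightarrow> nat) \<Rightarrow> 'a::comm_ring_1 fps fps" where
  "stat_gf s = Abs_fps (\<lambda>i. Abs_fps (\<lambda>N. of_nat (card {\<pi> \<in> overpartitions N. stat s \<pi> = i})))"

lemma stat_gf_nth: "stat_gf s $ i $ N = of_nat (card {\<pi> \<in> overpartitions N. stat s \<pi> = i})"
  by (simp add: stat_gf_def)

text \<open>Agreement up to degree \<open>k\<close> in $q$, in every power of the outer variable; it
  carries the finite-level equations over to all overpartitions.\<close>

definition eqb :: "nat \<Rightarrow> 'a::zero fps fps \<Rightarrow> 'a fps fps \<Rightarrow> bool" where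
  "eqb k f g \<longleftrightarrow> (\<forall>i N. N \<le> k \<longrightarrow> f $ i $ N = g $ i $ N)"

lemma eqb_refl: "eqb k f f" by (simp add: eqb_def)

lemma eqb_mult:
  assumes "eqb k f f'" "eqb k g g'"
  shows "eqb k (f * g) (f' * g' :: 'a::comm_ring_1 fps fps)"
  unfolding eqb_def
proof (intro allI impI)
  fix i N assume N: "N \<le> k"
  have "f $ j $ l = f' $ j $ l" "g $ j $ l = g' $ j $ l" if "l \<le> N" for j l
    using assms N that unfolding eqb_def by auto
  then have "(f $ j * g $ l) $ N = (f' $ j * g' $ l) $ N" for j l
    unfolding fps_mult_nth by (intro sum.cong) auto
  then show "(f * g) $ i $ N = (f' * g') $ i $ N"
    unfolding fps_mult_nth[of f] fps_mult_nth[of f'] fps_sum_nth by simp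
qed

lemma eqb_dil: "eqb k f g \<Longrightarrow> eqb k (dil f) (dil g)"
  by (auto simp: eqb_def dil_nth fps_X_power_mult_nth)

lemma eqb_add: "eqb k f f' \<Longrightarrow> eqb k g g' \<Longrightarrow> eqb k (f + g) (f' + g' :: 'a::comm_ring_1 fps fps)"
  and eqb_diff: "eqb k f f' \<Longrightarrow> eqb k g g' \<Longrightarrow> eqb k (f - g) (f' - g' :: 'a::comm_ring_1 fps fps)"
  by (simp_all add: eqb_def)

lemma stat_gf_level_gf: "eqb (2 * m) (stat_gf s) (level_gf s m)"
  unfolding eqb_def
proof (intro allI impI)
  fix i N :: nat assume "N \<le> 2 * m"
  then have "key_bounded (4 * m + 2) N = overpartitions N" by (intro key_bounded_large) simp
  then show "stat_gf s $ i $ N = level_gf s m $ i $ N" by (simp add: stat_gf_nth level_gf_def key_gf_nth)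
qed

lemma eqb_M: "eqb (2 * m) (fps_X * (qq ^ Suc k * (qq ^ 2) ^ m)) 0"
proof -
  have "fps_X * (qq ^ Suc k * (qq ^ 2) ^ m) = (fps_X ^ 1 * qq ^ (Suc k + 2 * m) * 1 :: 'a fps fps)"
    unfolding power_mult[symmetric] power_add by (simp add: mult.assoc)
  then show ?thesis unfolding eqb_def by (simp only: biv_nth) auto
qed

text \<open>If the coefficients of the difference vanish below $y^n$, the equation reduces to $(1 -
  q^{2n}) d_n = 0$, because both multipliers have constant term 1 in $y$.\<close>

lemma dil_unique:
  fixes f g :: "'a::field fps fps"
  assumes f: "f * ((1 - fps_X * qq) * (1 - fps_X * qq ^ 2)) = (1 + fps_X * qq) * (1 + fps_X * qq ^ 2) * dil f"
    and g: "g * ((1 - fps_X * qq) * (1 - fps_X * qq ^ 2)) = (1 + fps_X * qq) * (1 + fps_X * qq ^ 2) * dil g"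
    and 0: "f $ 0 = g $ 0"
  shows "f = g"
proof -
  define A B d :: "'a fps fps" where "A = (1 - fps_X * qq) * (1 - fps_X * qq ^ 2)"
    and "B = (1 + fps_X * qq) * (1 + fps_X * qq ^ 2)" and "d = f - g"
  have e: "d * A = B * dil d"
    using f g unfolding A_def[symmetric] B_def[symmetric] d_def dil_diff by (simp add: algebra_simps)
  have A0: "A $ 0 = 1" and B0: "B $ 0 = 1" by (simp_all add: A_def B_def)
  have "d $ n = 0" for n
  proof (induction n rule: less_induct)
    case (less n)
    show ?case
    proof (cases "n = 0")
      case True
      then show ?thesis using 0 by (simp add: d_def)
    next
      case False
      have "(d * A) $ n = (\<Sum>i\<in>{0..n}. d $ i * A $ (n - i))" by (rule fps_mult_nth)
      also have "\<dots> = (\<Sum>i\<in>{n}. d $ i * A $ (n - i))"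
        by (rule sum.mono_neutral_right) (auto simp: less)
      finally have l: "(d * A) $ n = d $ n" by (simp add: A0)
      have "(dil d * B) $ n = (\<Sum>i\<in>{0..n}. dil d $ i * B $ (n - i))" by (rule fps_mult_nth)
      also have "\<dots> = (\<Sum>i\<in>{n}. dil d $ i * B $ (n - i))"
        by (rule sum.mono_neutral_right) (auto simp: less dil_nth)
      finally have r: "(dil d * B) $ n = fps_X ^ (2 * n) * d $ n" by (simp add: B0 dil_nth)
      have "(1 - fps_X ^ (2 * n)) * d $ n = 0"
        using l r e by (simp add: algebra_simps)
      moreover have "(1 - fps_X ^ (2 * n) :: 'a fps) $ 0 = 1" using False by simp
      then have "(1 - fps_X ^ (2 * n) :: 'a fps) \<noteq> 0" by (metis fps_zero_nth zero_neq_one)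
      ultimately show ?thesis by simp
    qed
  qed
  then have "d = 0" by (intro fps_ext) simp
  then show ?thesis by (simp add: d_def)
qed

text \<open>The limit of \<open>dil_all\<close>: the factors at the top are congruent to 1 modulo
  high powers of $q$.\<close>

lemma stat_gf_all_eq:
  fixes H :: "'a::field fps fps"
  defines "H \<equiv> stat_gf s_all"
  shows "H * ((1 - fps_X * qq) * (1 - fps_X * qq ^ 2)) = (1 + fps_X * qq) * (1 + fps_X * qq ^ 2) * dil H"
proof (intro fps_ext)
  fix i N
  let ?l = "\<lambda>H U :: 'a fps fps. H * (1 - fps_X * qq) * (1 - fps_X * qq ^ 2) * U"
  let ?r = "\<lambda>H U :: 'a fps fps. (1 + fps_X * qq) * (1 + fps_X * qq ^ 2) * dil H * U"
  let ?U = "(1 + fps_X * (qq * (qq ^ 2) ^ N)) * (1 + fps_X * (qq ^ 2 * (qq ^ 2) ^ N)) :: 'a fps fps"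
  let ?V = "(1 - fps_X * (qq ^ 2 * (qq ^ 2) ^ N)) * (1 - fps_X * (qq ^ 3 * (qq ^ 2) ^ N)) :: 'a fps fps"
  have "eqb (2 * N) ?U ((1 + 0) * (1 + 0))"
    using eqb_M[of N 0, where 'a='a] eqb_M[of N 1, where 'a='a]
    by (intro eqb_mult eqb_add eqb_refl) (simp_all add: numeral_2_eq_2)
  then have U: "eqb (2 * N) ?U 1" by simp
  have "eqb (2 * N) ?V ((1 - 0) * (1 - 0))"
    using eqb_M[of N 1, where 'a='a] eqb_M[of N 2, where 'a='a]
    by (intro eqb_mult eqb_diff eqb_refl) (simp_all add: numeral_2_eq_2 numeral_3_eq_3)
  then have V: "eqb (2 * N) ?V 1" by simp
  have F: "eqb (2 * N) (level_gf s_all N) H"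
    using stat_gf_level_gf[of N s_all, where 'a='a] unfolding H_def eqb_def by metis
  have "eqb (2 * N) (?l (level_gf s_all N) ?U) (?l H 1)"
    by (rule eqb_mult[OF eqb_mult[OF eqb_mult[OF F eqb_refl] eqb_refl] U])
  moreover have "eqb (2 * N) (?r (level_gf s_all N) ?V) (?r H 1)"
    by (rule eqb_mult[OF eqb_mult[OF eqb_refl eqb_dil[OF F]] V])
  moreover have "?l (level_gf s_all N) ?U = ?r (level_gf s_all N) ?V" by (rule dil_all)
  ultimately have "?l H 1 $ i $ N = ?r H 1 $ i $ N" by (auto simp: eqb_def)
  then show "(H * ((1 - fps_X * qq) * (1 - fps_X * qq ^ 2))) $ i $ N = ((1 + fps_X * qq) * (1 + fps_X * qq ^ 2) * dil H) $ i $ N"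
    by (simp add: mult.assoc)
qed

lemma locfin_yX: "locfin (\<lambda>m. fps_X ^ m * f m :: 'a::comm_ring_1 fps) UNIV"
  by (rule locfin_X_power) simp

lemma fsum_telescope:
  fixes f :: "nat \<Rightarrow> 'a::comm_ring_1 fps"
  shows "fsum (\<lambda>m. fps_X ^ m * (f m - fps_X * f (Suc m))) UNIV = f 0"
proof -
  have l: "locfin (\<lambda>m. fps_X ^ Suc m * f (Suc m)) UNIV"
  proof (rule locfin_X_power)
    fix k show "finite {m \<in> UNIV. Suc m \<le> k}" by (rule finite_subset[of _ "{..k}"]) auto
  qed
  have "fsum (\<lambda>m. fps_X ^ m * f m) UNIV = f 0 + fsum (\<lambda>m. fps_X ^ Suc m * f (Suc m)) UNIV"
    using fsum_nat_Suc[OF locfin_yX, of f] by simp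
  moreover have "fsum (\<lambda>m. fps_X ^ m * (f m - fps_X * f (Suc m))) UNIV
      = fsum (\<lambda>m. fps_X ^ m * f m) UNIV - fsum (\<lambda>m. fps_X ^ Suc m * f (Suc m)) UNIV"
    by (subst fsum_diff[OF locfin_yX l, symmetric], rule fsum_cong) (simp add: algebra_simps)
  ultimately show ?thesis by simp
qed

text \<open>The power $y^m$ marks an upper bound for the level, not the level itself; a factor $1 -
  y$ later turns the cumulative counts into exact ones.\<close>

definition shifted_gf :: "'a::comm_ring_1 fps fps" where
  "shifted_gf = fsum (\<lambda>m. fps_X ^ m * level_gf s_odd m) UNIV"

lemma shifted_gf_nth: "shifted_gf $ i $ N = of_nat (card {\<pi> \<in> overpartitions N. level \<pi> + stat s_odd \<pi> \<le> i})"
proof -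
  let ?A = "\<lambda>m. {\<pi> \<in> overpartitions N. level \<pi> \<le> m \<and> stat s_odd \<pi> = i - m}"
  have "shifted_gf $ i = (\<Sum>m\<le>i. (fps_X ^ m * level_gf s_odd m) $ i :: 'a fps)" unfolding shifted_gf_def
    by (rule fsum_nth) (auto simp: fps_X_power_mult_nth)
  also have "\<dots> = (\<Sum>m\<le>i. level_gf s_odd m $ (i - m))"
    by (rule sum.cong) (auto simp: fps_X_power_mult_nth)
  finally have "shifted_gf $ i $ N = (of_nat (\<Sum>m\<le>i. card (?A m)) :: 'a)" by (simp add: fps_sum_nth level_gf_nth)
  also have "(\<Sum>m\<le>i. card (?A m)) = card (\<Union>m\<in>{..i}. ?A m)"
    by (rule card_UN_disjoint[symmetric]) (auto simp: finite_overpartitions)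
  also have "(\<Union>m\<in>{..i}. ?A m) = {\<pi> \<in> overpartitions N. level \<pi> + stat s_odd \<pi> \<le> i}"
  proof (intro equalityI subsetI)
    fix \<pi> assume "\<pi> \<in> {\<pi> \<in> overpartitions N. level \<pi> + stat s_odd \<pi> \<le> i}"
    then have "\<pi> \<in> ?A (i - stat s_odd \<pi>)" "i - stat s_odd \<pi> \<in> {..i}" by auto
    then show "\<pi> \<in> (\<Union>m\<in>{..i}. ?A m)" by (rule UN_I[rotated])
  qed auto
  finally show ?thesis .
qed

lemma shifted_gf_eq: "(1 - fps_X) * (1 - fps_X * qq) * shifted_gf = (1 + fps_X * qq) * (1 + fps_X * qq ^ 2) * (dil shifted_gf :: 'a::field fps fps)"
proof -
  define B :: "'a fps fps" where "B = (1 + fps_X * qq) * (1 + fps_X * qq ^ 2)"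
  define A :: "'a fps fps" where "A = (1 - fps_X) * (1 - fps_X * qq)"
  define Y where "Y m = (1 - fps_X * qq) * (1 - (qq ^ 2) ^ m) * (level_gf s_odd m :: 'a fps fps)" for m
  have d: "dil shifted_gf = fsum (\<lambda>m. fps_X ^ m * ((qq ^ 2) ^ m * dil (level_gf s_odd m :: 'a fps fps))) UNIV"
    unfolding shifted_gf_def dil_fsum[OF locfin_yX]
    by (rule fsum_cong) (simp only: dil_mult dil_X_power power_mult[of qq 2], simp only: mult_ac)
  have a: "fsum (\<lambda>m. A * (fps_X ^ m * level_gf s_odd m)) UNIV = A * shifted_gf"
    unfolding shifted_gf_def by (rule fsum_mult[OF locfin_yX])
  have b: "fsum (\<lambda>m. B * (fps_X ^ m * ((qq ^ 2) ^ m * dil (level_gf s_odd m)))) UNIV = B * dil shifted_gf"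
    unfolding d by (rule fsum_mult[OF locfin_yX])
  have "A * shifted_gf - B * dil shifted_gf = fsum (\<lambda>m. A * (fps_X ^ m * level_gf s_odd m) - B * (fps_X ^ m * ((qq ^ 2) ^ m * dil (level_gf s_odd m)))) UNIV"
    unfolding a[symmetric] b[symmetric] by (rule fsum_diff[symmetric]) (intro locfin_mult locfin_yX)+
  also have "\<dots> = fsum (\<lambda>m. fps_X ^ m * (Y m - fps_X * Y (Suc m))) UNIV"
  proof (rule fsum_cong)
    fix m
    have "A * (x * F) - B * (x * D) = x * (A * F - B * D)" for x F D :: "'a fps fps"
      by (simp add: algebra_simps)
    then show "A * (fps_X ^ m * level_gf s_odd m) - B * (fps_X ^ m * ((qq ^ 2) ^ m * dil (level_gf s_odd m)))
        = fps_X ^ m * (Y m - fps_X * Y (Suc m))"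
      unfolding Y_def odd_certificate[symmetric] A_def B_def .
  qed
  also have "\<dots> = Y 0" by (rule fsum_telescope)
  \<comment> \<open>\<open>Y 0\<close> is 0 because of its factor
    \<open>1 - (qq ^ 2) ^ 0\<close>.\<close>
  finally show ?thesis by (simp add: Y_def A_def B_def)
qed

text \<open>The factor $1 - y$ in \<open>G\<close> supplies $1 - y q^2$ after dilation, which is
  what separates \<open>shifted_gf_eq\<close> from \<open>stat_gf_all_eq\<close>. Equality of the
  counts in the field is all that the moments require.\<close>

lemma level_odd_equidist:
  "of_nat (card {\<pi> \<in> overpartitions N. level \<pi> + stat s_odd \<pi> = i})
   = (of_nat (card {\<pi> \<in> overpartitions N. length \<pi> = i}) :: 'a::field)"
proof -
  define G :: "'a fps fps" where "G = (1 - fps_X) * shifted_gf"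
  have Gn: "G $ i $ N = of_nat (card {\<pi> \<in> overpartitions N. level \<pi> + stat s_odd \<pi> = i})" for i N
  proof (cases i)
    case 0
    then show ?thesis by (simp add: G_def left_diff_distrib shifted_gf_nth)
  next
    case (Suc j)
    let ?C = "\<lambda>P. {\<pi> \<in> overpartitions N. P (level \<pi> + stat s_odd \<pi>)}"
    have "?C (\<lambda>x. x \<le> i) = ?C (\<lambda>x. x \<le> j) \<union> ?C (\<lambda>x. x = i)" using Suc by auto
    moreover have "card (?C (\<lambda>x. x \<le> j) \<union> ?C (\<lambda>x. x = i)) = card (?C (\<lambda>x. x \<le> j)) + card (?C (\<lambda>x. x = i))"
      using Suc by (intro card_Un_disjoint) (auto simp: finite_overpartitions)
    ultimately show ?thesis using Suc by (simp add: G_def left_diff_distrib shifted_gf_nth)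
  qed
  have "G = stat_gf s_all"
  proof (rule dil_unique)
    have "G * ((1 - fps_X * qq) * (1 - fps_X * qq ^ 2)) = ((1 - fps_X) * (1 - fps_X * qq) * shifted_gf) * (1 - fps_X * qq ^ 2)"
      unfolding G_def by (simp only: mult_ac)
    also have "\<dots> = (1 + fps_X * qq) * (1 + fps_X * qq ^ 2) * ((1 - fps_X * qq ^ 2) * dil shifted_gf)"
      unfolding shifted_gf_eq by (simp only: mult_ac)
    also have "(1 - fps_X * qq ^ 2) * dil shifted_gf = dil G"
      unfolding G_def dil_simps by (simp only: mult_ac)
    finally show "G * ((1 - fps_X * qq) * (1 - fps_X * qq ^ 2)) = (1 + fps_X * qq) * (1 + fps_X * qq ^ 2) * dil G" .
    have "G $ 0 = level_gf s_odd 0 $ 0"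
      by (intro fps_ext) (simp add: G_def left_diff_distrib shifted_gf_nth level_gf_nth)
    also have "\<dots> = 1" using arg_cong[OF odd_0[where 'a='a], of "\<lambda>f. f $ 0"] by simp
    also have "1 = (stat_gf s_all :: 'a fps fps) $ 0"
    proof (rule fps_ext)
      fix N
      have "{\<pi> \<in> overpartitions N. stat s_all \<pi> = 0} = (if N = 0 then {[]} else {})"
        unfolding stat_s_all by (auto simp: Nil_overpartitions)
      then show "1 $ N = (stat_gf s_all :: 'a fps fps) $ 0 $ N" by (simp add: stat_gf_nth)
    qed
    finally show "G $ 0 = stat_gf s_all $ 0" .
  qed (rule stat_gf_all_eq)
  then have "G $ i $ N = stat_gf s_all $ i $ N" by simp
  then show ?thesis unfolding Gn stat_gf_nth stat_s_all .
qed

lemma sum_by_stat: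
  assumes "finite A" "\<And>x. x \<in> A \<Longrightarrow> f x \<le> (K::nat)"
  shows "(\<Sum>x\<in>A. g (f x)) = (\<Sum>i\<le>K. of_nat (card {x \<in> A. f x = i}) * (g i :: 'a::comm_semiring_1))"
proof -
  have "(\<Sum>x\<in>A. g (f x)) = (\<Sum>i\<le>K. sum (\<lambda>x. g (f x)) {x \<in> A. f x = i})"
    using assms by (intro sum.group[symmetric]) auto
  also have "\<dots> = (\<Sum>i\<le>K. of_nat (card {x \<in> A. f x = i}) * g i)"
    by (intro sum.cong) simp_all
  finally show ?thesis .
qed

lemma sum_length_rank:
  "2 * (\<Sum>\<pi>\<in>overpartitions N. of_nat (length \<pi>) * of_int (M2_rank \<pi>))
    = - (\<Sum>\<pi>\<in>overpartitions N. (of_int (M2_rank \<pi>) ^ 2 :: 'a::field))"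
proof -
  let ?g = "\<lambda>i. of_nat (i ^ 2) :: 'a"
  have "(\<Sum>\<pi>\<in>overpartitions N. ?g (level \<pi> + stat s_odd \<pi>)) = (\<Sum>\<pi>\<in>overpartitions N. ?g (length \<pi>))"
  proof -
    have "(\<Sum>\<pi>\<in>overpartitions N. ?g (level \<pi> + stat s_odd \<pi>))
       = (\<Sum>i\<le>2 * N. of_nat (card {\<pi> \<in> overpartitions N. level \<pi> + stat s_odd \<pi> = i}) * ?g i)"
      by (rule sum_by_stat) (use stat_le in \<open>fastforce simp: finite_overpartitions\<close>)+
    also have "\<dots> = (\<Sum>i\<le>2 * N. of_nat (card {\<pi> \<in> overpartitions N. length \<pi> = i}) * ?g i)"
      unfolding level_odd_equidist ..
    also have "\<dots> = (\<Sum>\<pi>\<in>overpartitions N. ?g (length \<pi>))"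
      by (rule sum_by_stat[symmetric]) (use stat_le in \<open>fastforce simp: finite_overpartitions\<close>)+
    finally show ?thesis .
  qed
  moreover have "?g (level \<pi> + stat s_odd \<pi>) = ?g (length \<pi>) + 2 * (of_nat (length \<pi>) * of_int (M2_rank \<pi>)) + of_int (M2_rank \<pi>) ^ 2" for \<pi>
  proof -
    have "int (level \<pi> + stat s_odd \<pi>) = int (length \<pi>) + M2_rank \<pi>"
      unfolding M2_rank_level length_stat[of \<pi>] by simp
    then have "of_int (int (level \<pi> + stat s_odd \<pi>)) = (of_int (int (length \<pi>) + M2_rank \<pi>) :: 'a)" by (rule arg_cong)
    then have "of_nat (level \<pi> + stat s_odd \<pi>) = (of_nat (length \<pi>) + of_int (M2_rank \<pi>) :: 'a)" by simp
    then show ?thesis unfolding of_nat_power by (simp add: power2_eq_square algebra_simps)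
  qed
  ultimately show ?thesis by (simp add: sum.distrib sum_distrib_left eq_neg_iff_add_eq_0)
qed

section \<open>The generating function of the M2-rank\<close>

text \<open>Integer indices with value 0 outside the natural range make the shifts of summation below uniform.\<close>

definition rest_coeff :: "int \<Rightarrow> int \<Rightarrow> 'a::comm_ring_1 fps" where
  "rest_coeff m e = (if m < 0 \<or> e < 0 then 0 else level_gf s_rest (nat m) $ nat e)"

lemma rest_coeff_nth: "rest_coeff m e $ N = of_nat (card {\<pi> \<in> overpartitions N. int (level \<pi>) \<le> m \<and> int (stat s_rest \<pi>) = e})"
proof (cases "m < 0 \<or> e < 0")
  case True
  then have "{\<pi> \<in> overpartitions N. int (level \<pi>) \<le> m \<and> int (stat s_rest \<pi>) = e} = {}" by auto
  then show ?thesis using True by (simp only: card.empty) (simp add: rest_coeff_def)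
next
  case False
  then have "{\<pi> \<in> overpartitions N. int (level \<pi>) \<le> m \<and> int (stat s_rest \<pi>) = e}
    = {\<pi> \<in> overpartitions N. level \<pi> \<le> nat m \<and> stat s_rest \<pi> = nat e}" by auto
  then show ?thesis using False by (simp add: rest_coeff_def level_gf_nth)
qed

lemma rest_coeff_shift: "(if s \<le> e then level_gf s_rest m $ (e - s) else 0) = rest_coeff (int m) (int e - int s)"
  by (auto simp: rest_coeff_def nat_diff_distrib')

lemma yk_nth: "(fps_X ^ s * qq ^ k * f) $ e = fps_X ^ k * (if s \<le> e then f $ (e - s) else 0)"
proof -
  have "(fps_X ^ s * qq ^ k * f) = fps_X ^ s * (fps_const (fps_X ^ k) * f)"
    by (simp only: qq_def fps_const_power mult.assoc)
  then show ?thesis by (simp only: fps_X_power_mult_nth fps_mult_left_const_nth) simp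
qed

lemma yk_nth_plain: "(fps_X ^ s * qq ^ k * level_gf s_rest m) $ e = fps_X ^ k * rest_coeff (int m) (int e - int s)"
  unfolding yk_nth rest_coeff_shift ..

lemma yk_nth_dil: "k = 2 * s + j \<Longrightarrow>
  (fps_X ^ s * qq ^ k * dil (level_gf s_rest m)) $ e = fps_X ^ (j + 2 * e) * rest_coeff (int m) (int e - int s)"
  unfolding yk_nth dil_nth rest_coeff_shift[symmetric]
proof (cases "s \<le> e")
  case True
  assume "k = 2 * s + j"
  then have "j + 2 * e = k + 2 * (e - s)" using True by simp
  then show "fps_X ^ k * (if s \<le> e then fps_X ^ (2 * (e - s)) * level_gf s_rest m $ (e - s) else 0)
      = fps_X ^ (j + 2 * e) * (if s \<le> e then level_gf s_rest m $ (e - s) else (0 :: 'a fps))"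
    using True by (simp only: if_True power_add mult.assoc)
qed simp

text \<open>The coefficient of $y^e$ in \<open>(1 + fps_X) * level_gf s_rest m\<close>. The
  certificates involve \<open>level_gf s_rest\<close> only through this multiple: its dilation
  explains their factor \<open>1 + qq ^ 2 * fps_X\<close>.\<close>

definition rest_pair :: "int \<Rightarrow> int \<Rightarrow> 'a::comm_ring_1 fps" where
  "rest_pair m e = rest_coeff m e + rest_coeff m (e - 1)"

text \<open>The coefficients of $(1 - q^2 y)(q y - 1)$, the inhomogeneous term of
  \<open>rest_certificate_0\<close>.\<close>

definition defect :: "int \<Rightarrow> int \<Rightarrow> 'a::comm_ring_1 fps" where
  "defect m e = (if m = 0 then (if e = 0 then - 1 else if e = 1 then fps_X + fps_X ^ 2 else if e = 2 then - (fps_X ^ 3) else 0) else 0)"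

lemma rest_pair_neg: "m < 0 \<or> e < 0 \<Longrightarrow> rest_pair m e = 0"
  by (auto simp: rest_pair_def rest_coeff_def)

lemma rest_pair_certificate_Suc:
  fixes m e :: nat
  shows "fps_X ^ (2 * Suc m + 1) * (rest_pair (int (Suc m)) (int e) - fps_X ^ 2 * rest_pair (int (Suc m)) (int e - 1))
   = fps_X ^ (2 * e) * (rest_pair (int (Suc m)) (int e) - rest_pair (int m) (int e))
     - fps_X ^ (2 * (Suc m + e)) * rest_pair (int (Suc m)) (int e - 1)
     + fps_X ^ (2 * (m + e)) * (rest_pair (int m) (int e - 2) :: 'a::field fps)"
proof -
  let ?F = "level_gf s_rest m :: 'a fps fps" and ?F' = "level_gf s_rest (Suc m) :: 'a fps fps"
  define k where "k = 2 * Suc m"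
  define M :: "'a fps fps" where "M = (qq ^ 2) ^ Suc m"
  have M: "M = qq ^ k" unfolding M_def k_def by (rule power_mult[symmetric])
  have "qq * (1 + y) * (1 - qq ^ 2 * y) * (M * F') = y ^ 0 * (qq ^ 1 * M) * F' + y ^ 1 * (qq ^ 1 * M) * F'
      - y ^ 1 * (qq ^ 3 * M) * F' - y ^ 2 * (qq ^ 3 * M) * F'" for y F' :: "'a fps fps"
    by (simp add: algebra_simps eval_nat_numeral)
  note 1 = this[of fps_X ?F']
  have "(1 + qq ^ 2 * y) * (G' - G - qq ^ 2 * y * M * (G' - y * G))
    = y ^ 0 * qq ^ 0 * G' + y ^ 1 * qq ^ 2 * G' - y ^ 0 * qq ^ 0 * G - y ^ 1 * qq ^ 2 * G
      - y ^ 1 * (qq ^ 2 * M) * G' - y ^ 2 * (qq ^ 4 * M) * G' + y ^ 2 * (qq ^ 2 * M) * G + y ^ 3 * (qq ^ 4 * M) * G"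
    for y G G' :: "'a fps fps"
    by (simp add: algebra_simps eval_nat_numeral)
  note 2 = this[of fps_X "dil ?F'" "dil ?F"]
  have d: "(fps_X ^ 0 * qq ^ 0 * dil (level_gf s_rest m)) $ e = fps_X ^ (2 * e) * (rest_coeff (int m) (int e) :: 'a fps)"
    "(fps_X ^ 1 * qq ^ 2 * dil (level_gf s_rest m)) $ e = fps_X ^ (2 * e) * (rest_coeff (int m) (int e - 1) :: 'a fps)"
    "(fps_X ^ 1 * qq ^ (2 + k) * dil (level_gf s_rest m)) $ e = fps_X ^ (k + 2 * e) * (rest_coeff (int m) (int e - 1) :: 'a fps)"
    "(fps_X ^ 2 * qq ^ (4 + k) * dil (level_gf s_rest m)) $ e = fps_X ^ (k + 2 * e) * (rest_coeff (int m) (int e - 2) :: 'a fps)" for m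
    using yk_nth_dil[of 0 0 0 m e, where 'a='a] yk_nth_dil[of 2 1 0 m e, where 'a='a]
      yk_nth_dil[of "2 + k" 1 k m e, where 'a='a] yk_nth_dil[of "4 + k" 2 k m e, where 'a='a] by simp_all
  have d': "(fps_X ^ 2 * qq ^ (4 + 2 * m) * dil (level_gf s_rest m)) $ e = fps_X ^ (2 * m + 2 * e) * (rest_coeff (int m) (int e - 2) :: 'a fps)"
    "(fps_X ^ 3 * qq ^ (6 + 2 * m) * dil (level_gf s_rest m)) $ e = fps_X ^ (2 * m + 2 * e) * (rest_coeff (int m) (int e - 3) :: 'a fps)"
    using yk_nth_dil[of "4 + 2 * m" 2 "2 * m" m e, where 'a='a] yk_nth_dil[of "6 + 2 * m" 3 "2 * m" m e, where 'a='a] by simp_all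
  have D: "y ^ 2 * (qq ^ 2 * M) * G = y ^ 2 * qq ^ (4 + 2 * m) * G" "y ^ 3 * (qq ^ 4 * M) * G = y ^ 3 * qq ^ (6 + 2 * m) * G"
    for y G :: "'a fps fps"
    unfolding M k_def by (simp_all add: power_add eval_nat_numeral)
  have "(fps_X ^ 0 * (qq ^ 1 * M) * ?F' + fps_X ^ 1 * (qq ^ 1 * M) * ?F'
      - fps_X ^ 1 * (qq ^ 3 * M) * ?F' - fps_X ^ 2 * (qq ^ 3 * M) * ?F') $ e
    = (fps_X ^ 0 * qq ^ 0 * dil ?F' + fps_X ^ 1 * qq ^ 2 * dil ?F' - fps_X ^ 0 * qq ^ 0 * dil ?F - fps_X ^ 1 * qq ^ 2 * dil ?F
      - fps_X ^ 1 * (qq ^ 2 * M) * dil ?F' - fps_X ^ 2 * (qq ^ 4 * M) * dil ?F' + fps_X ^ 2 * (qq ^ 2 * M) * dil ?F + fps_X ^ 3 * (qq ^ 4 * M) * dil ?F) $ e"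
    using rest_certificate_Suc[of m, where 'a='a] unfolding M_def[symmetric] 1 2 by simp
  then have "fps_X ^ (1 + k) * rest_coeff (Suc m) e + fps_X ^ (1 + k) * rest_coeff (Suc m) (int e - 1)
      - fps_X ^ (3 + k) * rest_coeff (Suc m) (int e - 1) - fps_X ^ (3 + k) * rest_coeff (Suc m) (int e - 2)
    = fps_X ^ (2 * e) * rest_coeff (Suc m) e + fps_X ^ (2 * e) * rest_coeff (Suc m) (int e - 1)
      - fps_X ^ (2 * e) * rest_coeff m e - fps_X ^ (2 * e) * rest_coeff m (int e - 1)
      - fps_X ^ (k + 2 * e) * rest_coeff (Suc m) (int e - 1) - fps_X ^ (k + 2 * e) * rest_coeff (Suc m) (int e - 2)
      + fps_X ^ (2 * m + 2 * e) * rest_coeff m (int e - 2) + fps_X ^ (2 * m + 2 * e) * (rest_coeff m (int e - 3) :: 'a fps)"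
    unfolding D unfolding M power_add[symmetric] fps_add_nth fps_sub_nth yk_nth_plain d d'
    by simp
  then show ?thesis unfolding rest_pair_def k_def by (simp add: algebra_simps power_add eval_nat_numeral)
qed

lemma rest_pair_certificate_0:
  fixes e :: nat
  shows "fps_X * (rest_pair 0 (int e) - fps_X ^ 2 * rest_pair 0 (int e - 1))
   = fps_X ^ (2 * e) * rest_pair 0 (int e) - fps_X ^ (2 * e) * rest_pair 0 (int e - 1) + (defect 0 (int e) :: 'a::field fps)"
proof -
  let ?F = "level_gf s_rest 0 :: 'a fps fps"
  have "qq * (1 + y) * (1 - qq ^ 2 * y) * F' = y ^ 0 * qq ^ 1 * F' + y ^ 1 * qq ^ 1 * F'
      - y ^ 1 * qq ^ 3 * F' - y ^ 2 * qq ^ 3 * F'" for y F' :: "'a fps fps"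
    by (simp add: algebra_simps eval_nat_numeral)
  note 1 = this[of fps_X ?F]
  have "(1 + qq ^ 2 * y) * (G - qq ^ 2 * y * G) + (1 - qq ^ 2 * y) * (qq * y - 1)
    = y ^ 0 * qq ^ 0 * G - y ^ 2 * qq ^ 4 * G + (y ^ 1 * qq ^ 1 * 1 + y ^ 1 * qq ^ 2 * 1 - y ^ 0 * qq ^ 0 * 1 - y ^ 2 * qq ^ 3 * 1)"
    for y G :: "'a fps fps"
    by (simp add: algebra_simps eval_nat_numeral)
  note 2 = this[of fps_X "dil ?F"]
  note E = rest_certificate_0[where 'a='a, unfolded 1 2]
  have "(fps_X ^ 1 * qq ^ 1 * 1 + fps_X ^ 1 * qq ^ 2 * 1 - fps_X ^ 0 * qq ^ 0 * 1 - fps_X ^ 2 * qq ^ 3 * 1) $ e = (defect 0 (int e) :: 'a fps)"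
    unfolding fps_add_nth fps_sub_nth yk_nth by (auto simp: defect_def)
  note defect = this[unfolded fps_add_nth fps_sub_nth]
  have d: "(fps_X ^ 0 * qq ^ 0 * dil ?F) $ e = fps_X ^ (2 * e) * (rest_coeff 0 (int e) :: 'a fps)"
    "(fps_X ^ 2 * qq ^ 4 * dil ?F) $ e = fps_X ^ (2 * e) * (rest_coeff 0 (int e - 2) :: 'a fps)"
    using yk_nth_dil[of 0 0 0 0 e, where 'a='a] yk_nth_dil[of 4 2 0 0 e, where 'a='a] by simp_all
  have "fps_X * rest_coeff 0 e + fps_X * rest_coeff 0 (int e - 1) - fps_X ^ 3 * rest_coeff 0 (int e - 1) - fps_X ^ 3 * rest_coeff 0 (int e - 2)
    = fps_X ^ (2 * e) * rest_coeff 0 e - fps_X ^ (2 * e) * rest_coeff 0 (int e - 2) + (defect 0 (int e) :: 'a fps)"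
    using arg_cong[OF E, of "\<lambda>f. f $ e"] unfolding fps_add_nth fps_sub_nth defect d yk_nth_plain by simp
  then show ?thesis unfolding rest_pair_def by (simp add: algebra_simps eval_nat_numeral)
qed

text \<open>By \<open>ab\<close>, \<open>k\<close> is the minimum of $m = k + a$ and $e = k + b$.
  Dividing out $q^{2k}$ leaves coefficients that depend on \<open>a\<close> and \<open>b\<close>
  only, apart from the telescoping \<open>V\<close>, so the identity can be summed along the
  diagonal.\<close>

lemma rest_pair_certificate:
  fixes k :: int and a b :: nat
  defines "V \<equiv> \<lambda>k. fps_X ^ (2 * nat (k + int a + int b)) * (rest_pair (k + int a) (k + int b - 1) :: 'a::field fps)"
  assumes ab: "a = 0 \<or> b = 0"
  shows "fps_X ^ (2 * a + 1) * (rest_pair (k + int a) (k + int b) - fps_X ^ 2 * rest_pair (k + int a) (k + int b - 1))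
    = fps_X ^ (2 * b) * (rest_pair (k + int a) (k + int b) - rest_pair (k + int a - 1) (k + int b))
      - (V k - V (k - 1)) + defect (k + int a) (k + int b)"
proof (cases "k < 0")
  case True
  then have "defect (k + int a) (k + int b) = (0 :: 'a fps)" using ab by (auto simp: defect_def)
  then show ?thesis using True ab unfolding V_def by (auto simp: rest_pair_neg)
next
  case False
  then obtain c where k: "k = int c" using nat_0_le[of k] by (metis not_less)
  have gen: "C * (x - y) = B * (z - w) - (D * u - E * v) + 0"
    if "fps_X ^ (2 * c) * C * (x - y) = fps_X ^ (2 * c) * B * (z - w) - fps_X ^ (2 * c) * D * u + fps_X ^ (2 * c) * E * v"
    for B C D E x y z w u v :: "'a fps"
  proof -
    have "fps_X ^ (2 * c) * (C * (x - y)) = fps_X ^ (2 * c) * (B * (z - w) - (D * u - E * v) + 0)"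
      using that by (simp add: algebra_simps)
    then show ?thesis by (simp only: mult_cancel_left) simp
  qed
  have ints: "int c + int a = int (c + a)" "int c + int b = int (c + b)" by simp_all
  show ?thesis
  proof (cases "c + a")
    case 0
    then have [simp]: "c = 0" "a = 0" by simp_all
    show ?thesis using rest_pair_certificate_0[of b, where 'a='a]
      unfolding k V_def by (simp add: rest_pair_neg algebra_simps)
  next
    case (Suc m)
    have dl0: "defect (int (c + a)) (int (c + b)) = (0 :: 'a fps)" unfolding defect_def using Suc by simp
    have n: "nat (int c + int a + int b) = c + a + b" "nat (int c - 1 + int a + int b) = m + b"
      and n': "int (c + a) - 1 = int m" "int c - 1 + int a = int m" "int c - 1 + int b - 1 = int (c + b) - 2"
      using Suc by simp_all
    have e: "2 * (c + a) + 1 = 2 * c + (2 * a + 1)" "2 * (c + a + (c + b)) = 2 * c + 2 * (c + a + b)"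
      "2 * (m + (c + b)) = 2 * c + 2 * (m + b)" "2 * (c + b) = 2 * c + 2 * b"
      by simp_all
    show ?thesis
      using rest_pair_certificate_Suc[of m "c + b", where 'a='a] unfolding Suc[symmetric] unfolding e power_add[of _ "2 * c"]
      unfolding k V_def n unfolding ints n' unfolding dl0
      by (rule gen)
  qed
qed

section \<open>A recurrence for the cumulative rank generating functions\<close>

definition rank_gf :: "int \<Rightarrow> 'a::comm_ring_1 fps" where
  "rank_gf j = Abs_fps (\<lambda>N. of_nat (card {\<pi> \<in> overpartitions N. M2_rank \<pi> \<le> j}))"

definition over_gf :: "'a::comm_ring_1 fps" where
  "over_gf = Abs_fps (\<lambda>N. of_nat (card (overpartitions N)))"

text \<open>The sum of \<open>rest_pair\<close> along the diagonal $m - e = j$; the second summand,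
  with \<open>e - 1\<close>, lies on the diagonal $j + 1$.\<close>

definition rank2_gf :: "int \<Rightarrow> 'a::comm_ring_1 fps" where "rank2_gf j = rank_gf j + rank_gf (j + 1)"

lemma bij_add_int: "bij_betw (\<lambda>k. k + t :: int) UNIV UNIV"
  by (rule bij_betw_byWitness[of _ "\<lambda>k. k - t"]) auto

lemma locfin_rest_coeff: "locfin (\<lambda>k. rest_coeff (k + s) (k + t) :: 'a::comm_ring_1 fps) UNIV"
  unfolding locfin_def
proof
  fix N
  show "finite {k \<in> UNIV. rest_coeff (k + s) (k + t) $ N \<noteq> (0 :: 'a)}"
  proof (rule finite_subset)
    show "{k \<in> UNIV. rest_coeff (k + s) (k + t) $ N \<noteq> (0 :: 'a)} \<subseteq> {- t..int N - t}"
    proof (intro subsetI)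
      fix k assume "k \<in> {k \<in> UNIV. rest_coeff (k + s) (k + t) $ N \<noteq> (0 :: 'a)}"
      then have "{\<pi> \<in> overpartitions N. int (level \<pi>) \<le> k + s \<and> int (stat s_rest \<pi>) = k + t} \<noteq> {}"
        by (auto simp: rest_coeff_nth simp del: Collect_empty_eq)
      then obtain \<pi> where "\<pi> \<in> overpartitions N" "int (stat s_rest \<pi>) = k + t" by blast
      then show "k \<in> {- t..int N - t}" using stat_le(4)[of \<pi> N] by auto
    qed
  qed simp
qed

text \<open>The rank is \<open>level\<close> minus \<open>stat s_rest\<close>, so bounding the level
  by \<open>e + j\<close> bounds the rank by \<open>j\<close>.\<close>

lemma fsum_rest_coeff_0: "fsum (\<lambda>e. rest_coeff (e + j) e) UNIV = rank_gf j"
proof (rule fps_ext)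
  fix N
  let ?A = "\<lambda>e. {\<pi> \<in> overpartitions N. int (level \<pi>) \<le> e + j \<and> int (stat s_rest \<pi>) = e}"
  let ?E = "(\<lambda>\<pi>. int (stat s_rest \<pi>)) ` overpartitions N"
  have "fsum (\<lambda>e. rest_coeff (e + j) e) UNIV $ N = (\<Sum>e\<in>?E. rest_coeff (e + j) e $ N :: 'a)"
  proof (rule fsum_nth)
    fix e assume "e \<in> UNIV - ?E"
    then have "?A e = {}" by auto
    then show "rest_coeff (e + j) e $ N = (0 :: 'a)" unfolding rest_coeff_nth by (simp only: card.empty of_nat_0)
  qed (simp_all add: finite_overpartitions)
  also have "\<dots> = of_nat (\<Sum>e\<in>?E. card (?A e))" by (simp add: rest_coeff_nth)
  also have "(\<Sum>e\<in>?E. card (?A e)) = card (\<Union>e\<in>?E. ?A e)"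
    by (rule card_UN_disjoint[symmetric]) (auto simp: finite_overpartitions)
  also have "(\<Union>e\<in>?E. ?A e) = {\<pi> \<in> overpartitions N. M2_rank \<pi> \<le> j}"
    by (auto simp: M2_rank_level)
  finally show "fsum (\<lambda>e. rest_coeff (e + j) e) UNIV $ N = (rank_gf j $ N :: 'a)" by (simp add: rank_gf_def)
qed

lemma fsum_rest_coeff: "fsum (\<lambda>k. rest_coeff (k + s) (k + t)) UNIV = (rank_gf (s - t) :: 'a::comm_ring_1 fps)"
proof -
  have "(rank_gf (s - t) :: 'a fps) = fsum (\<lambda>e. rest_coeff (e + (s - t)) e) UNIV" by (rule fsum_rest_coeff_0[symmetric])
  also have "\<dots> = fsum (\<lambda>k. rest_coeff (k + t + (s - t)) (k + t)) UNIV"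
    by (rule fsum_reindex[OF bij_add_int])
  finally show ?thesis by (simp add: algebra_simps)
qed

lemma locfin_rest_pair: "locfin (\<lambda>k. rest_pair (k + s) (k + t) :: 'a::comm_ring_1 fps) UNIV"
  unfolding rest_pair_def add_diff_eq[symmetric] by (intro locfin_add locfin_rest_coeff)

lemma fsum_rest_pair: "fsum (\<lambda>k. rest_pair (k + s) (k + t)) UNIV = rank2_gf (s - t)"
proof -
  have "fsum (\<lambda>k. rest_pair (k + s) (k + t)) UNIV = rank_gf (s - t) + rank_gf (s - (t - 1))"
    unfolding rest_pair_def add_diff_eq[symmetric] fsum_rest_coeff[symmetric]
    by (rule fsum_add) (rule locfin_rest_coeff)+
  then show ?thesis by (simp add: rank2_gf_def algebra_simps)
qed

text \<open>\<open>rest_pair_certificate\<close> summed over all integers \<open>k\<close>. Since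
  \<open>V\<close> is locally finite, its differences sum to 0 without a boundary term.\<close>

lemma rank2_gf_rel:
  fixes a b :: nat
  assumes ab: "a = 0 \<or> b = 0"
  defines "j \<equiv> int a - int b"
  shows "fps_X ^ (2 * a + 1) * (rank2_gf j - fps_X ^ 2 * rank2_gf (j + 1)) = fps_X ^ (2 * b) * (rank2_gf j - rank2_gf (j - 1)) + (defect 0 (- j) :: 'a::field fps)"
proof -
  define V :: "int \<Rightarrow> 'a fps" where "V k = fps_X ^ (2 * nat (k + int a + int b)) * rest_pair (k + int a) (k + int b - 1)" for k
  let ?T = "\<lambda>s t k. rest_pair (k + s) (k + t) :: 'a fps"
  let ?a = "int a" and ?b = "int b"
  have LV: "locfin V UNIV" unfolding V_def add_diff_eq[symmetric] by (intro locfin_mult locfin_rest_pair)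
  have LV': "locfin (\<lambda>k. V (k - 1)) UNIV"
    using locfin_reindex[OF LV bij_add_int[of "- 1"]] by simp
  have SV: "fsum (\<lambda>k. V (k - 1)) UNIV = fsum V UNIV"
    using fsum_reindex[OF bij_add_int[of "- 1"], of V] by simp
  have Ld: "locfin (\<lambda>k. defect (k + ?a) (k + ?b) :: 'a fps) UNIV"
    unfolding locfin_def
  proof
    fix n show "finite {k \<in> UNIV. defect (k + ?a) (k + ?b) $ n \<noteq> (0 :: 'a)}"
      by (rule finite_subset[of _ "{- ?a}"]) (auto simp: defect_def split: if_splits)
  qed
  have Sd: "fsum (\<lambda>k. defect (k + ?a) (k + ?b) :: 'a fps) UNIV = defect 0 (- j)"
  proof (rule fps_ext)
    fix n
    have "fsum (\<lambda>k. defect (k + ?a) (k + ?b) :: 'a fps) UNIV $ n = (\<Sum>k\<in>{- ?a}. defect (k + ?a) (k + ?b) $ n)"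
      by (rule fsum_nth) (auto simp: defect_def)
    then show "fsum (\<lambda>k. defect (k + ?a) (k + ?b) :: 'a fps) UNIV $ n = defect 0 (- j) $ n" by (simp add: j_def)
  qed
  let ?L = "\<lambda>k. fps_X ^ (2 * a + 1) * (?T ?a ?b k - fps_X ^ 2 * ?T ?a (?b - 1) k)"
  let ?R = "\<lambda>k. fps_X ^ (2 * b) * (?T ?a ?b k - ?T (?a - 1) ?b k)"
  have L: "fsum ?L UNIV = fps_X ^ (2 * a + 1) * (rank2_gf j - fps_X ^ 2 * rank2_gf (j + 1))"
  proof -
    have "fsum ?L UNIV = fps_X ^ (2 * a + 1) * fsum (\<lambda>k. ?T ?a ?b k - fps_X ^ 2 * ?T ?a (?b - 1) k) UNIV"
      by (rule fsum_mult) (intro locfin_diff locfin_mult locfin_rest_pair)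
    also have "fsum (\<lambda>k. ?T ?a ?b k - fps_X ^ 2 * ?T ?a (?b - 1) k) UNIV = fsum (?T ?a ?b) UNIV - fsum (\<lambda>k. fps_X ^ 2 * ?T ?a (?b - 1) k) UNIV"
      by (rule fsum_diff) (intro locfin_mult locfin_rest_pair)+
    also have "fsum (\<lambda>k. fps_X ^ 2 * ?T ?a (?b - 1) k) UNIV = fps_X ^ 2 * fsum (?T ?a (?b - 1)) UNIV"
      by (rule fsum_mult) (rule locfin_rest_pair)
    finally show ?thesis unfolding fsum_rest_pair j_def by (simp add: algebra_simps)
  qed
  have R: "fsum ?R UNIV = fps_X ^ (2 * b) * (rank2_gf j - rank2_gf (j - 1))"
  proof -
    have "fsum ?R UNIV = fps_X ^ (2 * b) * fsum (\<lambda>k. ?T ?a ?b k - ?T (?a - 1) ?b k) UNIV"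
      by (rule fsum_mult) (intro locfin_diff locfin_rest_pair)
    also have "fsum (\<lambda>k. ?T ?a ?b k - ?T (?a - 1) ?b k) UNIV = fsum (?T ?a ?b) UNIV - fsum (?T (?a - 1) ?b) UNIV"
      by (rule fsum_diff) (rule locfin_rest_pair)+
    finally show ?thesis unfolding fsum_rest_pair j_def by (simp add: algebra_simps)
  qed
  have "fsum ?L UNIV = fsum (\<lambda>k. ?R k - (V k - V (k - 1)) + defect (k + ?a) (k + ?b)) UNIV"
    by (rule fsum_cong) (use rest_pair_certificate[OF ab, where 'a='a] in \<open>simp add: V_def add_diff_eq\<close>)
  also have "\<dots> = fsum (\<lambda>k. ?R k - (V k - V (k - 1))) UNIV + defect 0 (- j)"
    unfolding Sd[symmetric] by (rule fsum_add) (intro locfin_diff locfin_mult locfin_rest_pair LV LV' Ld)+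
  also have "fsum (\<lambda>k. ?R k - (V k - V (k - 1))) UNIV = fsum ?R UNIV - fsum (\<lambda>k. V k - V (k - 1)) UNIV"
    by (rule fsum_diff) (intro locfin_diff locfin_mult locfin_rest_pair LV LV')+
  also have "fsum (\<lambda>k. V k - V (k - 1)) UNIV = 0"
    using fsum_diff[OF LV LV'] SV by simp
  finally show ?thesis unfolding L R by simp
qed

lemma rank2_gf_large:
  assumes "int N \<le> j" shows "rank2_gf j $ N = 2 * over_gf $ N"
proof -
  have "{\<pi> \<in> overpartitions N. M2_rank \<pi> \<le> i} = overpartitions N" if "int N \<le> i" for i
    using that stat_le(2)[of _ N] by (fastforce simp: M2_rank_level)
  then show ?thesis using assms unfolding rank2_gf_def rank_gf_def over_gf_def fps_add_nth fps_nth_Abs_fps by simp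
qed

text \<open>By \<open>rank2_gf_rel\<close> with \<open>b = 0\<close> the left-hand side does not
  depend on \<open>j\<close>; in any fixed degree it can be evaluated at a large \<open>j\<close>,
  where the rank condition is always met.\<close>

lemma rank2_gf_pos:
  fixes j :: nat
  assumes "0 < j"
  shows "fps_X ^ (2 * j + 1) * rank2_gf (int j) + rank2_gf (int j - 1) = (2 * over_gf :: 'a::field fps)"
proof -
  define U where "U j = fps_X ^ (2 * j + 1) * rank2_gf (int j) + (rank2_gf (int j - 1) :: 'a fps)" for j
  have step: "U i = U (Suc i)" if "0 < i" for i
  proof -
    have d: "defect 0 (- int i) = (0 :: 'a fps)" using that by (simp add: defect_def)
    have "U i - U (Suc i) = fps_X ^ (2 * i + 1) * (rank2_gf (int i) - fps_X ^ 2 * rank2_gf (int i + 1)) - (rank2_gf (int i) - rank2_gf (int i - 1))"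
      unfolding U_def by (simp add: algebra_simps power2_eq_square)
    also have "\<dots> = 0" using rank2_gf_rel[of i 0, where 'a='a] d by simp
    finally show ?thesis by simp
  qed
  have const: "U (j + n) = U j" for n
    using assms by (induction n) (simp_all add: step[symmetric])
  show ?thesis
  proof (rule fps_ext)
    fix N
    have "U j $ N = U (j + Suc N) $ N" by (simp only: const)
    also have "\<dots> = rank2_gf (int (j + Suc N) - 1) $ N"
      unfolding U_def fps_add_nth fps_X_power_mult_nth by simp
    also have "\<dots> = 2 * over_gf $ N" by (rule rank2_gf_large) simp
    finally show "(fps_X ^ (2 * j + 1) * rank2_gf (int j) + rank2_gf (int j - 1)) $ N = (2 * over_gf :: 'a fps) $ N"
      by (simp add: U_def numeral_fps_const)
  qed
qed

lemma rank2_gf_0: "fps_X * rank2_gf 0 + rank2_gf (- 1) = (2 * over_gf - 1 :: 'a::field fps)"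
proof -
  have "fps_X * (rank2_gf 0 - fps_X ^ 2 * rank2_gf 1) = rank2_gf 0 - rank2_gf (- 1) + (- 1 :: 'a fps)"
    using rank2_gf_rel[of 0 0, where 'a='a] by (simp add: defect_def)
  moreover have "fps_X ^ 3 * rank2_gf 1 + rank2_gf 0 = (2 * over_gf :: 'a fps)"
    using rank2_gf_pos[of 1, where 'a='a] by (simp add: numeral_3_eq_3)
  ultimately show ?thesis by (simp add: algebra_simps eval_nat_numeral)
qed

text \<open>With \<open>a = 0\<close> the left-hand side \<open>E\<close> satisfies $E_{i+1} = q^2
  E_i$ plus a defect, starting from $2P - 1$. The defect $q + q^2$ at the first step absorbs $-q^2$
  and leaves $q$, which $-q^3$ cancels at the next step.\<close>

lemma rank2_gf_neg:
  fixes i :: nat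
  assumes "0 < i"
  shows "fps_X * rank2_gf (- int i) + fps_X ^ (2 * i) * rank2_gf (- int i - 1)
    = (2 * fps_X ^ (2 * i) * over_gf + (if i = 1 then fps_X else 0) :: 'a::field fps)"
proof -
  define E where "E i = fps_X * rank2_gf (- int i) + fps_X ^ (2 * i) * (rank2_gf (- int i - 1) :: 'a fps)" for i
  have step: "E (Suc i) = fps_X ^ 2 * E i + defect 0 (int (Suc i))" for i
  proof -
    have gen: "x * s1 + y * q * s2 = y * (x * s0 + q * s1) + d" if "x * (s1 - y * s0) = y * q * (s1 - s2) + d"
      for x y q s0 s1 s2 d :: "'a fps"
      using that by (simp add: algebra_simps)
    have e: "- (int 0 - int (Suc i)) = int (Suc i)" "int 0 - int (Suc i) + 1 = - int i"
      "int 0 - int (Suc i) = - int (Suc i)" "- int i - 1 = - int (Suc i)" "2 * 0 + 1 = (1::nat)" by simp_all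
    have X: "fps_X ^ (2 * Suc i) = fps_X ^ 2 * (fps_X ^ (2 * i) :: 'a fps)" unfolding power_add[symmetric] by simp
    have "fps_X * (rank2_gf (- int (Suc i)) - fps_X ^ 2 * rank2_gf (- int i))
      = fps_X ^ 2 * fps_X ^ (2 * i) * (rank2_gf (- int (Suc i)) - rank2_gf (- int (Suc i) - 1)) + (defect 0 (int (Suc i)) :: 'a fps)"
      using rank2_gf_rel[of 0 "Suc i", where 'a='a] unfolding e(1,2) unfolding e X power_one_right by blast
    then show ?thesis unfolding E_def X e(4) by (rule gen)
  qed
  have E0: "E 0 = 2 * over_gf - 1" unfolding E_def using rank2_gf_0[where 'a='a] by simp
  have "E (Suc i) = 2 * fps_X ^ (2 * Suc i) * over_gf + (if i = 0 then fps_X else 0)" for i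
  proof (induction i)
    case 0
    then show ?case unfolding step[of 0] E0 by (simp add: defect_def algebra_simps power2_eq_square)
  next
    case (Suc i)
    then show ?case unfolding step[of "Suc i"] by (auto simp: defect_def algebra_simps eval_nat_numeral)
  qed
  from this[of "i - 1"] show ?thesis using assms by (simp add: E_def)
qed

section \<open>Solution of the recurrence by partial theta functions\<close>

definition ptheta_term :: "nat \<Rightarrow> nat \<Rightarrow> 'a::comm_ring_1 fps" where
  "ptheta_term j n = - alt_sign (int (Suc n)) * fps_X ^ (Suc n * Suc n + 2 * Suc n * j)"

definition ptheta :: "nat \<Rightarrow> 'a::comm_ring_1 fps" where "ptheta j = fsum (ptheta_term j) UNIV"

lemma locfin_pairs_le: "finite {p \<in> UNIV. (case p of (n, d) \<Rightarrow> Suc n * Suc n + 2 * Suc n * d) \<le> (k::nat)}"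
  by (rule finite_subset[of _ "{..k} \<times> {..k}"]) auto

lemma locfin_ptheta_term_pairs: "locfin (\<lambda>(n, d). c n d * ptheta_term d n :: 'a::comm_ring_1 fps) (UNIV \<times> UNIV)"
proof -
  have "locfin (\<lambda>p. fps_X ^ (case p of (n, d) \<Rightarrow> Suc n * Suc n + 2 * Suc n * d)
      * (case p of (n, d) \<Rightarrow> - alt_sign (int (Suc n)) * c n d) :: 'a fps) UNIV"
    by (rule locfin_X_power) (rule locfin_pairs_le)
  then show ?thesis by (simp add: ptheta_term_def case_prod_beta' mult_ac)
qed

lemma locfin_ptheta_term: "locfin (ptheta_term j :: nat \<Rightarrow> 'a::comm_ring_1 fps) UNIV"
proof -
  have "locfin (\<lambda>n. fps_X ^ (Suc n * Suc n + 2 * Suc n * j) * - alt_sign (int (Suc n)) :: 'a fps) UNIV"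
  proof (rule locfin_X_power)
    fix k show "finite {n \<in> UNIV. Suc n * Suc n + 2 * Suc n * j \<le> k}"
      by (rule finite_subset[of _ "{..k}"]) auto
  qed
  then show ?thesis by (simp add: ptheta_term_def[abs_def] mult.commute)
qed

text \<open>The first term is split off, and $(n+1)^2 + 2(n+1)j = (2j+1) + n^2 + 2n(j+1)$ identifies
  the rest.\<close>

lemma ptheta_rec: "ptheta j = fps_X ^ (2 * j + 1) * (1 - ptheta (Suc j) :: 'a::comm_ring_1 fps)"
proof -
  have "ptheta j = ptheta_term j 0 + fsum (\<lambda>n. ptheta_term j (Suc n) :: 'a fps) UNIV"
    unfolding ptheta_def by (rule fsum_nat_Suc) (rule locfin_ptheta_term)
  also have "fsum (\<lambda>n. ptheta_term j (Suc n) :: 'a fps) UNIV = fsum (\<lambda>n. - (fps_X ^ (2 * j + 1)) * ptheta_term (Suc j) n) UNIV"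
  proof (rule fsum_cong)
    fix n
    have "Suc (Suc n) * Suc (Suc n) + 2 * Suc (Suc n) * j = (2 * j + 1) + (Suc n * Suc n + 2 * Suc n * Suc j)"
      by (simp add: algebra_simps)
    then have "fps_X ^ (Suc (Suc n) * Suc (Suc n) + 2 * Suc (Suc n) * j)
      = fps_X ^ (2 * j + 1) * (fps_X ^ (Suc n * Suc n + 2 * Suc n * Suc j) :: 'a fps)"
      by (simp only: power_add)
    moreover have "alt_sign (int (Suc (Suc n))) = - (alt_sign (int (Suc n)) :: 'a fps)" by (simp add: alt_sign_def)
    ultimately show "ptheta_term j (Suc n) = - (fps_X ^ (2 * j + 1)) * (ptheta_term (Suc j) n :: 'a fps)"
      unfolding ptheta_term_def by (simp only: minus_mult_minus minus_mult_left[symmetric] minus_mult_right[symmetric] mult_ac minus_minus)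
  qed
  also have "\<dots> = - (fps_X ^ (2 * j + 1)) * ptheta (Suc j)"
    unfolding ptheta_def by (rule fsum_mult) (rule locfin_ptheta_term)
  also have "ptheta_term j 0 = (fps_X ^ (2 * j + 1) :: 'a fps)" by (simp add: ptheta_term_def alt_sign_def)
  finally show ?thesis by (simp add: algebra_simps)
qed

text \<open>Each use of the recurrence lowers the degree in question by \<open>2 * j + 1\<close>, so
  any discrepancy is pushed out of every fixed degree.\<close>

lemma rec_unique:
  fixes f g :: "nat \<Rightarrow> 'a::comm_ring_1 fps"
  assumes f: "\<And>j. 0 < j \<Longrightarrow> f j = fps_X ^ (2 * j + 1) * (p - f (Suc j))"
    and g: "\<And>j. 0 < j \<Longrightarrow> g j = fps_X ^ (2 * j + 1) * (p - g (Suc j))"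
    and j: "0 < j"
  shows "f j = g j"
proof (rule fps_ext)
  fix N
  show "f j $ N = g j $ N" using j
  proof (induction N arbitrary: j rule: less_induct)
    case (less N)
    have "(p - f (Suc j)) $ (N - (2 * j + 1)) = (p - g (Suc j)) $ (N - (2 * j + 1))" if "2 * j + 1 \<le> N"
      using less.IH[of "N - (2 * j + 1)" "Suc j"] that by simp
    then show ?case unfolding f[OF less.prems] g[OF less.prems] fps_X_power_mult_nth by simp
  qed
qed

text \<open>The left-hand side counts the overpartitions of rank at least \<open>j\<close> together
  with those of rank at least \<open>j + 1\<close>.\<close>

lemma rank_ge_gf:
  assumes "0 < j"
  shows "2 * over_gf - rank2_gf (int j - 1) = 2 * over_gf * (ptheta j :: 'a::field fps)"
proof (rule rec_unique[OF _ _ assms, of "\<lambda>j. 2 * over_gf - rank2_gf (int j - 1)" "2 * over_gf" "\<lambda>j. 2 * over_gf * ptheta j"])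
  fix j :: nat assume "0 < j"
  then show "2 * over_gf - rank2_gf (int j - 1) = fps_X ^ (2 * j + 1) * (2 * over_gf - (2 * over_gf - rank2_gf (int (Suc j) - 1)) :: 'a fps)"
    using rank2_gf_pos[of j, where 'a='a] by (simp add: algebra_simps)
  show "2 * over_gf * ptheta j = fps_X ^ (2 * j + 1) * (2 * over_gf - 2 * over_gf * ptheta (Suc j) :: 'a fps)"
    by (subst ptheta_rec) (simp add: algebra_simps)
qed

text \<open>The mirror image of \<open>rank_ge_gf\<close> for ranks at most \<open>- j\<close>.
  \<open>rank2_gf_neg\<close> is used at \<open>j + 1\<close>, past its exceptional term.\<close>

lemma rank_le_gf:
  assumes "0 < j"
  shows "rank2_gf (- int j - 1) = 2 * over_gf * (ptheta j :: 'a::field fps)"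
proof (rule rec_unique[OF _ _ assms, of "\<lambda>j. rank2_gf (- int j - 1)" "2 * over_gf" "\<lambda>j. 2 * over_gf * ptheta j"])
  fix j :: nat assume "0 < j"
  have i: "- int (Suc j) = - int j - 1" by simp
  have X: "fps_X ^ (2 * Suc j) = fps_X * (fps_X ^ (2 * j + 1) :: 'a fps)" by simp
  have "fps_X * rank2_gf (- int (Suc j)) + fps_X * fps_X ^ (2 * j + 1) * rank2_gf (- int (Suc j) - 1)
    = (2 * (fps_X * fps_X ^ (2 * j + 1)) * over_gf :: 'a fps)"
    using rank2_gf_neg[of "Suc j", where 'a='a] \<open>0 < j\<close> unfolding X by simp
  then have "fps_X * rank2_gf (- int j - 1) = fps_X * (fps_X ^ (2 * j + 1) * (2 * over_gf - rank2_gf (- int (Suc j) - 1)) :: 'a fps)"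
    unfolding i by (simp only: right_diff_distrib eq_diff_eq mult_ac)
  then show "rank2_gf (- int j - 1) = fps_X ^ (2 * j + 1) * (2 * over_gf - rank2_gf (- int (Suc j) - 1) :: 'a fps)"
    by (simp only: mult_cancel_left) simp
  show "2 * over_gf * ptheta j = fps_X ^ (2 * j + 1) * (2 * over_gf - 2 * over_gf * ptheta (Suc j) :: 'a fps)"
    by (subst ptheta_rec) (simp add: algebra_simps)
qed

lemma theta_0_ptheta: "theta 0 = (1 - 2 * ptheta 0 :: 'a::char5_field fps)"
proof -
  have "theta 0 = fsum (gauss :: int \<Rightarrow> 'a fps) (insert 0 (UNIV - {0}))"
    unfolding theta_def by (simp add: insert_absorb)
  also have "\<dots> = gauss 0 + fsum gauss (UNIV - {0})"
    by (rule fsum_insert) (auto intro: locfin_gauss')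
  also have "fsum gauss (UNIV - {0}) = 2 * fsum (\<lambda>n. gauss (int (Suc n)) :: 'a fps) UNIV"
    by (rule fsum_even[OF locfin_gauss']) simp
  also have "fsum (\<lambda>n. gauss (int (Suc n)) :: 'a fps) UNIV = fsum (\<lambda>n. - ptheta_term 0 n) UNIV"
  proof (rule fsum_cong)
    fix n
    have "nat ((int (Suc n))\<^sup>2) = Suc n * Suc n" by (simp only: power2_eq_square of_nat_mult[symmetric] nat_int)
    then show "gauss (int (Suc n)) = - (ptheta_term 0 n :: 'a fps)" unfolding gauss_def ptheta_term_def by simp
  qed
  also have "\<dots> = - ptheta 0" unfolding ptheta_def by (rule fsum_uminus) (rule locfin_ptheta_term)
  finally show ?thesis by (simp add: gauss_def)
qed

text \<open>The recurrence is overdetermined near rank 0. The values at 0 and -2 are known from both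
  solved branches, \<open>rank2_gf_neg\<close> gives the value at -1, and \<open>rank2_gf_0\<close>
  is a further relation among them; consistency determines $P$.\<close>

lemma over_gf_theta: "over_gf * theta 0 = (1 :: 'a::char5_field fps)"
proof -
  have "2 * over_gf - rank2_gf 0 = 2 * over_gf * (ptheta 1 :: 'a fps)" using rank_ge_gf[of 1, where 'a='a] by simp
  then have 1: "rank2_gf 0 = 2 * over_gf - 2 * over_gf * (ptheta 1 :: 'a fps)" by (simp only: diff_eq_eq eq_diff_eq add.commute)
  have 2: "rank2_gf (- 2) = 2 * over_gf * (ptheta 1 :: 'a fps)" using rank_le_gf[of 1, where 'a='a] by simp
  have X0: "ptheta 0 = fps_X * (1 - ptheta 1 :: 'a fps)" using ptheta_rec[of 0, where 'a='a] by simp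
  have 3: "fps_X * rank2_gf (- 1) + fps_X ^ 2 * rank2_gf (- 2) = (2 * fps_X ^ 2 * over_gf + fps_X :: 'a fps)"
    using rank2_gf_neg[of 1, where 'a='a] by simp
  have "fps_X * rank2_gf (- 1) = fps_X * (2 * over_gf * ptheta 0 + 1 :: 'a fps)"
    using 3 unfolding 2 X0 by (simp add: algebra_simps power2_eq_square)
  then have "rank2_gf (- 1) = (2 * over_gf * ptheta 0 + 1 :: 'a fps)" by (simp only: mult_cancel_left) simp
  moreover have "fps_X * (2 * over_gf - 2 * over_gf * ptheta 1) = 2 * over_gf * (ptheta 0 :: 'a fps)"
    unfolding X0 by (simp add: algebra_simps)
  moreover have "fps_X * (2 * over_gf - 2 * over_gf * ptheta 1) + rank2_gf (- 1) = (2 * over_gf - 1 :: 'a fps)"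
    using rank2_gf_0[where 'a='a] unfolding 1 .
  ultimately have "2 * over_gf * ptheta 0 + (2 * over_gf * ptheta 0 + 1) = (2 * over_gf - 1 :: 'a fps)" by simp
  then have "2 * (over_gf * (1 - 2 * ptheta 0)) = (2 * 1 :: 'a fps)" by (simp add: algebra_simps)
  moreover have "(2 :: 'a fps) \<noteq> 0"
    using two_neq_0[where 'a='a] by (simp add: numeral_fps_const)
  ultimately show ?thesis unfolding theta_0_ptheta by (simp only: mult_cancel_left) simp
qed

section \<open>The second moment of the rank and the series $M$\<close>

lemma locfin_ptheta: "locfin (\<lambda>j. of_nat j * ptheta j :: 'a::comm_ring_1 fps) UNIV"
proof -
  have "locfin (\<lambda>j. fps_X ^ (2 * j + 1) * (of_nat j * (1 - ptheta (Suc j))) :: 'a fps) UNIV"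
  proof (rule locfin_X_power)
    fix k :: nat
    show "finite {j :: nat \<in> UNIV. 2 * j + 1 \<le> k}" by (rule finite_subset[of _ "{..k}"]) auto
  qed
  moreover have "of_nat j * ptheta j = fps_X ^ (2 * j + 1) * (of_nat j * (1 - ptheta (Suc j)) :: 'a fps)" for j
    unfolding ptheta_rec[of j] by (rule mult.left_commute)
  ultimately show ?thesis by simp
qed

text \<open>Expand $q^{2n}/(1 - q^{2n})^2$ as the sum of $d q^{2nd}$ and exchange the sums over
  \<open>n\<close> and \<open>d\<close>.\<close>

lemma bmom_0_ptheta: "bmom 0 = - 2 * fsum (\<lambda>j. of_nat j * ptheta j :: 'a::char5_field fps) UNIV"
proof -
  have "bmom 0 = fsum (\<lambda>n. gauss n * bker n :: 'a fps) (UNIV - {0})" by (simp add: bmom_def)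
  also have "\<dots> = 2 * fsum (\<lambda>n. gauss (int (Suc n)) * bker (int (Suc n))) UNIV"
    by (rule fsum_even[OF locfin_gauss]) simp
  also have "fsum (\<lambda>n. gauss (int (Suc n)) * bker (int (Suc n)) :: 'a fps) UNIV
      = fsum (\<lambda>n. fsum (\<lambda>d. - of_nat d * ptheta_term d n) UNIV) UNIV"
  proof (rule fsum_cong)
    fix n
    have sq: "nat ((int (Suc n))\<^sup>2) = Suc n * Suc n" by (simp only: power2_eq_square of_nat_mult[symmetric] nat_int)
    have e: "0 < 2 * Suc n" by simp
    have B: "bker (int (Suc n)) = fsum (\<lambda>d. fps_X ^ (2 * Suc n * d) * of_nat d :: 'a fps) UNIV"
      unfolding fsum_geometric(2)[OF e] bker_def geom_def qabs_def
      by (simp add: nat_mult_distrib nat_add_distrib)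
    show "gauss (int (Suc n)) * bker (int (Suc n)) = fsum (\<lambda>d. - of_nat d * ptheta_term d n :: 'a fps) UNIV"
      unfolding B fsum_mult[OF locfin_geometric[OF e], symmetric]
    proof (rule fsum_cong)
      fix d
      show "gauss (int (Suc n)) * (fps_X ^ (2 * Suc n * d) * of_nat d) = - of_nat d * (ptheta_term d n :: 'a fps)"
        unfolding gauss_def sq ptheta_term_def power_add by (simp only: minus_mult_minus minus_mult_left[symmetric] minus_mult_right[symmetric] minus_minus mult_ac)
    qed
  qed
  also have "\<dots> = fsum (\<lambda>(n, d). - of_nat d * ptheta_term d n) (UNIV \<times> UNIV)"
    by (rule fsum_fsum) (rule locfin_ptheta_term_pairs)
  also have "\<dots> = fsum (\<lambda>p. (\<lambda>(n, d). - of_nat d * ptheta_term d n) (prod.swap p)) (UNIV \<times> UNIV)"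
    by (rule fsum_reindex) (auto simp: bij_betw_def)
  also have "\<dots> = fsum (\<lambda>(d, n). - of_nat d * ptheta_term d n) (UNIV \<times> UNIV)"
    by (rule fsum_cong) auto
  also have "\<dots> = fsum (\<lambda>d. fsum (\<lambda>n. - of_nat d * ptheta_term d n) UNIV) UNIV"
  proof (rule fsum_fsum[symmetric])
    have "locfin (\<lambda>p. (\<lambda>(n, d). - of_nat d * ptheta_term d n) (prod.swap p) :: 'a fps) (UNIV \<times> UNIV)"
      by (rule locfin_reindex[OF locfin_ptheta_term_pairs]) (auto simp: bij_betw_def)
    then show "locfin (\<lambda>(d, n). - of_nat d * ptheta_term d n :: 'a fps) (UNIV \<times> UNIV)"
      by (simp add: case_prod_beta')
  qed
  also have "\<dots> = fsum (\<lambda>d. - 1 * (of_nat d * ptheta d)) UNIV"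
    unfolding ptheta_def by (rule fsum_cong) (simp only: fsum_mult[OF locfin_ptheta_term], simp)
  also have "\<dots> = - 1 * fsum (\<lambda>d. of_nat d * ptheta d) UNIV"
    by (rule fsum_mult) (rule locfin_ptheta)
  finally show ?thesis by simp
qed

text \<open>The bracket is $[|r| \<ge> j] + [|r| \<ge> j + 1]$, and two consecutive triangular
  numbers add up to a square. If $|r|$ exceeds \<open>K\<close>, every bracket equals 2. The four
  indicators are exactly those that \<open>rank_ge_gf\<close> and \<open>rank_le_gf\<close>
  count.\<close>

lemma sum_sq_steps:
  fixes r :: int
  shows "(\<Sum>j=1..K. int j * (2 - of_bool (r \<le> int j - 1) - of_bool (r \<le> int j)
      + of_bool (r \<le> - int j - 1) + of_bool (r \<le> - int j)))
    = (if \<bar>r\<bar> \<le> int K then r\<^sup>2 else int K * (int K + 1))"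
proof (induction K)
  case (Suc K)
  let ?c = "2 - of_bool (r \<le> int (Suc K) - 1) - of_bool (r \<le> int (Suc K))
      + of_bool (r \<le> - int (Suc K) - 1) + of_bool (r \<le> - int (Suc K)) :: int"
  consider "\<bar>r\<bar> \<le> int K" | "\<bar>r\<bar> = int K + 1" | "\<bar>r\<bar> > int K + 1" by linarith
  then have "int (Suc K) * ?c + (if \<bar>r\<bar> \<le> int K then r\<^sup>2 else int K * (int K + 1))
    = (if \<bar>r\<bar> \<le> int (Suc K) then r\<^sup>2 else int (Suc K) * (int (Suc K) + 1))"
  proof cases
    case 1
    then have "?c = 0" by (auto simp: abs_if split: if_splits)
    then show ?thesis using 1 by simp
  next
    case 2
    then have c: "?c = 1" by (auto simp: abs_if split: if_splits)
    have "r\<^sup>2 = \<bar>r\<bar>\<^sup>2" by simp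
    also have "\<dots> = (int K + 1)\<^sup>2" unfolding 2 ..
    finally show ?thesis unfolding c using 2 by (simp add: power2_eq_square algebra_simps)
  next
    case 3
    then have c: "?c = 2" by (auto simp: abs_if split: if_splits)
    show ?thesis unfolding c using 3 by (simp add: algebra_simps)
  qed
  then show ?case using Suc.IH by (simp only: sum.cl_ivl_Suc) (simp add: add.commute)
qed auto

lemma sum_rank_sq:
  "(\<Sum>\<pi>\<in>overpartitions N. (of_int (M2_rank \<pi>) ^ 2 :: 'a::char5_field))
    = (4 * over_gf * fsum (\<lambda>j. of_nat j * ptheta j) UNIV) $ N"
proof -
  let ?O = "overpartitions N"
  let ?h = "\<lambda>j \<pi>. 2 - of_bool (M2_rank \<pi> \<le> int j - 1) - of_bool (M2_rank \<pi> \<le> int j)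
      + of_bool (M2_rank \<pi> \<le> - int j - 1) + of_bool (M2_rank \<pi> \<le> - int j) :: int"
  have rank_gf: "rank_gf i $ N = (of_int (\<Sum>\<pi>\<in>?O. of_bool (M2_rank \<pi> \<le> i)) :: 'a)" for i
    unfolding rank_gf_def by (simp add: of_bool_def sum.inter_filter[symmetric] finite_overpartitions)
  have over_gf: "over_gf $ N = (of_int (\<Sum>\<pi>\<in>?O. 1) :: 'a)" unfolding over_gf_def by simp
  have h: "of_int (\<Sum>\<pi>\<in>?O. ?h j \<pi>) = (4 * over_gf * ptheta j :: 'a fps) $ N" if "0 < j" for j
  proof -
    have "(4 * over_gf * ptheta j :: 'a fps) = (2 * over_gf - rank2_gf (int j - 1)) + rank2_gf (- int j - 1)"
      unfolding rank_ge_gf[OF that] rank_le_gf[OF that] by (simp add: algebra_simps)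
    also have "\<dots> $ N = 2 * over_gf $ N - rank_gf (int j - 1) $ N - rank_gf (int j) $ N + rank_gf (- int j - 1) $ N + rank_gf (- int j) $ N"
      unfolding rank2_gf_def by (simp add: numeral_fps_const)
    also have "\<dots> = of_int (\<Sum>\<pi>\<in>?O. ?h j \<pi>)"
      unfolding rank_gf over_gf by (simp add: sum.distrib sum_subtractf)
    finally show ?thesis by simp
  qed
  have rank: "\<bar>M2_rank \<pi>\<bar> \<le> int N" if "\<pi> \<in> ?O" for \<pi>
    using stat_le[OF that] unfolding M2_rank_level by linarith
  have "(\<Sum>\<pi>\<in>?O. (of_int (M2_rank \<pi>) ^ 2 :: 'a)) = of_int (\<Sum>\<pi>\<in>?O. (M2_rank \<pi>)\<^sup>2)"
    by (simp only: of_int_sum of_int_power)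
  \<comment> \<open>Truncating the sum over \<open>j\<close> at \<open>N\<close> is exact, since the
    rank is at most \<open>N\<close> in absolute value.\<close>
  also have "(\<Sum>\<pi>\<in>?O. (M2_rank \<pi>)\<^sup>2) = (\<Sum>\<pi>\<in>?O. \<Sum>j=1..N. int j * ?h j \<pi>)"
    by (rule sum.cong[OF refl]) (simp only: sum_sq_steps rank if_True)
  also have "\<dots> = (\<Sum>j=1..N. int j * (\<Sum>\<pi>\<in>?O. ?h j \<pi>))"
    unfolding sum_distrib_left by (rule sum.swap)
  also have "of_int \<dots> = (\<Sum>j=1..N. of_nat j * of_int (\<Sum>\<pi>\<in>?O. ?h j \<pi>) :: 'a)"
    by (simp only: of_int_sum of_int_mult of_int_of_nat_eq)
  also have "\<dots> = (\<Sum>j=1..N. of_nat j * (4 * over_gf * ptheta j :: 'a fps) $ N)"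
    by (rule sum.cong[OF refl], subst h) auto
  also have "\<dots> = (\<Sum>j=1..N. (4 * over_gf * (of_nat j * ptheta j :: 'a fps)) $ N)"
  proof (rule sum.cong)
    fix j
    have "4 * over_gf * (of_nat j * ptheta j) = fps_const (of_nat j) * (4 * over_gf * ptheta j :: 'a fps)"
      unfolding fps_of_nat by (simp only: mult_ac)
    then show "of_nat j * (4 * over_gf * ptheta j :: 'a fps) $ N = (4 * over_gf * (of_nat j * ptheta j :: 'a fps)) $ N"
      by (simp only: fps_mult_left_const_nth)
  qed simp
  also have "\<dots> = fsum (\<lambda>j. 4 * over_gf * (of_nat j * ptheta j :: 'a fps)) UNIV $ N"
  proof (rule fsum_nth[symmetric])
    fix j assume "j \<in> UNIV - {1..N}"
    then consider "j = 0" | "N < 2 * j + 1" by force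
    then show "(4 * over_gf * (of_nat j * ptheta j :: 'a fps)) $ N = 0"
    proof cases
      case 2
      have "4 * over_gf * (of_nat j * ptheta j :: 'a fps) = fps_X ^ (2 * j + 1) * (4 * over_gf * (of_nat j * (1 - ptheta (Suc j))))"
        by (subst ptheta_rec) (simp only: mult_ac)
      then show ?thesis using 2 by (simp only: fps_X_power_mult_nth if_True)
    qed simp
  qed simp_all
  also have "\<dots> = (4 * over_gf * fsum (\<lambda>j. of_nat j * ptheta j) UNIV) $ N"
    unfolding fsum_mult[OF locfin_ptheta] ..
  finally show ?thesis .
qed

lemma sum_length_rank_gf:
  "(\<Sum>\<pi>\<in>overpartitions N. of_nat (length \<pi>) * of_int (M2_rank \<pi>)) = ((over_gf * bmom 0) $ N :: 'a::char5_field)"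
proof -
  have "2 * (\<Sum>\<pi>\<in>overpartitions N. of_nat (length \<pi>) * of_int (M2_rank \<pi>))
      = (- ((4 * over_gf * fsum (\<lambda>j. of_nat j * ptheta j) UNIV) $ N) :: 'a)"
    unfolding sum_length_rank sum_rank_sq ..
  also have "\<dots> = (2 * (over_gf * bmom 0)) $ N"
    unfolding bmom_0_ptheta by (simp add: mult_ac flip: fps_neg_nth)
  finally show ?thesis using two_neq_0[where 'a='a] by (simp add: numeral_fps_const)
qed

text \<open>With the zero statistic and the bound \<open>2 * k + 1\<close>, both kinds of every size
  up to \<open>k\<close> are allowed. Size $i$ contributes $(1 + q^i)/(1 - q^i) = (1 - q^{2i})/(1 -
  q^i)^2$.\<close>

lemma over_gf_product: "over_gf * (qinf 1 * qinf 1) = (qinf 2 :: 'a::char5_field fps)"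
proof (rule fps_ext)
  fix N
  define g where "g k = (key_gf (\<lambda>_. 0) (2 * k + 1) $ 0 :: 'a fps)" for k
  have g0: "g 0 = 1" by (simp add: g_def key_gf_1)
  have g_Suc: "g (Suc k) * (1 - fps_X ^ Suc k) = g k * (1 + fps_X ^ Suc k)" for k
  proof -
    have n: "2 * (k + 1) + 1 = 2 * Suc k + 1" "2 * (k + 1) = 2 * k + 2" "k + 1 = Suc k" by simp_all
    have c: "(1 - fps_X ^ 0 * qq ^ Suc k) $ 0 = (1 - fps_X ^ Suc k :: 'a fps)"
      "(1 + fps_X ^ 0 * qq ^ Suc k) $ 0 = (1 + fps_X ^ Suc k :: 'a fps)"
      by (simp_all add: qq_def fps_const_power)
    have "key_gf (\<lambda>_. 0) (2 * k + 2) $ 0 * (1 - fps_X ^ Suc k) = g k"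
      using arg_cong[OF key_gf_plain[of "\<lambda>_. 0" k, where 'a='a], of "\<lambda>f. f $ 0"]
      unfolding g_def fps_mult_nth_0 n(3) c .
    moreover have "g (Suc k) = key_gf (\<lambda>_. 0) (2 * k + 2) $ 0 * (1 + fps_X ^ Suc k)"
      using arg_cong[OF key_gf_over[of "k + 1" "\<lambda>_. 0", where 'a='a], of "\<lambda>f. f $ 0"]
      unfolding n(1,2) unfolding g_def fps_mult_nth_0 n(3) c by simp
    moreover have "key_gf (\<lambda>_. 0) (2 * k + 2) $ 0 * (1 + x) * (1 - x) = key_gf (\<lambda>_. 0) (2 * k + 2) $ 0 * (1 - x) * (1 + x)" for x :: "'a fps"
      by (simp only: mult_ac)
    ultimately show ?thesis by simp
  qed
  have g: "g k * (qpoch 1 k * qpoch 1 k) = qpoch 2 k" for k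
  proof (induction k)
    case 0
    then show ?case by (simp add: g0)
  next
    case (Suc k)
    let ?x = "fps_X ^ Suc k :: 'a fps"
    have "g (Suc k) * (qpoch 1 (Suc k) * qpoch 1 (Suc k)) = (g (Suc k) * (1 - ?x)) * (1 - ?x) * (qpoch 1 k * qpoch 1 k)"
      unfolding qpoch_Suc mult_1 by (simp only: mult_ac)
    also have "\<dots> = (g k * (qpoch 1 k * qpoch 1 k)) * ((1 + ?x) * (1 - ?x))"
      unfolding g_Suc by (simp only: mult_ac)
    also have "(1 + ?x) * (1 - ?x) = 1 - fps_X ^ (2 * Suc k)"
    proof -
      have "fps_X ^ (2 * Suc k) = ?x * ?x" unfolding power_add[symmetric] mult_2 ..
      then show ?thesis by (simp only: ring_distribs mult_1 mult_1_right) simp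
    qed
    finally show ?case unfolding Suc.IH qpoch_Suc .
  qed
  have "eqm (Suc N) over_gf (g N)"
    unfolding eqm_def
  proof (intro allI impI)
    fix j assume "j < Suc N"
    then have "key_bounded (2 * N + 1) j = overpartitions j" by (intro key_bounded_large) simp
    moreover have "stat (\<lambda>_. 0) \<pi> = 0" for \<pi> by (simp add: stat_def)
    ultimately show "over_gf $ j = (g N $ j :: 'a)" unfolding over_gf_def g_def key_gf_nth by simp
  qed
  then have "eqm (Suc N) (over_gf * (qinf 1 * qinf 1)) (g N * (qpoch 1 N * qpoch 1 N) :: 'a fps)"
    by (intro eqm_mult qinf_eqm) simp_all
  moreover have "eqm (Suc N) (qinf 2) (qpoch 2 N :: 'a fps)" by (rule qinf_eqm) simp
  ultimately show "(over_gf * (qinf 1 * qinf 1)) $ N = (qinf 2 :: 'a fps) $ N" unfolding g by (simp add: eqm_def)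
qed

lemma sum_length_rank_eq_0:
  assumes "N mod 5 = 2"
  shows "(\<Sum>\<pi>\<in>overpartitions N. of_nat (length \<pi>) * of_int (M2_rank \<pi>)) = (0 :: 'a::char5_field)"
  unfolding sum_length_rank_gf
  by (rule appell_M0_coeff[OF over_gf_theta assms lattice_sum_coeff[OF over_gf_product assms]])

section \<open>Reduction modulo 5\<close>

text \<open>\<open>mod_ring\<close> takes its modulus from the cardinality of a type; the class and
  the type \<open>five\<close> below provide the field with five elements as an instance of
  \<open>char5_field\<close>.\<close>

class card_five = prime_card +
  assumes card_five: "CARD('a) = 5"

instance mod_ring :: (card_five) char5_field
proof
  have "CHAR('a mod_ring) = 5" by (simp add: card_five)
  then show "5 = (0 :: 'a mod_ring)" using of_nat_CHAR[where 'a="'a mod_ring"] by simp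
qed

typedef five = "{0..<5 :: nat}" by (rule exI[of _ 0]) simp

instance five :: card_five
proof
  show "CARD(five) = 5" using type_definition.card[OF type_definition_five] by simp
  then show "prime CARD(five)" by simp
qed

lemma of_int_mod_ring_five: "of_int k = (0 :: five mod_ring) \<longleftrightarrow> 5 dvd k"
  using of_int_eq_0_iff_char_dvd[of k, where 'a="five mod_ring"] by (simp add: card_five)

lemma weighted_NT2:
  "[int (NT2 1 5 N) - int (NT2 4 5 N) + 2 * int (NT2 2 5 N) - 2 * int (NT2 3 5 N)
    = (\<Sum>\<pi>\<in>overpartitions N. int (length \<pi>) * M2_rank \<pi>)] (mod 5)"
proof -
  let ?O = "overpartitions N"
  let ?b = "\<lambda>b \<pi>. of_bool ([M2_rank \<pi> = b] (mod 5)) :: int"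
  have NT: "int (NT2 b 5 N) = (\<Sum>\<pi>\<in>?O. int (length \<pi>) * ?b b \<pi>)" for b
    unfolding NT2_def
    by (simp add: of_bool_def sum.inter_filter[symmetric] finite_overpartitions if_distrib cong: if_cong)
  have "int (NT2 1 5 N) - int (NT2 4 5 N) + 2 * int (NT2 2 5 N) - 2 * int (NT2 3 5 N)
    = (\<Sum>\<pi>\<in>?O. int (length \<pi>) * (?b 1 \<pi> - ?b 4 \<pi> + 2 * ?b 2 \<pi> - 2 * ?b 3 \<pi>))"
    unfolding NT by (simp add: sum.distrib sum_subtractf sum_distrib_left algebra_simps)
  moreover have "[?b 1 \<pi> - ?b 4 \<pi> + 2 * ?b 2 \<pi> - 2 * ?b 3 \<pi> = M2_rank \<pi>] (mod 5)" for \<pi>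
  proof -
    have "M2_rank \<pi> mod 5 \<in> {0, 1, 2, 3, 4}" by auto
    then show ?thesis unfolding cong_def by (elim insertE) auto
  qed
  ultimately show ?thesis by (simp only: cong_sum cong_mult cong_refl)
qed

theorem theorem1p1:
  fixes n :: nat
  shows "[int (NT2 1 5 (5 * n + 2)) - int (NT2 4 5 (5 * n + 2))
          + 2 * int (NT2 2 5 (5 * n + 2)) - 2 * int (NT2 3 5 (5 * n + 2)) = 0] (mod 5)"
proof -
  let ?S = "\<Sum>\<pi>\<in>overpartitions (5 * n + 2). int (length \<pi>) * M2_rank \<pi>"
  have "of_int ?S = (\<Sum>\<pi>\<in>overpartitions (5 * n + 2). of_nat (length \<pi>) * of_int (M2_rank \<pi>) :: five mod_ring)"
    by simp
  also have "\<dots> = 0" by (rule sum_length_rank_eq_0) presburger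
  finally have "[?S = 0] (mod 5)" by (simp only: of_int_mod_ring_five cong_0_iff)
  with weighted_NT2 show ?thesis by (rule cong_trans)
qed

end
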